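(* Let $\mathcal{O}_{-11}=\mathbb{Z}[\omega]$, $\omega=(-1+\sqrt{-11})/2$, and let $\pi=\sqrt{-11}=1+2\omega$. The congruence subgroup $\mathrm{P}\Gamma_0(\pi)\subset\mathrm{PSL}_2(\mathcal{O}_{-11})$ of elements with lower left entry in $\langle\sqrt{-11}\rangle$ has a Ford fundamental domain bounded (besides vertical sides bounding a fundamental domain for the stabilizer of $\infty$) by the isometric spheres of radius $1/\sqrt{11}$ centered at $j/\sqrt{-11}$ for $j=\pm1,\pm2,\pm3,\pm4,\pm5$, along with four spheres of radius $1/\sqrt{33}$ centered at $\pm 1/(\omega\sqrt{-11})$ and $\pm1/((\omega+1)\sqrt{-11})$. The vertices of this domain are at $0$ and $\infty$, and the finite vertices above $(j\pm z_1)/\sqrt{-11}$, $(j\pm z_2)/\sqrt{-11}$ and $(j\pm z_3)/\sqrt{-11}$ for $-5\le j\le5$, at height $\sqrt2/11$.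
   Context: $\mathbb{H}^3$ is upper half-space over $\mathbb{C}$. For $\gamma=\begin{pmatrix}a&b\\c&d\end{pmatrix}\in\mathrm{PSL}_2(\mathbb{C})$ with $c\neq0$, the isometric sphere $S_\gamma$ is the hemisphere with center $-d/c$ and radius $1/|c|$. For a discrete group $\mathrm{P}\Gamma$, $\mathrm{P}\Gamma_\infty$ is the subgroup of elements fixing $\infty$; a Ford fundamental domain for $\mathrm{P}\Gamma$ is the intersection of the region $B\subset\mathbb{H}^3$ exterior to all isometric spheres of elements of $\mathrm{P}\Gamma$ with a fundamental domain for the action of $\mathrm{P}\Gamma_\infty$. $z_1=\frac{3}{11}+\frac{6\omega}{11}=\frac{3i}{\sqrt{11}}$, $z_2=-\frac{3}{11}+\frac{5\omega}{11}=-\frac12+\frac{5i}{2\sqrt{11}}$, $z_3=\frac{8}{11}+\frac{5\omega}{11}=\frac12+\frac{5i}{2\sqrt{11}}$. *)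

theory Defs
  imports "HOL-Analysis.Analysis" "HOL-Algebra.Coset"
begin

section \<open>Hyperbolic upper half-space\<close>

definition H3 :: "(complex \<times> real) set" where
  "H3 = {p. snd p > 0}"

text \<open>Euclidean hemisphere orthogonal to the boundary plane; \<open>w\<close> is a boundary point.\<close>

definition hemisphere :: "complex \<Rightarrow> real \<Rightarrow> (complex \<times> real) set" where
  "hemisphere w r = H3 \<inter> sphere (w, 0) r"

definition vertical_planes :: "(complex \<times> real) set set" where
  "vertical_planes = {{p \<in> H3. inner u (fst p) = k} | u k. u \<noteq> 0}"

definition hyperbolic_planes :: "(complex \<times> real) set set" where
  "hyperbolic_planes = {hemisphere w r | w r. r > 0} \<union> vertical_planes"

text \<open>
  Closure in the one-point compactification of \<open>\<complex> \<times> \<real>\<close>, in which closed hyperbolic space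
  \<open>H3 \<union> \<complex> \<union> {\<infinity>}\<close> is embedded.  The boundary point \<open>w\<close> is \<open>Some (w, 0)\<close> and \<open>\<infinity>\<close> is \<open>None\<close>.
\<close>

definition ideal_closure :: "(complex \<times> real) set \<Rightarrow> (complex \<times> real) option set" where
  "ideal_closure X = Alexandroff_compactification euclidean closure_of (Some ` X)"

section \<open>Sides and vertices of (not necessarily convex) polyhedral domains\<close>

text \<open>
  The part of the boundary of \<open>F\<close> lying in the plane \<open>H\<close>.  Taking the interior relative to \<open>H\<close>
  first discards planes that meet the boundary only along edges or vertices.  It may be
  disconnected, since \<open>F\<close> need not be convex.
\<close>

definition face :: "(complex \<times> real) set \<Rightarrow> (complex \<times> real) set \<Rightarrow> (complex \<times> real) set" where
  "face F H = top_of_set H closure_of (top_of_set H interior_of (H \<inter> frontier F))"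

definition side_planes :: "(complex \<times> real) set \<Rightarrow> (complex \<times> real) set set" where
  "side_planes F = {H \<in> hyperbolic_planes. face F H \<noteq> {}}"

definition bounded_by :: "(complex \<times> real) set \<Rightarrow> (complex \<times> real) set set \<Rightarrow> bool" where
  "bounded_by F \<H> \<longleftrightarrow>
     finite \<H> \<and> side_planes F = \<H> \<and> H3 \<inter> frontier F = (\<Union>H\<in>\<H>. face F H)"

text \<open>
  A point, finite or ideal, is a vertex if it is the only common point of the planes carrying the
  faces that reach it.  At a point inside an edge these planes share the whole geodesic of the
  edge; at a point inside a face there is just one plane.
\<close>

definition vertices :: "(complex \<times> real) set \<Rightarrow> (complex \<times> real) option set" where
  "vertices F = {p. \<Inter> {ideal_closure H | H. H \<in> side_planes F \<and> p \<in> ideal_closure (face F H)} = {p}}"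

section \<open>Special and projective special linear groups over subrings of the complex numbers\<close>

definition SL2 :: "complex set \<Rightarrow> (complex^2^2) monoid" where
  "SL2 R = \<lparr>carrier = {A. (\<forall>i j. A $ i $ j \<in> R) \<and> det A = 1}, mult = (**), one = mat 1\<rparr>"

text \<open>Elements of \<open>PSL2 R\<close> are the cosets \<open>{A, - A}\<close>.\<close>

definition PSL2 :: "complex set \<Rightarrow> (complex^2^2) set monoid" where
  "PSL2 R = SL2 R Mod {mat 1, - mat 1}"

text \<open>Action of a matrix on the Riemann sphere, with \<open>None\<close> for \<open>\<infinity>\<close>.\<close>

definition mobius :: "complex^2^2 \<Rightarrow> complex option \<Rightarrow> complex option" where
  "mobius A x = (case x of
       None \<Rightarrow> (if A$2$1 = 0 then None else Some (A$1$1 / A$2$1))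
     | Some z \<Rightarrow> (if A$2$1 * z + A$2$2 = 0 then None
                 else Some ((A$1$1 * z + A$1$2) / (A$2$1 * z + A$2$2))))"

text \<open>Poincare extension of the Moebius action to upper half-space.\<close>

definition poincare :: "complex^2^2 \<Rightarrow> complex \<times> real \<Rightarrow> complex \<times> real" where
  "poincare A = (\<lambda>(z, t).
     let a = A$1$1; b = A$1$2; c = A$2$1; d = A$2$2;
         N = (cmod (c * z + d))\<^sup>2 + (cmod c)\<^sup>2 * t\<^sup>2
     in (((a * z + b) * cnj (c * z + d) + a * cnj c * of_real (t\<^sup>2)) / of_real N, t / N))"

text \<open>Image under an element of \<open>PSL2\<close>; both representatives \<open>A\<close> and \<open>- A\<close> give the same image.\<close>

definition psl_image :: "(complex^2^2) set \<Rightarrow> (complex \<times> real) set \<Rightarrow> (complex \<times> real) set" where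
  "psl_image \<gamma> X = (\<Union>A\<in>\<gamma>. poincare A ` X)"

section \<open>Ford domains\<close>

definition stab_infinity :: "(complex^2^2) set set \<Rightarrow> (complex^2^2) set set" where
  "stab_infinity G = {\<gamma> \<in> G. \<forall>A\<in>\<gamma>. mobius A None = None}"

definition isometric_sphere :: "complex^2^2 \<Rightarrow> (complex \<times> real) set" where
  "isometric_sphere A = hemisphere (- A$2$2 / A$2$1) (1 / cmod (A$2$1))"

definition isometric_spheres :: "(complex^2^2) set set \<Rightarrow> (complex \<times> real) set set" where
  "isometric_spheres G = {isometric_sphere A | A. A \<in> \<Union>G \<and> A$2$1 \<noteq> 0}"

text \<open>The points of \<open>H3\<close> outside or on all isometric spheres: domains are taken to be closed.\<close>

definition ford_exterior :: "(complex^2^2) set set \<Rightarrow> (complex \<times> real) set" where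
  "ford_exterior G =
     {p \<in> H3. \<forall>A\<in>\<Union>G. A$2$1 \<noteq> 0 \<longrightarrow> p \<notin> ball (- A$2$2 / A$2$1, 0) (1 / cmod (A$2$1))}"

definition fundamental_domain :: "(complex^2^2) set set \<Rightarrow> (complex \<times> real) set \<Rightarrow> bool" where
  "fundamental_domain G D \<longleftrightarrow>
     D = H3 \<inter> closure (interior D) \<and>
     connected (interior D) \<and>
     (\<Union>\<gamma>\<in>G. psl_image \<gamma> D) = H3 \<and>
     (\<forall>\<gamma>\<in>G. \<forall>\<delta>\<in>G. \<gamma> \<noteq> \<delta> \<longrightarrow> psl_image \<gamma> (interior D) \<inter> psl_image \<delta> (interior D) = {})"

section \<open>The congruence subgroup of level \<open>\<surd>-11\<close>\<close>

text \<open>\<open>csqrt\<close> is the principal branch, so \<open>\<theta> = \<i> * sqrt 11\<close>; it is the generator written \<open>\<pi>\<close>.\<close>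

definition \<theta> :: complex where
  "\<theta> = csqrt (- 11)"

definition \<omega> :: complex where
  "\<omega> = (- 1 + \<theta>) / 2"

definition O11 :: "complex set" where
  "O11 = {of_int m + of_int n * \<omega> | m n. True}"

definition Gamma0 :: "(complex^2^2) set" where
  "Gamma0 = {A \<in> carrier (SL2 O11). A$2$1 \<in> {\<theta> * x | x. x \<in> O11}}"

definition PGamma0 :: "(complex^2^2) set set" where
  "PGamma0 = {{mat 1, - mat 1} #>\<^bsub>SL2 O11\<^esub> A | A. A \<in> Gamma0}"

definition z1 :: complex where "z1 = 3 / 11 + 6 * \<omega> / 11"
definition z2 :: complex where "z2 = - 3 / 11 + 5 * \<omega> / 11"
definition z3 :: complex where "z3 = 8 / 11 + 5 * \<omega> / 11"

definition bounding_spheres :: "(complex \<times> real) set set" where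
  "bounding_spheres =
      {hemisphere (of_int j / \<theta>) (1 / sqrt 11) | j. j \<in> {-5..5} - {0 :: int}}
    \<union> {hemisphere (s / (\<omega> * \<theta>)) (1 / sqrt 33) | s. s \<in> {1, -1}}
    \<union> {hemisphere (s / ((\<omega> + 1) * \<theta>)) (1 / sqrt 33) | s. s \<in> {1, -1}}"

lemma theta_omega: "\<theta> = \<i> * of_real (sqrt 11)" "\<theta> = 1 + 2 * \<omega>"
  using csqrt_of_real_nonpos[of "-11"] by (simp_all add: \<theta>_def \<omega>_def field_simps)

lemma z_cartesian:
  "z1 = 3 * \<i> / of_real (sqrt 11)"
  "z2 = - 1 / 2 + 5 * \<i> / (2 * of_real (sqrt 11))"
  "z3 = 1 / 2 + 5 * \<i> / (2 * of_real (sqrt 11))"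
proof -
  have "complex_of_real (sqrt 11) * complex_of_real (sqrt 11) = 11"
    by (simp flip: of_real_mult)
  then have s: "1 / complex_of_real (sqrt 11) = complex_of_real (sqrt 11) / 11"
    by (auto simp: field_simps)
  have w: "\<omega> = (- 1 + \<i> * of_real (sqrt 11)) / 2"
    by (simp add: \<omega>_def theta_omega(1))
  have q: "x / complex_of_real (sqrt 11) = x * of_real (sqrt 11) / 11" for x
    using s by (metis mult.right_neutral times_divide_eq_right)
  have q2: "x / (2 * complex_of_real (sqrt 11)) = x * of_real (sqrt 11) / 22" for x
    using q[of "x / 2"] by simp
  show "z1 = 3 * \<i> / of_real (sqrt 11)"
    "z2 = - 1 / 2 + 5 * \<i> / (2 * of_real (sqrt 11))"
    "z3 = 1 / 2 + 5 * \<i> / (2 * of_real (sqrt 11))"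
    unfolding q q2 z1_def z2_def z3_def w by (simp_all add: field_simps)
qed

end

theory Submission
  imports Defs
begin

text \<open>
  Multiplication by \<open>\<theta>\<close> turns the spheres of radius \<open>1 / sqrt 11\<close> into unit spheres around the
  elements of \<open>O11\<close> outside the ideal of \<open>\<theta>\<close>.  The Voronoi cells of \<open>O11\<close> are hexagons with
  vertices in \<open>O11 \<plusminus> z1\<close>, and the eleven hexagons around \<open>-5, \<dots>, 5\<close> tile the plane under
  translation by the ideal.  Up to the common term \<open>- |w|\<^sup>2\<close> the squared height of every isometric
  sphere is an affine function, so it suffices to compare spheres at the corners of a
  triangulation of the row of hexagons: at the cusp \<open>0\<close>, which no sphere covers, and at the hexagon
  vertices, where a congruence modulo 11 shows that no sphere rises above squared height \<open>2 / 11\<close>.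
  Around \<open>0\<close>, where there is no unit sphere, the hexagon is cut into triangles lying under the two
  neighbouring unit spheres and the four smaller ones.
\<close>

section \<open>Hyperbolic planes and faces\<close>

text \<open>Sides and vertices are defined by quantifying over all hyperbolic planes and all ideal
  points, so exhibiting the spheres and corners is not enough: no further plane may carry a face and
  no further point may be a vertex. The boundary is therefore listed as finitely many pairs of a
  plane and a regularly closed piece in it. Distinct hyperbolic planes share no relatively open
  part, so such a list determines every face. A point is shown not to be a vertex by moving it along
  a curve that stays in all planes active there. Hexagons are used because the zigzag border then
  runs from one floor vertex to the next; a straight border could cut the floor in additional
  vertices. The constant 2/11 is \<open>1 - |z1|\<^sup>2\<close>, the squared height of a unit
  sphere over a hexagon vertex; dividing by \<open>|\<theta>|\<^sup>2 = 11\<close> gives the square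
  of \<open>sqrt 2 / 11\<close>. Since \<open>z2 = \<omega> - z1\<close> and
  \<open>z3 = 1 + \<omega> - z1\<close>, one congruence serves all vertices. The cusp 0 stays
  uncovered because a sphere around it would need \<open>d = 0\<close>, which is impossible when
  \<theta> divides \<open>c\<close> and the determinant is 1.\<close>

lemma Some_in_ideal_closure [simp]: "Some p \<in> ideal_closure S \<longleftrightarrow> p \<in> closure S"
proof
  assume L: "Some p \<in> ideal_closure S"
  show "p \<in> closure S"
    unfolding closure_iff_nhds_not_empty
  proof (intro allI impI)
    fix A V :: "(complex \<times> real) set"
    assume "V \<subseteq> A" "open V" "p \<in> V"
    then have "openin (Alexandroff_compactification euclidean) (Some ` V)" "Some p \<in> Some ` V"
      by auto
    with L have "\<exists>y. y \<in> Some ` S \<and> y \<in> Some ` V"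
      unfolding ideal_closure_def in_closure_of by blast
    with \<open>V \<subseteq> A\<close> show "S \<inter> A \<noteq> {}" by blast
  qed
next
  assume R: "p \<in> closure S"
  show "Some p \<in> ideal_closure S"
    unfolding ideal_closure_def in_closure_of
  proof (intro conjI allI impI)
    fix T assume T: "Some p \<in> T \<and> openin (Alexandroff_compactification euclidean) T"
    then have "openin euclidean {x \<in> topspace euclidean. Some x \<in> T}"
      using continuous_map_Some[of euclidean] unfolding continuous_map_def by blast
    then have "open {x. Some x \<in> T}" by simp
    with R T obtain q where "q \<in> S" "Some q \<in> T"
      unfolding closure_iff_nhds_not_empty by blast
    then show "\<exists>y. y \<in> Some ` S \<and> y \<in> T" by blast
  qed auto
qed

text \<open>Neighbourhoods of \<open>None\<close> are complements of compact sets. The closure of a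
  bounded \<open>S\<close> is such a compact set, and an unbounded \<open>S\<close> fits into
  none.\<close>

lemma None_in_ideal_closure [simp]: "None \<in> ideal_closure S \<longleftrightarrow> \<not> bounded S"
proof
  assume L: "None \<in> ideal_closure S"
  show "\<not> bounded S"
  proof
    assume "bounded S"
    then have "compact (closure S)" by simp
    define T where "T = insert None (Some ` (UNIV - closure S))"
    have "openin (Alexandroff_compactification euclidean) T"
      unfolding T_def openin_Alexandroff_compactification
      using \<open>compact (closure S)\<close> by (auto intro!: exI[of _ "closure S"])
    then have "\<exists>y. y \<in> Some ` S \<and> y \<in> T"
      using L unfolding ideal_closure_def in_closure_of T_def by blast
    then show False unfolding T_def using closure_subset by fastforce
  qed
next
  assume R: "\<not> bounded S"
  show "None \<in> ideal_closure S"
    unfolding ideal_closure_def in_closure_of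
  proof (intro conjI allI impI)
    fix T :: "(complex \<times> real) option set"
    assume T: "None \<in> T \<and> openin (Alexandroff_compactification euclidean) T"
    then obtain C :: "(complex \<times> real) set" where C: "compact C" "T = insert None (Some ` (UNIV - C))"
      unfolding openin_Alexandroff_compactification by auto
    have "\<not> S \<subseteq> C" using R bounded_subset compact_imp_bounded C(1) by blast
    then show "\<exists>y. y \<in> Some ` S \<and> y \<in> T" using C R by auto
  qed auto
qed

lemma ideal_closure_mono: "S \<subseteq> T \<Longrightarrow> ideal_closure S \<subseteq> ideal_closure T"
  unfolding ideal_closure_def by (intro closure_of_mono image_mono)

lemma ideal_closure_Union:
  assumes "finite \<A>"
  shows "ideal_closure (\<Union>\<A>) = (\<Union>S\<in>\<A>. ideal_closure S)"
  using closure_of_Union[of "(`) Some ` \<A>" "Alexandroff_compactification euclidean"] assms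
  by (simp add: ideal_closure_def image_Union)

text \<open>\<open>\<kappa> = 1\<close> gives the hemispheres and \<open>\<kappa> = 0\<close> the vertical planes.\<close>

definition quadric :: "real \<Rightarrow> complex \<Rightarrow> real \<Rightarrow> (complex \<times> real) set" where
  "quadric \<kappa> u k = {(z, t). t > 0 \<and> \<kappa> * ((cmod z)\<^sup>2 + t\<^sup>2) + inner u z = k}"

lemma mem_hemisphere:
  "(z, t) \<in> hemisphere w r \<longleftrightarrow> 0 < t \<and> 0 \<le> r \<and> (cmod (z - w))\<^sup>2 + t\<^sup>2 = r\<^sup>2"
proof -
  have "dist (w, 0) (z, t) = sqrt ((cmod (z - w))\<^sup>2 + t\<^sup>2)"
    by (simp add: dist_norm norm_Pair norm_minus_commute)
  then show ?thesis
    unfolding hemisphere_def H3_def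
    by (auto simp: real_sqrt_eq_iff intro: real_sqrt_unique)
qed

lemma hemisphere_quadric:
  assumes "r \<ge> 0"
  shows "hemisphere w r = quadric 1 (- 2 *\<^sub>R w) (r\<^sup>2 - (cmod w)\<^sup>2)"
proof (rule Set.set_eqI)
  fix p :: "complex \<times> real"
  obtain z t where p: "p = (z, t)" by (cases p)
  have "(cmod (z - w))\<^sup>2 = (cmod z)\<^sup>2 - 2 * inner w z + (cmod w)\<^sup>2"
    by (simp add: power2_norm_eq_inner inner_simps inner_commute)
  then show "p \<in> hemisphere w r \<longleftrightarrow> p \<in> quadric 1 (- 2 *\<^sub>R w) (r\<^sup>2 - (cmod w)\<^sup>2)"
    using assms by (auto simp: p mem_hemisphere quadric_def)
qed

lemma vertical_quadric: "{p \<in> H3. inner u (fst p) = k} = quadric 0 u k"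
  by (auto simp: quadric_def H3_def)

lemma hyperbolic_plane_cases:
  assumes "H \<in> hyperbolic_planes"
  obtains \<kappa> u k where "H = quadric \<kappa> u k" "\<kappa> = 0 \<and> u \<noteq> 0 \<or> \<kappa> = 1"
  using assms unfolding hyperbolic_planes_def vertical_planes_def
  by (auto simp: hemisphere_quadric vertical_quadric)

text \<open>For nonzero \<open>v\<close> a short step in the direction \<open>v\<close> changes the
  inner product. This allows coefficients to be compared once two plane equations agree over a
  disc.\<close>

lemma affine_vanishing_on_ball:
  fixes v z0 :: complex
  assumes "e > 0" and van: "\<And>z. dist z0 z < e \<Longrightarrow> inner v z = c"
  shows "v = 0"
proof (rule ccontr)
  assume "v \<noteq> 0"
  define s where "s = e / (2 * norm v)"
  have "s > 0" using \<open>e > 0\<close> \<open>v \<noteq> 0\<close> by (simp add: s_def)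
  have "dist z0 (z0 + s *\<^sub>R v) < e"
    using \<open>e > 0\<close> \<open>v \<noteq> 0\<close> by (simp add: s_def dist_norm)
  then have "inner v (z0 + s *\<^sub>R v) = inner v z0" using van[of z0] van \<open>e > 0\<close> by simp
  then have "s * inner v v = 0" by (simp add: inner_simps)
  with \<open>s > 0\<close> \<open>v \<noteq> 0\<close> show False by simp
qed

text \<open>If the first plane is vertical, moving straight up forces \<open>\<kappa>' = 0\<close>,
  and moving horizontally inside it forces parallel normals. If it is a hemisphere, it is a graph
  over a disc; inserting the graph into the second equation leaves an affine identity, so the second
  equation is \<open>\<kappa>'\<close> times the first.\<close>

lemma quadric_eqI:
  assumes \<kappa>: "\<kappa> = 0 \<and> u \<noteq> 0 \<or> \<kappa> = 1" and \<kappa>': "\<kappa>' = 0 \<and> u' \<noteq> 0 \<or> \<kappa>' = 1"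
    and W: "open W" "quadric \<kappa> u k \<inter> W \<noteq> {}" "quadric \<kappa> u k \<inter> W \<subseteq> quadric \<kappa>' u' k'"
  shows "quadric \<kappa> u k = quadric \<kappa>' u' k'"
proof -
  obtain z0 t0 where p: "(z0, t0) \<in> quadric \<kappa> u k" "(z0, t0) \<in> W" using W(2) by auto
  have t0: "t0 > 0" and eq0: "\<kappa> * ((cmod z0)\<^sup>2 + t0\<^sup>2) + inner u z0 = k"
    using p(1) by (auto simp: quadric_def)
  have eq0': "\<kappa>' * ((cmod z0)\<^sup>2 + t0\<^sup>2) + inner u' z0 = k'"
    using p W(3) by (auto simp: quadric_def)
  show ?thesis
    using \<kappa>
  proof (elim disjE conjE)
    assume "\<kappa> = 0" "u \<noteq> 0"
    \<comment> \<open>\<open>\<i> * u\<close> is \<open>u\<close> turned by a right angle, so this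
      motion, like the vertical one below, stays in the vertical plane.\<close>
    have lim: "((\<lambda>s. (z0 + s *\<^sub>R (\<i> * u), t0)) \<longlongrightarrow> (z0 + 0 *\<^sub>R (\<i> * u), t0)) (at_right (0::real))"
      by (intro tendsto_intros)
    have ev: "eventually (\<lambda>s. (z0 + s *\<^sub>R (\<i> * u), t0) \<in> W) (at_right (0::real))"
      using topological_tendstoD[OF lim W(1)] p(2) by simp
    have perp: "inner u (\<i> * u) = 0" by (simp add: inner_complex_def)
    have lim2: "((\<lambda>s. (z0, t0 + s)) \<longlongrightarrow> (z0, t0 + 0)) (at_right (0::real))"
      by (intro tendsto_intros)
    have ev2: "eventually (\<lambda>s. (z0, t0 + s) \<in> W) (at_right (0::real))"
      using topological_tendstoD[OF lim2 W(1)] p(2) by simp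
    obtain s where s: "s > 0" "(z0, t0 + s) \<in> W"
      using eventually_happens[OF eventually_conj[OF ev2 eventually_at_right_less]]
      by auto
    have "(z0, t0 + s) \<in> quadric \<kappa>' u' k'"
    proof -
      have "(z0, t0 + s) \<in> quadric \<kappa> u k"
        using s t0 eq0 \<open>\<kappa> = 0\<close> by (simp add: quadric_def)
      then show ?thesis using s W(3) by auto
    qed
    then have "\<kappa>' * ((t0 + s)\<^sup>2 - t0\<^sup>2) = 0" using eq0'
      unfolding quadric_def right_diff_distrib by (auto simp: distrib_left)
    moreover have "(t0 + s)\<^sup>2 > t0\<^sup>2" using s t0 by (intro power_strict_mono) auto
    ultimately have "\<kappa>' = 0" by simp
    obtain s where s: "s > 0" "(z0 + s *\<^sub>R (\<i> * u), t0) \<in> W"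
      using eventually_happens[OF eventually_conj[OF ev eventually_at_right_less]]
      by auto
    have "(z0 + s *\<^sub>R (\<i> * u), t0) \<in> quadric \<kappa> u k"
      using t0 eq0 perp \<open>\<kappa> = 0\<close> by (simp add: quadric_def inner_add_right)
    then have "(z0 + s *\<^sub>R (\<i> * u), t0) \<in> quadric \<kappa>' u' k'" using s W(3) by auto
    then have "inner u' (\<i> * u) = 0"
      using eq0' \<open>\<kappa>' = 0\<close> s by (simp add: quadric_def inner_add_right)
    then have par: "Im u' * Re u = Re u' * Im u" by (simp add: inner_complex_def algebra_simps)
    define c where "c = inner u u' / inner u u"
    have "inner u u \<noteq> 0" using \<open>u \<noteq> 0\<close> by simp
    then have "u' = c *\<^sub>R u"
      using par unfolding c_def
      by (simp add: complex_eq_iff inner_complex_def field_simps)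
    moreover have "u' \<noteq> 0" using \<kappa>' \<open>\<kappa>' = 0\<close> by simp
    ultimately have "c \<noteq> 0" by auto
    have "k' = c * k" using eq0 eq0' \<open>\<kappa> = 0\<close> \<open>\<kappa>' = 0\<close> \<open>u' = c *\<^sub>R u\<close> by simp
    then show ?thesis
      using \<open>c \<noteq> 0\<close> unfolding quadric_def \<open>\<kappa> = 0\<close> \<open>\<kappa>' = 0\<close> \<open>u' = c *\<^sub>R u\<close> by simp
  next
    assume "\<kappa> = 1"
    \<comment> \<open>Near \<open>z0\<close> the hemisphere is the graph of
      \<open>sqrt (q z)\<close>; \<open>q\<close> contains exactly the quadratic term that has to
      cancel in the second equation.\<close>
    define q where "q z = k - inner u z - (cmod z)\<^sup>2" for z
    have q0: "q z0 = t0\<^sup>2" using eq0 \<open>\<kappa> = 1\<close> by (simp add: q_def)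
    have "((\<lambda>z. (z, sqrt (q z))) \<longlongrightarrow> (z0, sqrt (q z0))) (nhds z0)"
      unfolding q_def by (intro tendsto_intros filterlim_ident)
    moreover have "(z0, sqrt (q z0)) \<in> W" using p(2) q0 t0 by simp
    ultimately have "\<forall>\<^sub>F z in nhds z0. (z, sqrt (q z)) \<in> W"
      using topological_tendstoD W(1) by blast
    moreover have "\<forall>\<^sub>F z in nhds z0. q z > 0"
    proof (rule order_tendstoD)
      show "(q \<longlongrightarrow> q z0) (nhds z0)" unfolding q_def by (intro tendsto_intros filterlim_ident)
    qed (use q0 t0 in auto)
    ultimately have "\<forall>\<^sub>F z in nhds z0. (z, sqrt (q z)) \<in> W \<and> q z > 0"
      by (rule eventually_conj)
    then obtain e where e: "e > 0" "\<And>z. dist z z0 < e \<Longrightarrow> (z, sqrt (q z)) \<in> W \<and> q z > 0"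
      unfolding eventually_nhds_metric by blast
    have lin: "inner (u' - \<kappa>' *\<^sub>R u) z = k' - \<kappa>' * k" if "dist z0 z < e" for z
    proof -
      have "(z, sqrt (q z)) \<in> quadric \<kappa> u k"
        using e(2)[of z] that \<open>\<kappa> = 1\<close> by (auto simp: quadric_def q_def dist_commute)
      then have "(z, sqrt (q z)) \<in> quadric \<kappa>' u' k'" using e(2)[of z] that W(3)
        by (auto simp: dist_commute)
      then have "\<kappa>' * ((cmod z)\<^sup>2 + q z) + inner u' z = k'"
        using e(2)[of z] that by (auto simp: quadric_def dist_commute)
      then show ?thesis by (simp add: q_def inner_diff_left algebra_simps)
    qed
    then have "u' - \<kappa>' *\<^sub>R u = 0" using affine_vanishing_on_ball[OF \<open>e > 0\<close>] by blast
    moreover from this have "k' = \<kappa>' * k" using lin[of z0] \<open>e > 0\<close> by simp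
    ultimately show ?thesis using \<kappa>' \<open>\<kappa> = 1\<close> by auto
  qed
qed

lemma hyperbolic_plane_eqI:
  assumes "H \<in> hyperbolic_planes" "H' \<in> hyperbolic_planes"
    and "open W" "H \<inter> W \<noteq> {}" "H \<inter> W \<subseteq> H'"
  shows "H = H'"
proof -
  obtain \<kappa> u k where H: "H = quadric \<kappa> u k" "\<kappa> = 0 \<and> u \<noteq> 0 \<or> \<kappa> = 1"
    using hyperbolic_plane_cases[OF assms(1)] .
  obtain \<kappa>' u' k' where H': "H' = quadric \<kappa>' u' k'" "\<kappa>' = 0 \<and> u' \<noteq> 0 \<or> \<kappa>' = 1"
    using hyperbolic_plane_cases[OF assms(2)] .
  show ?thesis
    using quadric_eqI[OF H(2) H'(2)] assms(3-5) unfolding H(1) H'(1) by simp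
qed

lemma closedin_quadric: "closedin (top_of_set H3) (quadric \<kappa> u k)"
proof -
  have "closed {p :: complex \<times> real. \<kappa> * ((cmod (fst p))\<^sup>2 + (snd p)\<^sup>2) + inner u (fst p) = k}"
    by (intro closed_Collect_eq continuous_intros)
  moreover have "quadric \<kappa> u k = H3 \<inter> {p. \<kappa> * ((cmod (fst p))\<^sup>2 + (snd p)\<^sup>2) + inner u (fst p) = k}"
    by (auto simp: quadric_def H3_def)
  ultimately show ?thesis by (simp add: closedin_closed_Int)
qed

lemma closedin_hyperbolic_plane:
  "H \<in> hyperbolic_planes \<Longrightarrow> closedin (top_of_set H3) H"
  by (erule hyperbolic_plane_cases) (simp add: closedin_quadric)

lemma hyperbolic_plane_subset_H3: "H \<in> hyperbolic_planes \<Longrightarrow> H \<subseteq> H3"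
  using closedin_hyperbolic_plane closedin_imp_subset by blast


section \<open>Regularly closed pieces of planes and the faces they form\<close>

definition regular_in :: "(complex \<times> real) set \<Rightarrow> (complex \<times> real) set \<Rightarrow> bool" where
  "regular_in H P \<longleftrightarrow> P = top_of_set H closure_of (top_of_set H interior_of P)"

lemma regular_inI:
  assumes cl: "closedin (top_of_set H) P" and "open W" "H \<inter> W \<subseteq> P" "P \<subseteq> closure (H \<inter> W)"
  shows "regular_in H P"
proof -
  have "H \<inter> W \<subseteq> top_of_set H interior_of P"
    using assms by (intro interior_of_maximal) (auto simp: openin_open)
  then have "top_of_set H closure_of (H \<inter> W) \<subseteq> top_of_set H closure_of (top_of_set H interior_of P)"
    by (rule closure_of_mono)
  moreover have "P \<subseteq> top_of_set H closure_of (H \<inter> W)"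
    using assms closedin_imp_subset[OF cl]
    by (auto simp: closure_of_subtopology Int_absorb1)
  moreover have "top_of_set H closure_of (top_of_set H interior_of P) \<subseteq> P"
    using cl by (intro closure_of_minimal interior_of_subset)
  ultimately show ?thesis unfolding regular_in_def by blast
qed

lemma regular_in_closedin: "regular_in H P \<Longrightarrow> closedin (top_of_set H) P"
  unfolding regular_in_def by (metis closedin_closure_of)

lemma regular_in_Union:
  assumes "finite \<A>" "\<And>P. P \<in> \<A> \<Longrightarrow> regular_in H P"
  shows "regular_in H (\<Union>\<A>)"
proof -
  have "closedin (top_of_set H) (\<Union>\<A>)"
    using assms regular_in_closedin by (intro closedin_Union) auto
  then have "top_of_set H closure_of (top_of_set H interior_of \<Union>\<A>) \<subseteq> \<Union>\<A>"
    by (intro closure_of_minimal interior_of_subset)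
  moreover have "P \<subseteq> top_of_set H closure_of (top_of_set H interior_of \<Union>\<A>)" if "P \<in> \<A>" for P
  proof -
    have "P = top_of_set H closure_of (top_of_set H interior_of P)"
      using assms(2)[OF that] by (simp add: regular_in_def)
    also have "\<dots> \<subseteq> top_of_set H closure_of (top_of_set H interior_of \<Union>\<A>)"
      using that by (intro closure_of_mono interior_of_mono) auto
    finally show ?thesis .
  qed
  ultimately show ?thesis unfolding regular_in_def by blast
qed

text \<open>Locally no plane is covered by finitely many others. Removing from \<open>W\<close> the
  closed set that cuts out one plane \<open>H'\<close> leaves an open set to which the induction
  applies. Hence \<open>H\<close> lies in \<open>H'\<close> alone throughout \<open>W\<close>, and
  the planes would coincide if they met there.\<close>

lemma hyperbolic_plane_nowhere_dense_in:
  assumes "finite \<H>" "\<H> \<subseteq> hyperbolic_planes" "H \<in> hyperbolic_planes" "H \<notin> \<H>"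
    and "open W" "H \<inter> W \<subseteq> \<Union>\<H>"
  shows "H \<inter> W = {}"
  using assms
proof (induction \<H> arbitrary: W rule: finite_induct)
  case (insert H' \<H>)
  have "closedin (top_of_set H3) H'" using insert closedin_hyperbolic_plane by blast
  then obtain C where C: "closed C" "H' = H3 \<inter> C" by (auto simp: closedin_closed)
  have "H \<inter> (W - C) \<subseteq> \<Union>\<H>" using insert.prems C hyperbolic_plane_subset_H3 by fastforce
  moreover have "open (W - C)" using insert.prems C by auto
  ultimately have "H \<inter> (W - C) = {}" using insert by blast
  then have "H \<inter> W \<subseteq> H'" using C hyperbolic_plane_subset_H3[OF insert.prems(2)] by blast
  then show ?case using hyperbolic_plane_eqI[of H H' W] insert.prems by auto
qed auto

text \<open>Pieces are recorded together with their planes because one plane may carry several: the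
  zigzag edges with \<open>s = 1\<close> at \<open>j\<close> and with \<open>s = -1\<close> at
  \<open>j + 6\<close> lie on the same line when the slope is the same.\<close>

locale decomposed_boundary =
  fixes F :: "(complex \<times> real) set" and \<P> :: "((complex \<times> real) set \<times> (complex \<times> real) set) set"
  assumes finite_pieces: "finite \<P>"
    and piece_plane: "(H, P) \<in> \<P> \<Longrightarrow> H \<in> hyperbolic_planes"
    and piece_regular: "(H, P) \<in> \<P> \<Longrightarrow> regular_in H P"
    and piece_nonempty: "(H, P) \<in> \<P> \<Longrightarrow> P \<noteq> {}"
    and boundary: "H3 \<inter> frontier F = \<Union> (snd ` \<P>)"
begin

lemma piece_closedin_H3: "(H, P) \<in> \<P> \<Longrightarrow> closedin (top_of_set H3) P"
  by (meson closedin_hyperbolic_plane closedin_trans piece_plane piece_regular regular_in_closedin)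

lemma piece_subset: "(H, P) \<in> \<P> \<Longrightarrow> P \<subseteq> H"
  by (meson closedin_imp_subset piece_regular regular_in_closedin)

text \<open>A relatively open part of the boundary in \<open>H\<close> that avoided the pieces
  recorded for \<open>H\<close> would be covered by the finitely many other planes. Regularity of
  the pieces then makes closure and interior in the definition of \<open>face\<close> return their
  union unchanged.\<close>

lemma face_eq:
  assumes H: "H \<in> hyperbolic_planes"
  shows "face F H = \<Union> {P. (H, P) \<in> \<P>}" (is "_ = ?A")
proof -
  have fin: "finite {P. (H, P) \<in> \<P>}"
    by (rule finite_subset[of _ "snd ` \<P>"]) (auto intro: image_eqI[rotated] finite_pieces)
  have A: "regular_in H ?A" using fin piece_regular by (intro regular_in_Union) auto
  have X: "H \<inter> frontier F = H \<inter> \<Union> (snd ` \<P>)"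
    using boundary hyperbolic_plane_subset_H3[OF H] by blast
  have AX: "?A \<subseteq> H \<inter> frontier F" unfolding X using piece_subset by (auto intro: image_eqI[rotated])
  have "top_of_set H interior_of (H \<inter> frontier F) \<subseteq> ?A"
  proof (rule ccontr)
    define U where "U = top_of_set H interior_of (H \<inter> frontier F)"
    assume "\<not> U \<subseteq> ?A"
    have "openin (top_of_set H) (U - ?A)"
      unfolding U_def using regular_in_closedin[OF A] by (intro openin_diff) auto
    then obtain W where W: "open W" "U - ?A = H \<inter> W" by (auto simp: openin_open)
    have "H \<inter> W \<subseteq> \<Union> (fst ` \<P> - {H})"
    proof
      fix p assume "p \<in> H \<inter> W"
      then have "p \<in> U" "p \<notin> ?A" using W by auto
      then have "p \<in> \<Union> (snd ` \<P>)"
        using interior_of_subset[of "top_of_set H" "H \<inter> frontier F"] X by (auto simp: U_def)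
      then obtain H' P where "(H', P) \<in> \<P>" "p \<in> P" by auto
      with \<open>p \<notin> ?A\<close> have "H' \<noteq> H" "p \<in> H'" using piece_subset by auto
      then show "p \<in> \<Union> (fst ` \<P> - {H})" using image_eqI[of H' fst, OF _ \<open>(H', P) \<in> \<P>\<close>] by auto
    qed
    then have "H \<inter> W = {}"
      using finite_pieces piece_plane H W(1)
      by (intro hyperbolic_plane_nowhere_dense_in[of "fst ` \<P> - {H}"]) auto
    with W \<open>\<not> U \<subseteq> ?A\<close> show False by blast
  qed
  then have "top_of_set H interior_of (H \<inter> frontier F) \<subseteq> top_of_set H interior_of ?A"
    by (intro interior_of_maximal) auto
  moreover have "top_of_set H interior_of ?A \<subseteq> top_of_set H interior_of (H \<inter> frontier F)"
    using AX by (rule interior_of_mono)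
  ultimately show ?thesis
    using A unfolding face_def regular_in_def by (metis subset_antisym)
qed

lemma side_planes_eq: "side_planes F = fst ` \<P>"
proof
  show "side_planes F \<subseteq> fst ` \<P>"
  proof
    fix H assume "H \<in> side_planes F"
    then have "H \<in> hyperbolic_planes" "face F H \<noteq> {}" by (auto simp: side_planes_def)
    then obtain P where "(H, P) \<in> \<P>" using face_eq by auto
    then show "H \<in> fst ` \<P>" by (rule image_eqI[rotated]) simp
  qed
  show "fst ` \<P> \<subseteq> side_planes F"
  proof
    fix H assume "H \<in> fst ` \<P>"
    then obtain P where P: "(H, P) \<in> \<P>" by auto
    then obtain x where "x \<in> P" using piece_nonempty by blast
    with P have "x \<in> face F H" unfolding face_eq[OF piece_plane[OF P]] by blast
    then show "H \<in> side_planes F" unfolding side_planes_def using piece_plane[OF P] by blast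
  qed
qed

lemma bounded_by: "bounded_by F (fst ` \<P>)"
proof -
  have "\<Union> (snd ` \<P>) = (\<Union>H\<in>fst ` \<P>. \<Union> {P. (H, P) \<in> \<P>})"
    by auto (metis fst_conv)
  also have "\<dots> = (\<Union>H\<in>fst ` \<P>. face F H)" using face_eq piece_plane by auto
  finally show ?thesis
    using side_planes_eq finite_pieces boundary by (simp add: bounded_by_def)
qed

lemma vertices_eq:
  "vertices F = {p. \<Inter> {ideal_closure H | H. \<exists>P. (H, P) \<in> \<P> \<and> p \<in> ideal_closure P} = {p}}"
proof -
  have "H \<in> side_planes F \<and> p \<in> ideal_closure (face F H) \<longleftrightarrow>
      (\<exists>P. (H, P) \<in> \<P> \<and> p \<in> ideal_closure P)" for H p
  proof (cases "H \<in> hyperbolic_planes")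
    case True
    have fin: "finite {P. (H, P) \<in> \<P>}"
      by (rule finite_subset[of _ "snd ` \<P>"]) (auto intro: image_eqI[rotated] finite_pieces)
    show ?thesis
      unfolding side_planes_eq face_eq[OF True] ideal_closure_Union[OF fin]
      by (auto intro: image_eqI[rotated])
  next
    case False
    then have "(H, P) \<notin> \<P>" for P using piece_plane by blast
    then show ?thesis unfolding side_planes_eq by auto
  qed
  then show ?thesis unfolding vertices_def by simp
qed

text \<open>Each piece lies in its plane, so \<open>p\<close> always belongs to the intersection.
  Being a vertex is thus only the uniqueness of a common ideal or finite point.\<close>

lemma mem_vertices:
  "p \<in> vertices F \<longleftrightarrow>
    (\<forall>q. (\<forall>H P. (H, P) \<in> \<P> \<longrightarrow> p \<in> ideal_closure P \<longrightarrow> q \<in> ideal_closure H) \<longrightarrow> q = p)"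
proof -
  define I where "I = \<Inter> {ideal_closure H | H. \<exists>P. (H, P) \<in> \<P> \<and> p \<in> ideal_closure P}"
  have I: "q \<in> I \<longleftrightarrow> (\<forall>H P. (H, P) \<in> \<P> \<longrightarrow> p \<in> ideal_closure P \<longrightarrow> q \<in> ideal_closure H)" for q
    unfolding I_def by blast
  have "p \<in> I"
    unfolding I using ideal_closure_mono[OF piece_subset] by blast
  then have "I = {p} \<longleftrightarrow> (\<forall>q. q \<in> I \<longrightarrow> q = p)" by blast
  then show ?thesis unfolding vertices_eq mem_Collect_eq I_def[symmetric] I .
qed

end

subsection \<open>Regions above a graph\<close>

text \<open>The graph bounds the squared height, which is the quantity that is affine up to a common
  term for isometric spheres. With \<open>f = 0\<close> this is the full vertical strip over
  \<open>R\<close>.\<close>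

definition above_graph :: "complex set \<Rightarrow> (complex \<Rightarrow> real) \<Rightarrow> (complex \<times> real) set" where
  "above_graph R f = {(z, t). z \<in> R \<and> t > 0 \<and> f z \<le> t\<^sup>2}"

lemma closed_ge_graph:
  assumes "closed R" "continuous_on UNIV f"
  shows "closed {(z :: complex, t :: real). z \<in> R \<and> f z \<le> t\<^sup>2}"
proof -
  have "closed (R \<times> (UNIV :: real set))" using assms by (intro closed_Times) auto
  moreover have "closed {p :: complex \<times> real. f (fst p) \<le> (snd p)\<^sup>2}"
    by (intro closed_Collect_le continuous_intros continuous_on_compose2[OF assms(2)]) auto
  ultimately have "closed (R \<times> (UNIV :: real set) \<inter> {p. f (fst p) \<le> (snd p)\<^sup>2})"
    by (rule closed_Int)
  moreover have "R \<times> (UNIV :: real set) \<inter> {p. f (fst p) \<le> (snd p)\<^sup>2} = {(z, t). z \<in> R \<and> f z \<le> t\<^sup>2}"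
    by auto
  ultimately show ?thesis by simp
qed

lemma closure_above_subset:
  assumes "closed R" "continuous_on UNIV f"
  shows "closure (above_graph R f) \<subseteq> {(z, t). z \<in> R \<and> f z \<le> t\<^sup>2 \<and> t \<ge> 0}"
proof -
  have "closed ({(z, t). z \<in> R \<and> f z \<le> t\<^sup>2} \<inter> {p :: complex \<times> real. 0 \<le> snd p})"
    using closed_ge_graph[OF assms] by (intro closed_Int closed_Collect_le continuous_intros) auto
  moreover have "above_graph R f \<subseteq> {(z, t). z \<in> R \<and> f z \<le> t\<^sup>2} \<inter> {p. 0 \<le> snd p}"
    by (auto simp: above_graph_def)
  ultimately have "closure (above_graph R f) \<subseteq> {(z, t). z \<in> R \<and> f z \<le> t\<^sup>2} \<inter> {p. 0 \<le> snd p}"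
    by (rule closure_minimal[rotated])
  then show ?thesis by auto
qed

lemma interior_above:
  assumes "continuous_on UNIV f"
  shows "interior (above_graph R f) = {(z, t). z \<in> interior R \<and> t > 0 \<and> f z < t\<^sup>2}"
proof
  have "open (interior R \<times> {0<..} \<inter> {p :: complex \<times> real. f (fst p) < (snd p)\<^sup>2})"
    by (intro open_Int open_Times open_Collect_less continuous_intros
        continuous_on_compose2[OF assms]) auto
  moreover have "interior R \<times> {0<..} \<inter> {p. f (fst p) < (snd p)\<^sup>2} \<subseteq> above_graph R f"
    using interior_subset by (fastforce simp: above_graph_def)
  ultimately have "interior R \<times> {0<..} \<inter> {p. f (fst p) < (snd p)\<^sup>2} \<subseteq> interior (above_graph R f)"
    by (rule interior_maximal[rotated])
  then show "{(z, t). z \<in> interior R \<and> t > 0 \<and> f z < t\<^sup>2} \<subseteq> interior (above_graph R f)" by auto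
next
  show "interior (above_graph R f) \<subseteq> {(z, t). z \<in> interior R \<and> t > 0 \<and> f z < t\<^sup>2}"
  proof (clarify)
    fix z t assume p: "(z, t) \<in> interior (above_graph R f)"
    have "interior (above_graph R f) \<subseteq> interior (R \<times> (UNIV :: real set))"
      by (intro interior_mono) (auto simp: above_graph_def)
    then have z: "z \<in> interior R" using p by (auto simp: interior_Times)
    obtain e where e: "e > 0" "ball (z, t) e \<subseteq> above_graph R f" using p by (auto simp: mem_interior)
    \<comment> \<open>The point lowered by \<open>e / 2\<close> still belongs to the region; this
      makes the inequality strict at height \<open>t\<close>.\<close>
    have "(z, t) \<in> ball (z, t) e" "(z, t - e / 2) \<in> ball (z, t) e"
      using \<open>e > 0\<close> by (auto simp: dist_Pair_Pair dist_norm)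
    then have "t - e / 2 > 0" "f z \<le> (t - e / 2)\<^sup>2" "t > 0" using e by (auto simp: above_graph_def)
    moreover from this have "(t - e / 2)\<^sup>2 < t\<^sup>2" using e by (intro power_strict_mono) auto
    ultimately show "z \<in> interior R \<and> t > 0 \<and> f z < t\<^sup>2" using z by auto
  qed
qed

lemma frontier_above:
  assumes "closed R" "continuous_on UNIV f"
  shows "H3 \<inter> frontier (above_graph R f) =
    {(z, t). t > 0 \<and> z \<in> R \<and> f z \<le> t\<^sup>2 \<and> (z \<in> frontier R \<or> t\<^sup>2 = f z)}"
proof -
  have "p \<in> closure (above_graph R f) \<longleftrightarrow> p \<in> above_graph R f" if "p \<in> H3" for p
    using closure_above_subset[OF assms] closure_subset[of "above_graph R f"] that
    by (auto simp: H3_def above_graph_def)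
  then have "H3 \<inter> frontier (above_graph R f) =
      above_graph R f - {(z, t). z \<in> interior R \<and> t > 0 \<and> f z < t\<^sup>2}"
    unfolding frontier_def interior_above[OF assms(2)] by (auto simp: H3_def above_graph_def)
  also have "\<dots> = {(z, t). t > 0 \<and> z \<in> R \<and> f z \<le> t\<^sup>2 \<and> (z \<in> frontier R \<or> t\<^sup>2 = f z)}"
    using interior_subset[of R] assms(1) by (auto simp: above_graph_def frontier_def)
  finally show ?thesis .
qed

text \<open>The height of the hemisphere over a base point is continuous, and it stays positive near
  a point with \<open>t > 0\<close>. Base points from the interior of \<open>Q\<close> can therefore
  be lifted to approximate any point of the piece.\<close>

lemma regular_in_hemisphere:
  assumes "closed Q" "Q \<subseteq> closure (interior Q)"
  shows "regular_in (hemisphere w r) {(z, t) \<in> hemisphere w r. z \<in> Q}"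
proof (rule regular_inI)
  have "{(z, t) \<in> hemisphere w r. z \<in> Q} = hemisphere w r \<inter> Q \<times> UNIV" by auto
  then show "closedin (top_of_set (hemisphere w r)) {(z, t) \<in> hemisphere w r. z \<in> Q}"
    using assms(1) closed_Times[of Q "UNIV :: real set"] by (simp add: closedin_closed_Int)
  show "open (interior Q \<times> (UNIV :: real set))" by (intro open_Times) auto
  show "hemisphere w r \<inter> interior Q \<times> UNIV \<subseteq> {(z, t) \<in> hemisphere w r. z \<in> Q}"
    using interior_subset by auto
  show "{(z, t) \<in> hemisphere w r. z \<in> Q} \<subseteq> closure (hemisphere w r \<inter> interior Q \<times> UNIV)"
  proof (clarify)
    fix z t assume z: "z \<in> Q" and H: "(z, t) \<in> hemisphere w r"
    define q where "q z = r\<^sup>2 - (cmod (z - w))\<^sup>2" for z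
    have t: "t > 0" "r \<ge> 0" "q z = t\<^sup>2" using H by (auto simp: mem_hemisphere q_def)
    obtain x where x: "\<And>n. x n \<in> interior Q" "x \<longlonglongrightarrow> z"
      using subsetD[OF assms(2) z] unfolding closure_sequential by auto
    have "(\<lambda>n. q (x n)) \<longlonglongrightarrow> q z" unfolding q_def by (intro tendsto_intros x)
    then have ev: "\<forall>\<^sub>F n in sequentially. q (x n) > 0"
      by (rule order_tendstoD(1)) (use t in simp)
    have "(\<lambda>n. (x n, sqrt (q (x n)))) \<longlonglongrightarrow> (z, sqrt (q z))"
      unfolding q_def by (intro tendsto_intros x)
    moreover have "sqrt (q z) = t" using t by simp
    ultimately have "(\<lambda>n. (x n, sqrt (q (x n)))) \<longlonglongrightarrow> (z, t)" by simp
    moreover have "\<forall>\<^sub>F n in sequentially. (x n, sqrt (q (x n))) \<in> closure (hemisphere w r \<inter> interior Q \<times> UNIV)"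
      using ev
    proof eventually_elim
      case (elim n)
      then have "(x n, sqrt (q (x n))) \<in> hemisphere w r \<inter> interior Q \<times> UNIV"
        using x t by (auto simp: mem_hemisphere q_def less_imp_le)
      then show ?case by (rule subsetD[OF closure_subset])
    qed
    ultimately show "(z, t) \<in> closure (hemisphere w r \<inter> interior Q \<times> UNIV)"
      by (rule Lim_in_closed_set[OF closed_closure _ sequentially_bot, rotated])
  qed
qed

lemma regular_in_vertical:
  assumes "continuous_on UNIV f" "closed E" "E \<subseteq> {z. inner u z = k}"
    and "open V" "{z. inner u z = k} \<inter> V \<subseteq> E" "E \<subseteq> closure ({z. inner u z = k} \<inter> V)"
  shows "regular_in {p \<in> H3. inner u (fst p) = k} (above_graph E f)"
proof (rule regular_inI)
  define W where "W = V \<times> UNIV \<inter> {p :: complex \<times> real. f (fst p) < (snd p)\<^sup>2}"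
  have "above_graph E f = {p \<in> H3. inner u (fst p) = k} \<inter> {(z, t). z \<in> E \<and> f z \<le> t\<^sup>2}"
    using assms(3) by (auto simp: above_graph_def H3_def)
  then show "closedin (top_of_set {p \<in> H3. inner u (fst p) = k}) (above_graph E f)"
    using closed_ge_graph[OF assms(2,1)] by (simp add: closedin_closed_Int)
  show "open W" unfolding W_def
    by (intro open_Int open_Times open_Collect_less continuous_intros
        continuous_on_compose2[OF assms(1)] assms) auto
  show "{p \<in> H3. inner u (fst p) = k} \<inter> W \<subseteq> above_graph E f"
    using assms(5) by (auto simp: above_graph_def H3_def W_def)
  show "above_graph E f \<subseteq> closure ({p \<in> H3. inner u (fst p) = k} \<inter> W)" (is "_ \<subseteq> closure ?C")
  proof (clarify)
    fix z t assume "(z, t) \<in> above_graph E f"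
    then have z: "z \<in> E" "t > 0" "f z \<le> t\<^sup>2" by (auto simp: above_graph_def)
    obtain x where x: "\<And>n. x n \<in> {z. inner u z = k} \<inter> V" "x \<longlonglongrightarrow> z"
      using subsetD[OF assms(6) z(1)] unfolding closure_sequential by auto
    have lim: "(\<lambda>n. f (x n)) \<longlonglongrightarrow> f z"
      using assms(1) x(2) continuous_on_tendsto_compose[of UNIV f] by auto
    \<comment> \<open>At height \<open>t + s\<close> there is room above the graph, so the
      approximation along the line succeeds by continuity of \<open>f\<close>. Letting
      \<open>s\<close> tend to 0 afterwards reaches points on the graph itself.\<close>
    have up: "(z, t + s) \<in> closure ?C" if "s > 0" for s
    proof -
      have "t\<^sup>2 < (t + s)\<^sup>2" using z that by (intro power_strict_mono) auto
      then have "\<forall>\<^sub>F n in sequentially. f (x n) < (t + s)\<^sup>2"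
        using z by (intro order_tendstoD(2)[OF lim]) auto
      then have "\<forall>\<^sub>F n in sequentially. (x n, t + s) \<in> closure ?C"
      proof eventually_elim
        case (elim n)
        then have "(x n, t + s) \<in> ?C" using x(1)[of n] z that by (auto simp: H3_def W_def)
        then show ?case by (rule subsetD[OF closure_subset])
      qed
      moreover have "(\<lambda>n. (x n, t + s)) \<longlonglongrightarrow> (z, t + s)" by (intro tendsto_intros x)
      ultimately show ?thesis
        by (rule Lim_in_closed_set[OF closed_closure _ sequentially_bot])
    qed
    have "((\<lambda>s. (z, t + s)) \<longlongrightarrow> (z, t + 0)) (at_right (0::real))" by (intro tendsto_intros)
    moreover have "\<forall>\<^sub>F s in at_right (0::real). (z, t + s) \<in> closure ?C"
      using eventually_at_right_less[of "0::real"] by eventually_elim (rule up)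
    ultimately show "(z, t) \<in> closure ?C"
      using Lim_in_closed_set[OF closed_closure, of "\<lambda>s. (z, t + s)" ?C "at_right (0::real)" "(z, t)"] by simp
  qed
qed

lemma bounded_hemisphere: "bounded (hemisphere w r)"
  unfolding hemisphere_def using bounded_sphere bounded_subset by blast

lemma unbounded_above:
  assumes "E \<noteq> {}"
  shows "\<not> bounded (above_graph E f)"
proof
  assume "bounded (above_graph E f)"
  then obtain B where B: "\<And>p. p \<in> above_graph E f \<Longrightarrow> norm p \<le> B" by (auto simp: bounded_iff)
  obtain z where "z \<in> E" using assms by auto
  define t where "t = 1 + \<bar>B\<bar> + \<bar>f z\<bar>"
  have "t \<ge> 1" by (simp add: t_def)
  then have "t \<le> t\<^sup>2" by (simp add: power2_eq_square)
  then have "(z, t) \<in> above_graph E f" using \<open>z \<in> E\<close> \<open>t \<ge> 1\<close> by (auto simp: above_graph_def t_def)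
  then have "norm (z, t) \<le> B" by (rule B)
  moreover have "norm (z, t) \<ge> \<bar>t\<bar>" using norm_snd_le[of t z] by simp
  ultimately show False by (auto simp: t_def)
qed

lemma closure_closedin_H3:
  assumes "closedin (top_of_set H3) P" "p \<in> H3"
  shows "p \<in> closure P \<longleftrightarrow> p \<in> P"
proof -
  obtain C where "closed C" "P = H3 \<inter> C" using assms(1) by (auto simp: closedin_closed)
  then show ?thesis using assms(2) closure_minimal[of P C] closure_subset[of P] by auto
qed

section \<open>Arithmetic\<close>

lemma theta_sq: "\<theta> * \<theta> = - 11"
  by (simp add: theta_omega(1) complex_eq_iff)

lemma Re_theta [simp]: "Re \<theta> = 0" and Im_theta [simp]: "Im \<theta> = sqrt 11"
  by (simp_all add: theta_omega(1))

lemma Re_omega [simp]: "Re \<omega> = - 1 / 2" and Im_omega [simp]: "Im \<omega> = sqrt 11 / 2"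
  by (simp_all add: \<omega>_def)

lemma theta_nonzero [simp]: "\<theta> \<noteq> 0"
  using theta_sq by auto

lemma omega_sq: "\<omega> * \<omega> = - \<omega> - 3"
  by (simp add: complex_eq_iff)

lemma O11I: "w = of_int m + of_int n * \<omega> \<Longrightarrow> w \<in> O11"
  unfolding O11_def by blast

lemma of_int_O11 [simp]: "of_int m \<in> O11"
  by (rule O11I[of _ m 0]) simp

lemma O11_0 [simp]: "0 \<in> O11" and O11_1 [simp]: "1 \<in> O11"
  using of_int_O11[of 0] of_int_O11[of 1] by simp_all

lemma omega_O11 [simp]: "\<omega> \<in> O11"
  by (rule O11I[of _ 0 1]) simp

lemma theta_O11 [simp]: "\<theta> \<in> O11"
  by (rule O11I[of _ 1 2]) (simp add: theta_omega(2))

lemma O11_add [simp]: assumes "v \<in> O11" "w \<in> O11" shows "v + w \<in> O11"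
proof -
  from assms obtain m n p q where "v = of_int m + of_int n * \<omega>" "w = of_int p + of_int q * \<omega>"
    unfolding O11_def by blast
  then show ?thesis by (intro O11I[of _ "m + p" "n + q"]) (simp add: algebra_simps)
qed

lemma O11_mult [simp]: assumes "v \<in> O11" "w \<in> O11" shows "v * w \<in> O11"
proof -
  from assms obtain m n p q where vw: "v = of_int m + of_int n * \<omega>" "w = of_int p + of_int q * \<omega>"
    unfolding O11_def by blast
  have "v * w = of_int m * of_int p + (of_int m * of_int q + of_int n * of_int p) * \<omega>
      + of_int n * of_int q * (\<omega> * \<omega>)"
    unfolding vw by (simp add: algebra_simps)
  then show ?thesis unfolding omega_sq
    by (intro O11I[of _ "m * p - 3 * n * q" "m * q + n * p - n * q"]) (simp add: algebra_simps)
qed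

lemma O11_minus [simp]: "v \<in> O11 \<Longrightarrow> - v \<in> O11"
  using O11_mult[OF of_int_O11[of "- 1"], of v] by simp

lemma O11_minus_iff [simp]: "- v \<in> O11 \<longleftrightarrow> v \<in> O11"
  using O11_minus[of v] O11_minus[of "- v"] by auto

lemma O11_diff [simp]: "v \<in> O11 \<Longrightarrow> w \<in> O11 \<Longrightarrow> v - w \<in> O11"
  using O11_add[of v "- w"] by simp

lemma O11_cartesian:
  assumes "v \<in> O11"
  obtains m n :: int where "Re v = of_int m - of_int n / 2" "Im v = of_int n * sqrt 11 / 2"
  using assms unfolding O11_def by auto

text \<open>This is the norm form \<open>m\<^sup>2 - m * n + 3 * n\<^sup>2\<close>: \<omega> has
  trace -1 and norm 3.\<close>

lemma O11_norm_int:
  assumes "v \<in> O11"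
  obtains k :: int where "(cmod v)\<^sup>2 = of_int k"
proof -
  obtain m n :: int where v: "Re v = of_int m - of_int n / 2" "Im v = of_int n * sqrt 11 / 2"
    using O11_cartesian[OF assms] .
  have "(cmod v)\<^sup>2 = of_int (m\<^sup>2 - m * n + 3 * n\<^sup>2)"
    unfolding cmod_power2 v by (simp add: power2_eq_square field_simps)
  then show ?thesis by (rule that)
qed

lemma O11_norm_ge_1:
  assumes "v \<in> O11" "v \<noteq> 0"
  shows "1 \<le> (cmod v)\<^sup>2"
proof -
  obtain k :: int where k: "(cmod v)\<^sup>2 = of_int k" using O11_norm_int[OF assms(1)] .
  have "(cmod v)\<^sup>2 > 0" using assms(2) by simp
  then show ?thesis unfolding k by simp
qed

text \<open>Both norms are at least 1 and their product is 1. In a norm equal to 1 the term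
  \<open>11 / 4 * n\<^sup>2\<close> leaves no room for \<open>n \<noteq> 0\<close>. This is why the
  stabilizer of infinity contains only translations.\<close>

lemma O11_units:
  assumes "a \<in> O11" "d \<in> O11" "a * d = 1"
  shows "a = 1 \<or> a = - 1"
proof -
  have "a \<noteq> 0" "d \<noteq> 0" using assms(3) by auto
  then have "1 \<le> (cmod a)\<^sup>2" "1 \<le> (cmod d)\<^sup>2" using assms O11_norm_ge_1 by auto
  moreover have "(cmod a)\<^sup>2 * (cmod d)\<^sup>2 = 1"
    using assms(3) by (metis norm_mult norm_one power_mult_distrib power_one)
  ultimately have 1: "(cmod a)\<^sup>2 = 1"
    using mult_left_mono[of 1 "(cmod d)\<^sup>2" "(cmod a)\<^sup>2"] by simp
  obtain m n :: int where v: "Re a = of_int m - of_int n / 2" "Im a = of_int n * sqrt 11 / 2"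
    using O11_cartesian[OF assms(1)] .
  have *: "(Re a)\<^sup>2 + 11 / 4 * (of_int n)\<^sup>2 = 1"
    using 1 unfolding cmod_power2 v(2) by (simp add: power_divide power_mult_distrib)
  have "n = 0"
  proof (rule ccontr)
    assume "n \<noteq> 0"
    then have "1 \<le> \<bar>real_of_int n\<bar>" by linarith
    then have "1 \<le> (real_of_int n)\<^sup>2" by (metis abs_one abs_le_square_iff abs_abs power_one)
    moreover have "0 \<le> (Re a)\<^sup>2" by simp
    ultimately show False using * by linarith
  qed
  then have "(Re a)\<^sup>2 = 1" "Im a = 0" using * v by auto
  then show ?thesis by (auto simp: complex_eq_iff power2_eq_1_iff)
qed

lemma Re_z1 [simp]: "Re z1 = 0" and Im_z1 [simp]: "Im z1 = 3 / sqrt 11"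
proof -
  have "Im z1 = 3 * sqrt 11 / 11" by (simp add: z1_def)
  also have "\<dots> = 3 / sqrt 11" by (simp add: divide_simps)
  finally show "Im z1 = 3 / sqrt 11" .
qed (simp add: z1_def)

text \<open>
  With \<open>z1 = - 3 / \<theta>\<close>, the left-hand side is an integer over 11 whose numerator is
  \<open>9|x|\<^sup>2 + 2|x|\<^sup>2 \<equiv> 0\<close> modulo 11, because \<open>|\<theta> * y + 3 * x|\<^sup>2 \<equiv> 9|x|\<^sup>2\<close>.
  It is therefore a positive integer.
\<close>

lemma vertex_height:
  assumes "x \<in> O11" "y \<in> O11" "x \<noteq> 0" and s: "s = 1 \<or> s = - 1"
  shows "1 \<le> (cmod (y + of_real s * x * z1))\<^sup>2 + 2 / 11 * (cmod x)\<^sup>2"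
proof -
  obtain m n :: int where x: "Re x = of_int m - of_int n / 2" "Im x = of_int n * sqrt 11 / 2"
    using O11_cartesian[OF assms(1)] .
  obtain p q :: int where y: "Re y = of_int p - of_int q / 2" "Im y = of_int q * sqrt 11 / 2"
    using O11_cartesian[OF assms(2)] .
  obtain k :: int where k: "s = of_int k" "k = 1 \<or> k = - 1"
    using s by (metis of_int_1 of_int_minus)
  have re: "Re (y + of_real s * x * z1) = p - q / 2 - 3 * s * n / 2"
    by (simp add: x y)
  have im: "Im (y + of_real s * x * z1) = q * sqrt 11 / 2 + 3 * s * (m - n / 2) / sqrt 11"
    by (simp add: x y)
  have ss: "s * s = 1" using s by auto
  have "(Im (y + of_real s * x * z1))\<^sup>2 = 11 / 4 * q\<^sup>2 + 3 * s * q * (m - n / 2) + 9 / 11 * (m - n / 2)\<^sup>2"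
  proof -
    have "(q * sqrt 11 / 2 + 3 * s * (m - n / 2) / sqrt 11)\<^sup>2
      = (q * sqrt 11 / 2)\<^sup>2 + (3 * s * (m - n / 2) / sqrt 11)\<^sup>2
        + 2 * (q * sqrt 11 / 2) * (3 * s * (m - n / 2) / sqrt 11)" by (rule power2_sum)
    also have "\<dots> = 11 / 4 * q\<^sup>2 + 3 * s * q * (m - n / 2) + 9 / 11 * (s * s) * (m - n / 2)\<^sup>2"
      by (simp add: power_divide power_mult_distrib power2_eq_square[of s])
    finally show ?thesis unfolding im ss by simp
  qed
  then have "(cmod (y + of_real s * x * z1))\<^sup>2 + 2 / 11 * (cmod x)\<^sup>2 =
      (p - q / 2 - 3 * s * n / 2)\<^sup>2 + 11 / 4 * q\<^sup>2 + 3 * s * q * (m - n / 2) + 9 / 11 * (m - n / 2)\<^sup>2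
      + 2 / 11 * ((m - n / 2)\<^sup>2 + 11 / 4 * n\<^sup>2)"
    unfolding cmod_power2 re x by (simp add: power2_eq_square)
  \<comment> \<open>The fractions 9/11 and 2/11 add up to 1, which removes every denominator 11.
    With \<open>s * s = 1\<close> the three terms in \<open>n\<^sup>2\<close> add up to
    \<open>3 * n\<^sup>2\<close>.\<close>
  also have "\<dots> = p\<^sup>2 - p * q + 3 * q\<^sup>2 + 3 * s * (q * m - p * n) + m\<^sup>2 - m * n
      + n\<^sup>2 / 4 + n\<^sup>2 / 2 + 9 / 4 * (s * s) * n\<^sup>2"
    by (simp add: power2_eq_square field_simps)
  also have "\<dots> = of_int (p\<^sup>2 - p * q + 3 * q\<^sup>2 + 3 * k * (q * m - p * n) + m\<^sup>2 - m * n + 3 * n\<^sup>2)"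
    unfolding ss by (simp add: k)
  finally have int: "(cmod (y + of_real s * x * z1))\<^sup>2 + 2 / 11 * (cmod x)\<^sup>2 =
    of_int (p\<^sup>2 - p * q + 3 * q\<^sup>2 + 3 * k * (q * m - p * n) + m\<^sup>2 - m * n + 3 * n\<^sup>2)" .
  have "0 < (cmod (y + of_real s * x * z1))\<^sup>2 + 2 / 11 * (cmod x)\<^sup>2"
    using assms(3) by (intro add_nonneg_pos) auto
  then show ?thesis
    unfolding int of_int_1_le_iff of_int_0_less_iff int_one_le_iff_zero_less .
qed

section \<open>The group\<close>

lemma Gamma0_iff:
  "A \<in> Gamma0 \<longleftrightarrow> A$1$1 \<in> O11 \<and> A$1$2 \<in> O11 \<and> A$2$2 \<in> O11 \<and> (\<exists>x\<in>O11. A$2$1 = \<theta> * x)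
    \<and> A$1$1 * A$2$2 - A$1$2 * A$2$1 = 1"
  by (auto simp: Gamma0_def SL2_def forall_2 det_2)

lemma Gamma0_minus [simp]: "- A \<in> Gamma0 \<longleftrightarrow> A \<in> Gamma0"
proof -
  have "\<exists>x\<in>O11. - c = \<theta> * x" if "\<exists>x\<in>O11. c = \<theta> * x" for c
    using that by (auto intro: bexI[of _ "- x" for x])
  from this[of "A$2$1"] this[of "- A$2$1"]
  have "(\<exists>x\<in>O11. - (A$2$1) = \<theta> * x) \<longleftrightarrow> (\<exists>x\<in>O11. A$2$1 = \<theta> * x)" by auto
  then show ?thesis by (simp add: Gamma0_iff)
qed

lemma PGamma0_eq: "PGamma0 = {{A, - A} | A. A \<in> Gamma0}"
proof -
  have "(- mat 1) ** A = - A" for A :: "complex^2^2"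
    by (simp add: vec_eq_iff matrix_matrix_mult_def forall_2 sum_2 mat_def)
  then show ?thesis by (simp add: PGamma0_def r_coset_def SL2_def insert_commute)
qed

lemma Union_PGamma0: "\<Union> PGamma0 = Gamma0"
  by (auto simp: PGamma0_eq)

definition translation :: "complex \<Rightarrow> complex^2^2" where
  "translation b = vector [vector [1, b], vector [0, 1]]"

lemma translation_entries [simp]:
  "translation b $ 1 $ 1 = 1" "translation b $ 1 $ 2 = b"
  "translation b $ 2 $ 1 = 0" "translation b $ 2 $ 2 = 1"
  by (simp_all add: translation_def)

text \<open>With lower left entry 0 the diagonal entries are mutually inverse units, hence both 1 or
  both -1, and the sign disappears in the coset.\<close>

lemma stab_infinity_eq: "stab_infinity PGamma0 = {{translation b, - translation b} | b. b \<in> O11}"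
proof (intro equalityI subsetI)
  fix \<gamma> assume "\<gamma> \<in> stab_infinity PGamma0"
  then obtain A where A: "A \<in> Gamma0" "\<gamma> = {A, - A}" and "mobius A None = None"
    by (auto simp: stab_infinity_def PGamma0_eq)
  then have c: "A$2$1 = 0" by (auto simp: mobius_def split: if_splits)
  have O: "A$1$1 \<in> O11" "A$1$2 \<in> O11" "A$2$2 \<in> O11" and det: "A$1$1 * A$2$2 = 1"
    using A c by (auto simp: Gamma0_iff)
  from O11_units[OF O(1,3) det] show "\<gamma> \<in> {{translation b, - translation b} | b. b \<in> O11}"
  proof
    assume "A$1$1 = 1"
    then have "A = translation (A$1$2)" using det c by (simp add: vec_eq_iff forall_2)
    then have "\<gamma> = {translation (A$1$2), - translation (A$1$2)}" using A(2) by metis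
    with O(2) show ?thesis by blast
  next
    assume a: "A$1$1 = - 1"
    then have "A$2$2 = - 1" using det by (metis minus_equation_iff mult_minus1)
    with a have "- A = translation (- A$1$2)" using c by (simp add: vec_eq_iff forall_2)
    then have "\<gamma> = {translation (- A$1$2), - translation (- A$1$2)}" using A(2)
      by (metis insert_commute minus_minus)
    with O(2) show ?thesis using O11_minus by blast
  qed
next
  fix \<gamma> assume "\<gamma> \<in> {{translation b, - translation b} | b. b \<in> O11}"
  then obtain b where b: "b \<in> O11" "\<gamma> = {translation b, - translation b}" by blast
  then have "translation b \<in> Gamma0" by (auto simp: Gamma0_iff intro: bexI[of _ 0])
  then show "\<gamma> \<in> stab_infinity PGamma0"
    using b by (auto simp: stab_infinity_def PGamma0_eq mobius_def)
qed

lemma psl_image_translation: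
  "psl_image {translation b, - translation b} S = (\<lambda>(z, t). (z + b, t)) ` S"
proof -
  have "poincare (translation b) = (\<lambda>(z, t). (z + b, t))"
    "poincare (- translation b) = (\<lambda>(z, t). (z + b, t))"
    by (auto simp: poincare_def fun_eq_iff Let_def)
  then show ?thesis by (simp add: psl_image_def)
qed

text \<open>Translating a pair of images back by one of the two translations reduces disjointness of
  all pairs to comparisons with the untranslated interior.\<close>

lemma fundamental_domain_stab_infinity:
  "fundamental_domain (stab_infinity PGamma0) D \<longleftrightarrow>
     D = H3 \<inter> closure (interior D) \<and> connected (interior D) \<and>
     (\<Union>b\<in>O11. (\<lambda>(z, t). (z + b, t)) ` D) = H3 \<and>
     (\<forall>b\<in>O11. b \<noteq> 0 \<longrightarrow> (\<lambda>(z, t). (z + b, t)) ` interior D \<inter> interior D = {})"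
proof -
  let ?T = "\<lambda>b. {translation b, - translation b}"
  have inj: "?T b = ?T b' \<longleftrightarrow> b = b'" for b b'
  proof
    assume "?T b = ?T b'"
    \<comment> \<open>The image of one point of \<open>H3\<close> already tells two translation
      cosets apart.\<close>
    then have "psl_image (?T b) {(0, 1)} = psl_image (?T b') {(0, 1)}" by simp
    then show "b = b'" unfolding psl_image_translation by simp
  qed simp
  have disj: "(\<lambda>(z, t). (z + b, t)) ` S \<inter> (\<lambda>(z, t). (z + b', t)) ` S = {} \<longleftrightarrow>
      (\<lambda>(z, t). (z + (b - b'), t)) ` S \<inter> S = {}" for b b' and S :: "(complex \<times> real) set"
  proof -
    have "(\<lambda>(z, t). (z + b, t)) ` S \<inter> (\<lambda>(z, t). (z + b', t)) ` S =
        (\<lambda>(z, t). (z + b', t)) ` ((\<lambda>(z, t). (z + (b - b'), t)) ` S \<inter> S)"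
      by (subst image_Int) (auto simp: inj_on_def image_image split_def)
    then show ?thesis by simp
  qed
  have stab: "stab_infinity PGamma0 = ?T ` O11" unfolding stab_infinity_eq by auto
  have un: "(\<Union>\<gamma>\<in>stab_infinity PGamma0. psl_image \<gamma> D) = (\<Union>b\<in>O11. (\<lambda>(z, t). (z + b, t)) ` D)"
    unfolding stab by (simp add: psl_image_translation)
  have "(\<forall>\<gamma>\<in>stab_infinity PGamma0. \<forall>\<delta>\<in>stab_infinity PGamma0. \<gamma> \<noteq> \<delta> \<longrightarrow>
        psl_image \<gamma> S \<inter> psl_image \<delta> S = {}) \<longleftrightarrow>
      (\<forall>b\<in>O11. \<forall>b'\<in>O11. ?T b \<noteq> ?T b' \<longrightarrow> psl_image (?T b) S \<inter> psl_image (?T b') S = {})" for S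
    unfolding stab by simp
  also have "\<dots> S \<longleftrightarrow> (\<forall>b\<in>O11. \<forall>b'\<in>O11. b \<noteq> b' \<longrightarrow> (\<lambda>(z, t). (z + (b - b'), t)) ` S \<inter> S = {})" for S
    unfolding inj psl_image_translation disj ..
  also have "\<dots> S \<longleftrightarrow> (\<forall>b\<in>O11. b \<noteq> 0 \<longrightarrow> (\<lambda>(z, t). (z + b, t)) ` S \<inter> S = {})" for S
    using O11_diff by (metis O11_0 diff_zero right_minus_eq)
  finally show ?thesis unfolding fundamental_domain_def un by simp
qed

text \<open>The quantity compared with 1 is the denominator by which \<open>poincare\<close> divides
  the height, so the ball consists of the points that the matrix raises. In this form no center or
  radius has to be computed for a general element.\<close>

lemma mem_ball_isometric:
  fixes c d z :: complex
  assumes "c \<noteq> 0"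
  shows "(z, t) \<in> ball (- d / c, 0) (1 / cmod c) \<longleftrightarrow> (cmod (c * z + d))\<^sup>2 + (cmod c)\<^sup>2 * t\<^sup>2 < 1"
proof -
  have "c * z + d = c * (z - (- d / c))" using assms by (simp add: field_simps)
  then have n: "cmod (c * z + d) = cmod c * cmod (- d / c - z)"
    by (simp only: norm_mult norm_minus_commute)
  have "(z, t) \<in> ball (- d / c, 0) (1 / cmod c) \<longleftrightarrow> cmod c * dist (- d / c, 0) (z, t) < 1"
    using assms by (simp add: field_simps)
  also have "\<dots> \<longleftrightarrow> (cmod c * dist (- d / c, 0) (z, t))\<^sup>2 < 1"
    by (simp add: abs_square_less_1)
  also have "(cmod c * dist (- d / c, 0) (z, t))\<^sup>2 = (cmod (c * z + d))\<^sup>2 + (cmod c)\<^sup>2 * t\<^sup>2"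
    unfolding n by (simp add: dist_norm norm_Pair power_mult_distrib distrib_left)
  finally show ?thesis .
qed

lemma mem_ford_exterior:
  "(z, t) \<in> ford_exterior PGamma0 \<longleftrightarrow> t > 0 \<and>
    (\<forall>A\<in>Gamma0. A$2$1 \<noteq> 0 \<longrightarrow> 1 \<le> (cmod (A$2$1 * z + A$2$2))\<^sup>2 + (cmod (A$2$1))\<^sup>2 * t\<^sup>2)"
proof -
  have "(z, t) \<notin> ball (- A$2$2 / A$2$1, 0) (1 / cmod (A$2$1)) \<longleftrightarrow>
      1 \<le> (cmod (A$2$1 * z + A$2$2))\<^sup>2 + (cmod (A$2$1))\<^sup>2 * t\<^sup>2" if "A$2$1 \<noteq> 0" for A :: "complex^2^2"
    unfolding mem_ball_isometric[OF that] by linarith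
  then show ?thesis unfolding ford_exterior_def Union_PGamma0 H3_def by simp
qed

subsection \<open>Bounding spheres in rational coordinates\<close>

text \<open>
  For \<open>w = \<theta> * z\<close> the coordinates are \<open>Re w\<close> and \<open>sqrt 11 * Im w\<close>; they are rational at all
  centers and vertices.
\<close>

definition cx :: "complex \<Rightarrow> real" where "cx z = - sqrt 11 * Im z"
definition cy :: "complex \<Rightarrow> real" where "cy z = 11 * Re z"

lemma cxy_add [simp]: "cx (z + w) = cx z + cx w" "cy (z + w) = cy z + cy w"
  and cxy_scaleR [simp]: "cx (r *\<^sub>R z) = r * cx z" "cy (r *\<^sub>R z) = r * cy z"
  and cxy_0 [simp]: "cx 0 = 0" "cy 0 = 0"
  by (simp_all add: cx_def cy_def algebra_simps)

lemma cxy_diff [simp]: "cx (z - w) = cx z - cx w" "cy (z - w) = cy z - cy w"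
  by (simp_all add: cx_def cy_def algebra_simps)

text \<open>Inverse of the coordinate map sending \<open>z\<close> to \<open>cx z\<close> and
  \<open>cy z\<close>.\<close>

definition point :: "real \<Rightarrow> real \<Rightarrow> complex" where
  "point x y = Complex (y / 11) (- x / sqrt 11)"

lemma cxy_point [simp]: "cx (point x y) = x" "cy (point x y) = y"
  by (simp_all add: point_def cx_def cy_def)

lemma point_cxy [simp]: "point (cx z) (cy z) = z"
  by (simp add: point_def cx_def cy_def complex_eq_iff)

lemma cxy_eqI: "cx z = cx w \<Longrightarrow> cy z = cy w \<Longrightarrow> z = w"
  by (metis point_cxy)

lemma cx_divide_theta: "cx (w / \<theta>) = Re w" and cy_divide_theta: "cy (w / \<theta>) = sqrt 11 * Im w"
proof -
  have "w / \<theta> = - (\<theta> * w) / 11"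
    using theta_sq by (simp add: field_simps flip: mult.assoc)
  then show "cx (w / \<theta>) = Re w" "cy (w / \<theta>) = sqrt 11 * Im w"
    by (simp_all add: cx_def cy_def)
qed

lemma theta_times: "Re (\<theta> * z) = cx z" "Im (\<theta> * z) = cy z / sqrt 11"
  by (simp_all add: cx_def cy_def field_simps flip: power2_eq_square)

text \<open>The squared modulus of \<open>\<theta> * z\<close>, the quadratic term shared by the
  squared heights of all spheres.\<close>

definition sqn :: "complex \<Rightarrow> real" where "sqn z = (cx z)\<^sup>2 + (cy z)\<^sup>2 / 11"

lemma sqn_eq: "sqn z = 11 * (cmod z)\<^sup>2"
  unfolding sqn_def cmod_power2 cx_def cy_def by (simp add: power_mult_distrib)

lemma cmod_diff_eq: "11 * (cmod (z - w))\<^sup>2 = sqn z - 2 * cx w * cx z - 2 / 11 * cy w * cy z + sqn w"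
  unfolding sqn_eq[symmetric] by (simp add: sqn_def power2_eq_square field_simps)

section \<open>Spheres as affine forms\<close>

type_synonym affine_form = "real \<times> real \<times> real"

fun val :: "affine_form \<Rightarrow> complex \<Rightarrow> real" where
  "val (a, b, e) z = a * cx z + b * cy z + e"

text \<open>\<open>11 * t\<^sup>2\<close> is the squared height after scaling by \<theta>. Since
  every form subtracts the same \<open>sqn z\<close>, the higher of two spheres is the one with the
  larger affine value.\<close>

definition dome :: "affine_form \<Rightarrow> (complex \<times> real) set" where
  "dome l = {(z, t). t > 0 \<and> 11 * t\<^sup>2 = val l z - sqn z}"

text \<open>Obtained by expanding \<open>1 - (cx z - j)\<^sup>2 - (cy z)\<^sup>2 / 11\<close> and
  adding \<open>sqn z\<close>.\<close>

definition unit_form :: "int \<Rightarrow> affine_form" where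
  "unit_form j = (2 * of_int j, 0, 1 - (of_int j)\<^sup>2)"

text \<open>After scaling, the center has coordinates \<open>\<sigma> / 6\<close> and
  \<open>11 * \<tau> / 6\<close>, hence squared modulus 1/3, which is also the squared radius. The
  constant term vanishes because these spheres pass through the cusp 0.\<close>

definition small_form :: "real \<Rightarrow> real \<Rightarrow> affine_form" where
  "small_form \<sigma> \<tau> = (\<sigma> / 3, \<tau> / 3, 0)"

definition forms :: "affine_form set" where
  "forms = unit_form ` ({-5..5} - {0}) \<union> (\<lambda>(\<sigma>, \<tau>). small_form \<sigma> \<tau>) ` ({1, -1} \<times> {1, -1})"

lemma finite_forms: "finite forms" by (simp add: forms_def)

lemma dome_hemisphere:
  assumes "cx c = a / 2" "cy c = 11 * b / 2" "r \<ge> 0" "11 * r\<^sup>2 = e + a\<^sup>2 / 4 + 11 * b\<^sup>2 / 4"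
  shows "dome (a, b, e) = hemisphere c r"
proof (rule Set.set_eqI)
  fix p :: "complex \<times> real"
  obtain z t where p: "p = (z, t)" by (cases p)
  have "11 * ((cmod (z - c))\<^sup>2 + t\<^sup>2 - r\<^sup>2) = 11 * t\<^sup>2 - (val (a, b, e) z - sqn z)"
    unfolding distrib_left right_diff_distrib cmod_diff_eq assms(4)
    by (simp add: assms sqn_def[of c] power2_eq_square algebra_simps)
  then have "(cmod (z - c))\<^sup>2 + t\<^sup>2 = r\<^sup>2 \<longleftrightarrow> 11 * t\<^sup>2 = val (a, b, e) z - sqn z"
    by (smt (verit))
  then show "p \<in> dome (a, b, e) \<longleftrightarrow> p \<in> hemisphere c r"
    using assms(3) by (auto simp: p dome_def mem_hemisphere)
qed


lemma isometric_form:
  assumes "A$2$1 \<noteq> 0" "cx (- A$2$2 / A$2$1) = a / 2" "cy (- A$2$2 / A$2$1) = 11 * b / 2"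
    and "11 / (cmod (A$2$1))\<^sup>2 = e + a\<^sup>2 / 4 + 11 * b\<^sup>2 / 4"
  shows "isometric_sphere A = dome (a, b, e)"
    and "1 \<le> (cmod (A$2$1 * z + A$2$2))\<^sup>2 + (cmod (A$2$1))\<^sup>2 * t\<^sup>2 \<longleftrightarrow>
      val (a, b, e) z - sqn z \<le> 11 * t\<^sup>2"
proof -
  define w where "w = - A$2$2 / A$2$1"
  have w: "cx w = a / 2" "cy w = 11 * b / 2" using assms by (simp_all add: w_def)
  show "isometric_sphere A = dome (a, b, e)"
    unfolding isometric_sphere_def using assms
    by (intro dome_hemisphere[symmetric]) (simp_all add: power_divide)
  have "A$2$1 * z + A$2$2 = A$2$1 * (z - w)" using assms(1) by (simp add: w_def field_simps)
  then have "1 \<le> (cmod (A$2$1 * z + A$2$2))\<^sup>2 + (cmod (A$2$1))\<^sup>2 * t\<^sup>2 \<longleftrightarrow>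
      1 \<le> (cmod (A$2$1))\<^sup>2 * ((cmod (z - w))\<^sup>2 + t\<^sup>2)"
    by (simp add: norm_mult power_mult_distrib distrib_left)
  also have "\<dots> \<longleftrightarrow> 11 / (cmod (A$2$1))\<^sup>2 \<le> 11 * ((cmod (z - w))\<^sup>2 + t\<^sup>2)"
  proof -
    have "1 \<le> N * S \<longleftrightarrow> 11 / N \<le> 11 * S" if "N > 0" for N S :: real
      using that by (simp only: pos_divide_le_eq) (auto simp: mult.commute)
    then show ?thesis using assms(1) by simp
  qed
  also have "11 * ((cmod (z - w))\<^sup>2 + t\<^sup>2) = 11 * (cmod (z - w))\<^sup>2 + 11 * t\<^sup>2" by simp
  also have "11 * (cmod (z - w))\<^sup>2 = 11 / (cmod (A$2$1))\<^sup>2 - (val (a, b, e) z - sqn z)"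
    unfolding cmod_diff_eq assms(4) by (simp add: w sqn_def[of w] power2_eq_square algebra_simps)
  finally show "1 \<le> (cmod (A$2$1 * z + A$2$2))\<^sup>2 + (cmod (A$2$1))\<^sup>2 * t\<^sup>2 \<longleftrightarrow>
      val (a, b, e) z - sqn z \<le> 11 * t\<^sup>2" by auto
qed

lemma inverse_omega: "1 / \<omega> = - (\<omega> + 1) / 3" "1 / (\<omega> + 1) = - \<omega> / 3"
  and omega_nonzero [simp]: "\<omega> \<noteq> 0" "\<omega> + 1 \<noteq> 0"
proof -
  have *: "\<omega> * (\<omega> + 1) = - 3" by (simp add: distrib_left omega_sq)
  then show nz: "\<omega> \<noteq> 0" "\<omega> + 1 \<noteq> 0" by auto
  show "1 / \<omega> = - (\<omega> + 1) / 3" "1 / (\<omega> + 1) = - \<omega> / 3"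
    by (subst frac_eq_eq; use nz in \<open>simp add: algebra_simps omega_sq\<close>)+
qed

lemma cmod_theta: "(cmod \<theta>)\<^sup>2 = 11" "(cmod \<omega>)\<^sup>2 = 3" "(cmod (\<omega> + 1))\<^sup>2 = 3"
  by (simp_all add: cmod_power2 power_divide)

lemma small_center:
  "cx (of_real s / (\<omega> * \<theta>)) = - s / 6" "cy (of_real s / (\<omega> * \<theta>)) = - 11 * s / 6"
  "cx (of_real s / ((\<omega> + 1) * \<theta>)) = s / 6" "cy (of_real s / ((\<omega> + 1) * \<theta>)) = - 11 * s / 6"
proof -
  have c: "of_real s / (\<omega> * \<theta>) = (of_real s * (1 / \<omega>)) / \<theta>"
    "of_real s / ((\<omega> + 1) * \<theta>) = (of_real s * (1 / (\<omega> + 1))) / \<theta>"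
    by (simp_all add: divide_simps)
  show "cx (of_real s / (\<omega> * \<theta>)) = - s / 6" "cy (of_real s / (\<omega> * \<theta>)) = - 11 * s / 6"
    "cx (of_real s / ((\<omega> + 1) * \<theta>)) = s / 6" "cy (of_real s / ((\<omega> + 1) * \<theta>)) = - 11 * s / 6"
    unfolding c cx_divide_theta cy_divide_theta inverse_omega by simp_all
qed

lemma unit_sphere_eq:
  "hemisphere (of_int j / \<theta>) (1 / sqrt 11) = dome (unit_form j)"
  unfolding unit_form_def
  by (rule dome_hemisphere[symmetric])
    (simp_all add: cx_divide_theta cy_divide_theta power_divide power2_eq_square)

lemma small_sphere_eq:
  assumes "s = 1 \<or> s = - 1"
  shows "hemisphere (of_real s / (\<omega> * \<theta>)) (1 / sqrt 33) = dome (small_form (- s) (- s))"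
    and "hemisphere (of_real s / ((\<omega> + 1) * \<theta>)) (1 / sqrt 33) = dome (small_form s (- s))"
proof -
  have ss: "s\<^sup>2 = 1" using assms by auto
  show "hemisphere (of_real s / (\<omega> * \<theta>)) (1 / sqrt 33) = dome (small_form (- s) (- s))"
    unfolding small_form_def
    by (rule dome_hemisphere[symmetric]) (simp_all add: small_center power_divide ss)
  show "hemisphere (of_real s / ((\<omega> + 1) * \<theta>)) (1 / sqrt 33) = dome (small_form s (- s))"
    unfolding small_form_def
    by (rule dome_hemisphere[symmetric]) (simp_all add: small_center power_divide ss)
qed

lemma bounding_spheres_eq: "bounding_spheres = dome ` forms"
proof -
  have two: "{f s | s. s \<in> {1, -1 :: complex}} = {f 1, f (-1)}" for f :: "complex \<Rightarrow> (complex \<times> real) set"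
    by auto
  have s: "{hemisphere (s / (\<omega> * \<theta>)) (1 / sqrt 33) | s. s \<in> {1, -1}} =
      {dome (small_form (-1) (-1)), dome (small_form 1 1)}"
    "{hemisphere (s / ((\<omega> + 1) * \<theta>)) (1 / sqrt 33) | s. s \<in> {1, -1}} =
      {dome (small_form 1 (-1)), dome (small_form (-1) 1)}"
    unfolding two using small_sphere_eq[of 1] small_sphere_eq[of "- 1"] by simp_all
  show ?thesis
    unfolding bounding_spheres_def s unit_sphere_eq forms_def by auto
qed

lemma forms_isometric:
  assumes "l \<in> forms"
  obtains A where "A \<in> Gamma0" "A$2$1 \<noteq> 0" "isometric_sphere A = dome l"
    "\<And>z t. 1 \<le> (cmod (A$2$1 * z + A$2$2))\<^sup>2 + (cmod (A$2$1))\<^sup>2 * t\<^sup>2 \<longleftrightarrow>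
      val l z - sqn z \<le> 11 * t\<^sup>2"
proof -
  from assms consider j where "j \<in> {-5..5}" "j \<noteq> 0" "l = unit_form j"
    | s x where "s = 1 \<or> s = - 1" "x = \<omega>" "l = small_form (- s) (- s)"
    | s x where "s = 1 \<or> s = - 1" "x = \<omega> + 1" "l = small_form s (- s)"
    unfolding forms_def by force
  then show ?thesis
  proof cases
    case (1 j)
    have "-5 \<le> j" "j \<le> 5" "j \<noteq> 0" using 1 by auto
    then have "j = -5 \<or> j = -4 \<or> j = -3 \<or> j = -2 \<or> j = -1 \<or> j = 1 \<or> j = 2 \<or> j = 3 \<or> j = 4 \<or> j = 5"
      by presburger
    then have "\<exists>u v. u * j + v * 11 = 1"
      by (elim disjE; simp only:; presburger)
    then obtain u v where uv: "u * j + v * 11 = 1" by blast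
    \<comment> \<open>The determinant is
      \<open>u * j - v * \<theta>\<^sup>2 = u * j + 11 * v\<close>, so the Bezout relation between
      \<open>j\<close> and 11 completes the bottom row \<theta>, \<open>-j\<close>.\<close>
    define A :: "complex^2^2" where "A = vector [vector [of_int (- u), \<theta> * of_int v], vector [\<theta>, of_int (- j)]]"
    have A [simp]: "A$1$1 = of_int (- u)" "A$1$2 = \<theta> * of_int v" "A$2$1 = \<theta>" "A$2$2 = of_int (- j)"
      by (simp_all add: A_def)
    have "of_int (u * j + v * 11) = (1 :: complex)" unfolding uv by simp
    moreover have "\<theta> * of_int v * \<theta> = - 11 * of_int v"
      using theta_sq by (metis mult.assoc mult.commute)
    ultimately have "A \<in> Gamma0"
      unfolding Gamma0_iff by (auto intro!: bexI[of _ 1] simp: algebra_simps)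
    moreover have coeff: "A$2$1 \<noteq> 0" "cx (- A$2$2 / A$2$1) = 2 * of_int j / 2"
      "cy (- A$2$2 / A$2$1) = 11 * 0 / 2"
      "11 / (cmod (A$2$1))\<^sup>2 = 1 - (of_int j)\<^sup>2 + (2 * of_int j)\<^sup>2 / 4 + 11 * 0\<^sup>2 / 4"
      by (simp_all add: cx_divide_theta cy_divide_theta cmod_theta power_mult_distrib)
    ultimately show ?thesis
      using that isometric_form[OF coeff] unfolding 1 unit_form_def by blast
  next
    case (2 s x)
    \<comment> \<open>A lower triangular matrix with \<open>s * s = 1\<close> on the diagonal
      suffices; its center is \<open>s / (\<theta> * x)\<close>, and \<open>x\<close> has norm 3,
      whence the radius.\<close>
    define A :: "complex^2^2" where "A = vector [vector [of_real (- s), 0], vector [\<theta> * x, of_real (- s)]]"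
    have A [simp]: "A$1$1 = of_real (- s)" "A$1$2 = 0" "A$2$1 = \<theta> * x" "A$2$2 = of_real (- s)"
      by (simp_all add: A_def)
    have "A \<in> Gamma0" unfolding Gamma0_iff using 2 by auto
    moreover have c: "- A$2$2 / A$2$1 = of_real s / (\<omega> * \<theta>)"
      by (simp add: 2 mult.commute)
    have coeff: "A$2$1 \<noteq> 0" "cx (- A$2$2 / A$2$1) = (- s / 3) / 2"
      "cy (- A$2$2 / A$2$1) = 11 * (- s / 3) / 2"
      "11 / (cmod (A$2$1))\<^sup>2 = 0 + (- s / 3)\<^sup>2 / 4 + 11 * (- s / 3)\<^sup>2 / 4"
      unfolding c small_center using 2
      by (auto simp: cmod_theta norm_mult power_mult_distrib power_divide)
    ultimately show ?thesis
      using that isometric_form[OF coeff] unfolding 2 small_form_def by blast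
  next
    case (3 s x)
    define A :: "complex^2^2" where "A = vector [vector [of_real (- s), 0], vector [\<theta> * x, of_real (- s)]]"
    have A [simp]: "A$1$1 = of_real (- s)" "A$1$2 = 0" "A$2$1 = \<theta> * x" "A$2$2 = of_real (- s)"
      by (simp_all add: A_def)
    have "A \<in> Gamma0" unfolding Gamma0_iff using 3 by auto
    moreover have c: "- A$2$2 / A$2$1 = of_real s / ((\<omega> + 1) * \<theta>)"
      by (simp add: 3 mult.commute)
    have coeff: "A$2$1 \<noteq> 0" "cx (- A$2$2 / A$2$1) = (s / 3) / 2"
      "cy (- A$2$2 / A$2$1) = 11 * (- s / 3) / 2"
      "11 / (cmod (A$2$1))\<^sup>2 = 0 + (s / 3)\<^sup>2 / 4 + 11 * (- s / 3)\<^sup>2 / 4"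
      unfolding c small_center using 3
      by (auto simp: cmod_theta norm_mult power_mult_distrib power_divide)
    ultimately show ?thesis
      using that isometric_form[OF coeff] unfolding 3 small_form_def by blast
  qed
qed

section \<open>The row of hexagons\<close>

text \<open>The Voronoi cell of \<open>j\<close> in \<open>O11\<close>, in the coordinates of
  \<open>\<theta> * z\<close>. The first bound comes from the bisectors with \<open>j - 1\<close>
  and \<open>j + 1\<close>, the second from those with the four neighbours of \<open>j\<close> at
  squared distance 3, which is the norm of \<omega>.\<close>

definition hexagon :: "int \<Rightarrow> complex set" where
  "hexagon j = {z. \<bar>cx z - of_int j\<bar> \<le> 1 / 2 \<and> \<bar>cx z - of_int j\<bar> + \<bar>cy z\<bar> \<le> 3}"

text \<open>Any \<open>j\<close> may serve as witness, not only a nearest one. A point inside an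
  edge shared by two hexagons then also satisfies the strict version, so \<open>open_hex_row\<close>
  is the whole interior and not merely the union of the open hexagons.\<close>

definition hex_row :: "complex set" where
  "hex_row = {z. \<bar>cx z\<bar> \<le> 11 / 2 \<and> (\<exists>j\<in>{-5..5 :: int}. \<bar>cx z - of_int j\<bar> + \<bar>cy z\<bar> \<le> 3)}"

definition open_hex_row :: "complex set" where
  "open_hex_row = {z. \<bar>cx z\<bar> < 11 / 2 \<and> (\<exists>j\<in>{-5..5 :: int}. \<bar>cx z - of_int j\<bar> + \<bar>cy z\<bar> < 3)}"

lemma continuous_cx [continuous_intros]: "continuous_on S f \<Longrightarrow> continuous_on S (\<lambda>x. cx (f x))"
  and continuous_cy [continuous_intros]: "continuous_on S f \<Longrightarrow> continuous_on S (\<lambda>x. cy (f x))"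
  unfolding cx_def cy_def by (rule continuous_intros | assumption)+

lemma abs_int_diff_ge_half:
  assumes "\<bar>x - of_int j\<bar> \<le> (1 / 2 :: real)"
  shows "\<bar>x - of_int j\<bar> \<le> \<bar>x - of_int k\<bar>"
proof (cases "j = k")
  case False
  then have "1 \<le> \<bar>real_of_int j - of_int k\<bar>" by linarith
  then show ?thesis using assms by linarith
qed simp

lemma nearest_index:
  fixes x :: real
  assumes "\<bar>x\<bar> \<le> 11 / 2"
  obtains j :: int where "j \<in> {-5..5}" "\<bar>x - of_int j\<bar> \<le> 1 / 2"
proof -
  \<comment> \<open>At the right end \<open>x = 11 / 2\<close> rounding would give 6, which is
    outside the row.\<close>
  define j where "j = (if x = 11 / 2 then 5 else \<lfloor>x + 1 / 2\<rfloor>)"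
  have "\<bar>x - of_int j\<bar> \<le> 1 / 2" unfolding j_def by (simp add: abs_if) linarith
  moreover have "j \<in> {-5..5}"
  proof (cases "x = 11 / 2")
    case False
    then have "x < 11 / 2" "- 11 / 2 \<le> x" using assms by linarith+
    then have "\<lfloor>x + 1 / 2\<rfloor> < 6" "-5 \<le> \<lfloor>x + 1 / 2\<rfloor>" by (simp_all add: floor_less_iff le_floor_iff)
    then show ?thesis using False by (simp add: j_def)
  qed (simp add: j_def)
  ultimately show ?thesis by (rule that[rotated])
qed

lemma row_eq_hexagons: "hex_row = (\<Union>j\<in>{-5..5}. hexagon j)"
proof (intro equalityI subsetI)
  fix z assume z: "z \<in> hex_row"
  then obtain j where "j \<in> {-5..5}" "\<bar>cx z - of_int j\<bar> \<le> 1 / 2"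
    using nearest_index unfolding hex_row_def by blast
  moreover obtain k :: int where "\<bar>cx z - of_int k\<bar> + \<bar>cy z\<bar> \<le> 3" using z by (auto simp: hex_row_def)
  ultimately have "z \<in> hexagon j"
    using abs_int_diff_ge_half[of "cx z" j k] by (simp add: hexagon_def)
  with \<open>j \<in> _\<close> show "z \<in> (\<Union>j\<in>{-5..5}. hexagon j)" by blast
next
  fix z assume "z \<in> (\<Union>j\<in>{-5..5}. hexagon j)"
  then obtain j where j: "j \<in> {-5..5}" "z \<in> hexagon j" by blast
  then have "\<bar>real_of_int j\<bar> \<le> 5" by auto
  with j have "\<bar>cx z\<bar> \<le> 11 / 2" unfolding hexagon_def mem_Collect_eq by linarith
  with j show "z \<in> hex_row" by (auto simp: hex_row_def hexagon_def)
qed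

lemma closed_hexagon: "closed (hexagon j)"
  unfolding hexagon_def by (intro closed_Collect_conj closed_Collect_le continuous_intros)

lemma convex_abs_le:
  "convex {z. \<bar>cx z - a\<bar> + \<bar>cy z\<bar> \<le> r}" "convex {z. \<bar>cx z - a\<bar> + \<bar>cy z\<bar> < r}"
  "convex {z. \<bar>cx z - a\<bar> \<le> r}" "convex {z. \<bar>cx z - a\<bar> < r}"
proof -
  have 1: "convex_on UNIV (\<lambda>z. \<bar>cx z - a\<bar>)"
  proof (rule convex_onI)
    fix t x y assume t: "0 < t" "t < (1 :: real)"
    have "cx ((1 - t) *\<^sub>R x + t *\<^sub>R y) - a = (1 - t) * (cx x - a) + t * (cx y - a)"
      by (simp add: algebra_simps)
    then show "\<bar>cx ((1 - t) *\<^sub>R x + t *\<^sub>R y) - a\<bar> \<le> (1 - t) * \<bar>cx x - a\<bar> + t * \<bar>cx y - a\<bar>"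
      using t abs_triangle_ineq[of "(1 - t) * (cx x - a)" "t * (cx y - a)"] by (simp add: abs_mult)
  qed auto
  have 2: "convex_on UNIV (\<lambda>z. \<bar>cy z\<bar>)"
  proof (rule convex_onI)
    fix t x y assume t: "0 < t" "t < (1 :: real)"
    then show "\<bar>cy ((1 - t) *\<^sub>R x + t *\<^sub>R y)\<bar> \<le> (1 - t) * \<bar>cy x\<bar> + t * \<bar>cy y\<bar>"
      using abs_triangle_ineq[of "(1 - t) * cy x" "t * cy y"] by (simp add: abs_mult)
  qed auto
  note 12 = convex_on_add[OF 1 2]
  have le: "convex {z. f z \<le> r}" and lt: "convex {z. f z < r}" if "convex_on UNIV f" for f :: "complex \<Rightarrow> real"
  proof -
    have *: "f (u *\<^sub>R x + v *\<^sub>R y) \<le> u * f x + v * f y" if "0 \<le> u" "0 \<le> v" "u + v = 1" for u v x y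
      using \<open>convex_on UNIV f\<close> that by (simp add: convex_on_def)
    show "convex {z. f z \<le> r}"
    proof (rule convexI)
      fix x y :: complex and u v :: real
      assume "x \<in> {z. f z \<le> r}" "y \<in> {z. f z \<le> r}" and uv: "0 \<le> u" "0 \<le> v" "u + v = 1"
      then have "u * f x + v * f y \<le> r" by (intro convex_bound_le) auto
      with *[OF uv, of x y] show "u *\<^sub>R x + v *\<^sub>R y \<in> {z. f z \<le> r}" by simp
    qed
    show "convex {z. f z < r}"
    proof (rule convexI)
      fix x y :: complex and u v :: real
      assume "x \<in> {z. f z < r}" "y \<in> {z. f z < r}" and uv: "0 \<le> u" "0 \<le> v" "u + v = 1"
      then have "u * f x + v * f y < r" by (intro convex_bound_lt) auto
      with *[OF uv, of x y] show "u *\<^sub>R x + v *\<^sub>R y \<in> {z. f z < r}" by simp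
    qed
  qed
  show "convex {z. \<bar>cx z - a\<bar> + \<bar>cy z\<bar> \<le> r}" "convex {z. \<bar>cx z - a\<bar> + \<bar>cy z\<bar> < r}"
    "convex {z. \<bar>cx z - a\<bar> \<le> r}" "convex {z. \<bar>cx z - a\<bar> < r}"
    using le[OF 12] lt[OF 12] le[OF 1] lt[OF 1] by auto
qed

lemma convex_hexagon: "convex (hexagon j)"
proof -
  have "hexagon j = {z. \<bar>cx z - of_int j\<bar> \<le> 1 / 2} \<inter> {z. \<bar>cx z - of_int j\<bar> + \<bar>cy z\<bar> \<le> 3}"
    by (auto simp: hexagon_def)
  then show ?thesis by (simp only: convex_Int convex_abs_le)
qed

lemma subset_closure_interior_convex:
  fixes S :: "complex set"
  assumes "convex S" "open U" "U \<subseteq> S" "p \<in> U"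
  shows "S \<subseteq> closure (interior S)"
proof -
  have "interior S \<noteq> {}" using assms interior_maximal[of U S] by auto
  then show ?thesis using convex_closure_interior[OF assms(1)] closure_subset[of S] by simp
qed

lemma hexagon_subset_closure_interior: "hexagon j \<subseteq> closure (interior (hexagon j))"
proof (rule subset_closure_interior_convex[OF convex_hexagon])
  show "open {z. \<bar>cx z - of_int j\<bar> < 1 / 2 \<and> \<bar>cx z - of_int j\<bar> + \<bar>cy z\<bar> < 3}"
    by (intro open_Collect_conj open_Collect_less continuous_intros)
  show "point (of_int j) 0 \<in> {z. \<bar>cx z - of_int j\<bar> < 1 / 2 \<and> \<bar>cx z - of_int j\<bar> + \<bar>cy z\<bar> < 3}"
    by simp
qed (auto simp: hexagon_def)

lemma closed_row: "closed hex_row"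
  unfolding row_eq_hexagons by (intro closed_UN ballI closed_hexagon) auto

text \<open>Steps of a fixed small size along the coordinate directions keep an interior point in
  the row. Steps both ways in \<open>cx\<close> make the outer bound strict; a step away from the
  axis \<open>cy z = 0\<close> makes the other bound strict.\<close>

lemma interior_row: "interior hex_row = open_hex_row"
proof
  show "open_hex_row \<subseteq> interior hex_row"
  proof (rule interior_maximal)
    show "open_hex_row \<subseteq> hex_row" unfolding open_hex_row_def hex_row_def by (auto intro: less_imp_le)
    have "open_hex_row = {z. \<bar>cx z\<bar> < 11 / 2} \<inter> (\<Union>j\<in>{-5..5 :: int}. {z. \<bar>cx z - of_int j\<bar> + \<bar>cy z\<bar> < 3})"
      by (auto simp: open_hex_row_def)
    then show "open open_hex_row"
      by (elim ssubst) (intro open_Int open_UN ballI open_Collect_less continuous_intros)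
  qed
  show "interior hex_row \<subseteq> open_hex_row"
  proof
    fix z assume "z \<in> interior hex_row"
    then obtain e where e: "e > 0" "ball z e \<subseteq> hex_row" by (auto simp: mem_interior)
    have near: "z + v \<in> hex_row" if "norm v < e" for v
      using e(2) that by (auto simp: dist_norm)
    \<comment> \<open>A shift by \<open>11 * r\<close> in \<open>cx\<close> has length
      \<open>11 * r / sqrt 11\<close>, and in \<open>cy\<close> it has length \<open>r\<close>; both
      stay below \<open>e\<close>.\<close>
    define r where "r = e / 24"
    have "r > 0" using e by (simp add: r_def)
    have nrm: "norm (point (s * 11 * r) 0) < e" "norm (point 0 (s * 11 * r)) < e" if "s = 1 \<or> s = - 1" for s
    proof -
      have "3 < sqrt 11" by (rule real_less_rsqrt) simp
      then have "11 * r / sqrt 11 < e" "r < e"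
        using \<open>e > 0\<close> by (auto simp: r_def divide_simps)
      then show "norm (point (s * 11 * r) 0) < e" "norm (point 0 (s * 11 * r)) < e"
        using that \<open>r > 0\<close> by (auto simp: point_def cmod_def)
    qed
    have "z + point (11 * r) 0 \<in> hex_row" "z + point (- 11 * r) 0 \<in> hex_row"
      "z + point 0 (11 * r) \<in> hex_row" "z + point 0 (- 11 * r) \<in> hex_row"
      using near nrm[of 1] nrm[of "- 1"] by simp_all
    then have "\<bar>cx z + 11 * r\<bar> \<le> 11 / 2" "\<bar>cx z - 11 * r\<bar> \<le> 11 / 2"
      and y1: "\<exists>j\<in>{-5..5 :: int}. \<bar>cx z - of_int j\<bar> + \<bar>cy z + 11 * r\<bar> \<le> 3"
      and y2: "\<exists>j\<in>{-5..5 :: int}. \<bar>cx z - of_int j\<bar> + \<bar>cy z - 11 * r\<bar> \<le> 3"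
      by (simp_all add: hex_row_def)
    then have "\<bar>cx z\<bar> < 11 / 2" using \<open>r > 0\<close> by linarith
    moreover have "\<exists>j\<in>{-5..5 :: int}. \<bar>cx z - of_int j\<bar> + \<bar>cy z\<bar> < 3"
    proof (cases "cy z \<ge> 0")
      case True
      with y1 \<open>r > 0\<close> show ?thesis by (elim bexE, intro bexI) auto
    next
      case False
      with y2 \<open>r > 0\<close> show ?thesis by (elim bexE, intro bexI) auto
    qed
    ultimately show "z \<in> open_hex_row" by (simp add: open_hex_row_def)
  qed
qed

lemma row_subset_closure_interior: "hex_row \<subseteq> closure (interior hex_row)"
proof
  fix z assume "z \<in> hex_row"
  then obtain j where "j \<in> {-5..5}" "z \<in> hexagon j" by (auto simp: row_eq_hexagons)
  moreover from this have "interior (hexagon j) \<subseteq> interior hex_row"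
    unfolding row_eq_hexagons by (intro interior_mono) auto
  ultimately show "z \<in> closure (interior hex_row)"
    using hexagon_subset_closure_interior closure_mono by blast
qed

text \<open>The row is a union of convex slabs \<open>K j\<close>, each of which meets the segment
  \<open>axis\<close> at the center of its hexagon. Adding the segment to every slab gives connected
  sets with a common point.\<close>

lemma connected_open_row: "connected open_hex_row"
proof -
  define axis where "axis = (\<lambda>x. point x 0) ` {-11/2<..<11/2}"
  have axis: "z \<in> axis \<longleftrightarrow> \<bar>cx z\<bar> < 11 / 2 \<and> cy z = 0" for z
  proof
    assume "\<bar>cx z\<bar> < 11 / 2 \<and> cy z = 0"
    then have "z = point (cx z) 0" "cx z \<in> {-11/2<..<11/2}" by (metis point_cxy, auto)
    then show "z \<in> axis" unfolding axis_def by blast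
  qed (auto simp: axis_def)
  have "connected axis"
    unfolding axis_def point_def by (intro connected_continuous_image continuous_intros) auto
  define K where "K j = {z. \<bar>cx z - 0\<bar> < 11 / 2} \<inter> {z. \<bar>cx z - of_int j\<bar> + \<bar>cy z\<bar> < 3}" for j :: int
  have "connected (axis \<union> K j)" if "j \<in> {-5..5}" for j
  proof (rule connected_Un)
    show "connected (K j)"
      unfolding K_def by (intro convex_connected convex_Int convex_abs_le)
    have "\<bar>real_of_int j\<bar> \<le> 5" using that by auto
    then have "point (of_int j) 0 \<in> axis \<inter> K j" by (simp add: K_def axis)
    then show "axis \<inter> K j \<noteq> {}" by blast
  qed fact
  then have "connected (\<Union>j\<in>{-5..5 :: int}. axis \<union> K j)"
  proof (intro connected_Union)
    have "point 0 0 \<in> axis" by (simp add: axis)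
    then show "\<Inter> ((\<lambda>j. axis \<union> K j) ` {-5..5 :: int}) \<noteq> {}" by blast
  qed auto
  moreover have "open_hex_row = (\<Union>j\<in>{-5..5 :: int}. axis \<union> K j)"
  proof (intro equalityI subsetI)
    fix z assume "z \<in> (\<Union>j\<in>{-5..5 :: int}. axis \<union> K j)"
    then consider "z \<in> axis" | "\<exists>j\<in>{-5..5 :: int}. z \<in> K j" by auto
    then show "z \<in> open_hex_row"
    proof cases
      case 1
      then obtain j where "j \<in> {-5..5}" "\<bar>cx z - of_int j\<bar> \<le> 1 / 2"
        using nearest_index[of "cx z"] by (auto simp: axis)
      with 1 show ?thesis by (force simp: open_hex_row_def axis)
    qed (auto simp: open_hex_row_def K_def)
  qed (auto simp: open_hex_row_def K_def)
  ultimately show ?thesis by simp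
qed

section \<open>The row as a fundamental domain for translations\<close>

lemma lattice_coords:
  assumes "b \<in> O11"
  obtains p q :: int where "cx b = 11 / 2 * of_int p" "cy b = 11 / 2 * of_int q" "even (p + q)"
proof -
  obtain m n :: int where b: "Re b = of_int m - of_int n / 2" "Im b = of_int n * sqrt 11 / 2"
    using O11_cartesian[OF assms] .
  have "cx b = 11 / 2 * of_int (- n)" "cy b = 11 / 2 * of_int (2 * m - n)"
    by (simp_all add: cx_def cy_def b)
  then show ?thesis by (rule that) simp
qed

text \<open>The size of the row leaves only translations with \<open>p\<close> and \<open>q\<close>
  equal to 1 or -1. Such a translation shifts \<open>cy\<close> by 11/2 and moves the row of centers
  by an odd multiple of 1/2, so the two hexagon bounds would have to exceed a total of 6.\<close>

lemma open_row_translates_disjoint: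
  assumes b: "b \<in> O11" "b \<noteq> 0" and z: "z \<in> open_hex_row"
  shows "z + b \<notin> open_hex_row"
proof
  assume zb: "z + b \<in> open_hex_row"
  obtain p q :: int where pq: "cx b = 11 / 2 * of_int p" "cy b = 11 / 2 * of_int q" "even (p + q)"
    using lattice_coords[OF b(1)] .
  obtain j where j: "\<bar>cx z\<bar> < 11 / 2" "\<bar>cx z - of_int j\<bar> + \<bar>cy z\<bar> < 3"
    using z by (auto simp: open_hex_row_def)
  obtain k where k: "\<bar>cx z + cx b\<bar> < 11 / 2" "\<bar>cx z + cx b - of_int k\<bar> + \<bar>cy z + cy b\<bar> < 3"
    using zb by (auto simp: open_hex_row_def)
  have "\<bar>cx b\<bar> < 11" using j k by linarith
  then have p: "\<bar>real_of_int p\<bar> < 2" unfolding pq by linarith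
  have "\<bar>cy b\<bar> < 6" using j k by linarith
  then have q: "\<bar>real_of_int q\<bar> < 2" unfolding pq by linarith
  have "(p = 0 \<and> q = 0) \<or> (\<bar>p\<bar> = 1 \<and> \<bar>q\<bar> = 1)"
  proof -
    have "\<bar>p\<bar> < 2" "\<bar>q\<bar> < 2" using p q by linarith+
    then show ?thesis using pq(3) by presburger
  qed
  then show False
  proof
    assume "p = 0 \<and> q = 0"
    then have "b = 0" by (intro cxy_eqI) (simp_all add: pq)
    with b show False by simp
  next
    assume pq1: "\<bar>p\<bar> = 1 \<and> \<bar>q\<bar> = 1"
    then have "\<bar>cy b\<bar> = 11 / 2" unfolding pq(2) by (simp add: abs_mult flip: of_int_abs)
    moreover have "1 / 2 \<le> \<bar>cx b - of_int k + of_int j\<bar>"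
    proof -
      have "2 * (cx b - of_int k + of_int j) = of_int (11 * p - 2 * k + 2 * j)"
        by (simp add: pq)
      \<comment> \<open>The number is odd because \<open>p\<close> is odd.\<close>
      moreover have "11 * p - 2 * k + 2 * j \<noteq> 0" using pq1 by presburger
      ultimately have "1 \<le> \<bar>2 * (cx b - of_int k + of_int j)\<bar>"
        by (metis of_int_abs of_int_1_le_iff int_one_le_iff_zero_less zero_less_abs_iff)
      then show ?thesis unfolding abs_mult by simp
    qed
    ultimately show False using j k by linarith
  qed
qed

lemma row_translates_cover:
  obtains b where "b \<in> O11" "z - b \<in> hex_row"
proof -
  obtain v where v: "v \<in> O11" "\<bar>cx z - Re v\<bar> \<le> 1 / 2" "\<bar>cx z - Re v\<bar> + \<bar>cy z - sqrt 11 * Im v\<bar> \<le> 3"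
  proof -
    \<comment> \<open>The lattice lies on the lines where \<open>cy\<close> is a multiple of 11/2.
      Rounding to a line and then along it places the point in a rectangle around the lattice point,
      whose corners still protrude from the hexagon.\<close>
    define n where "n = round (cy z * 2 / 11)"
    define m where "m = round (cx z + of_int n / 2)"
    define x where "x = cx z - (of_int m - of_int n / 2)"
    define y where "y = cy z - 11 / 2 * of_int n"
    have x: "\<bar>x\<bar> \<le> 1 / 2" using of_int_round_abs_le[of "cx z + of_int n / 2"]
      by (simp add: x_def m_def abs_minus_commute algebra_simps)
    have y: "\<bar>y\<bar> \<le> 11 / 4" using of_int_round_abs_le[of "cy z * 2 / 11"]
      unfolding y_def n_def[symmetric] by linarith
    show ?thesis
    proof (cases "\<bar>x\<bar> + \<bar>y\<bar> \<le> 3")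
      case True
      show ?thesis
        by (rule that[of "of_int m + of_int n * \<omega>", OF O11I[OF refl]])
          (use True x in \<open>simp_all add: x_def y_def mult.assoc mult.left_commute[of "sqrt 11"]\<close>)
    next
      case False
      \<comment> \<open>Near a protruding corner the neighbouring lattice point, displaced by
        \<open>r / 2\<close> and \<open>11 * s / 2\<close>, is the right center: relative to it the
        sum of absolute values becomes \<open>6 - (\<bar>x\<bar> + \<bar>y\<bar>)\<close>, which is
        less than 3.\<close>
      define s :: int where "s = (if y \<ge> 0 then 1 else -1)"
      define r :: int where "r = (if x \<ge> 0 then 1 else -1)"
      have "even (r + s)" by (simp add: r_def s_def)
      then obtain d where d: "r + s = 2 * d" by (rule evenE)
      then have "real_of_int r + real_of_int s = 2 * real_of_int d"
        by (metis of_int_add of_int_mult of_int_numeral)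
      then have d': "real_of_int d = (of_int r + of_int s) / 2" by simp
      show ?thesis
      proof (rule that[of "of_int (m + d) + of_int (n + s) * \<omega>", OF O11I[OF refl]])
        have cx: "cx z - Re (of_int (m + d) + of_int (n + s) * \<omega>) = x - of_int r / 2"
          by (simp add: x_def d' field_simps)
        have cy: "cy z - sqrt 11 * Im (of_int (m + d) + of_int (n + s) * \<omega>) = y - of_int s * 11 / 2"
          by (simp add: y_def algebra_simps)
        show "\<bar>cx z - Re (of_int (m + d) + of_int (n + s) * \<omega>)\<bar> \<le> 1 / 2"
          unfolding cx using x by (simp add: r_def)
        show "\<bar>cx z - Re (of_int (m + d) + of_int (n + s) * \<omega>)\<bar> +
            \<bar>cy z - sqrt 11 * Im (of_int (m + d) + of_int (n + s) * \<omega>)\<bar> \<le> 3"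
          unfolding cx cy using x y False
          by (cases "x \<ge> 0"; cases "y \<ge> 0") (auto simp: r_def s_def)
      qed
    qed
  qed
  obtain m n :: int where mn: "Re v = of_int m - of_int n / 2" "Im v = of_int n * sqrt 11 / 2"
    using O11_cartesian[OF v(1)] .
  \<comment> \<open>\<open>m + n * \<omega>\<close> is congruent to the integer \<open>m + 5 * n\<close> modulo \<open>\<theta>\<close>.\<close>
  define j where "j = (m + 5 * n + 5) mod 11 - 5"
  define k where "k = (m + 5 * n + 5) div 11"
  have jk: "m + 5 * n = 11 * k + j" unfolding j_def k_def by presburger
  have j: "j \<in> {-5..5}" unfolding j_def by auto
  \<comment> \<open>This is the quotient of \<open>v - j\<close> by \<theta>.\<close>
  define b where "b = of_int (n - k) + of_int (n - 2 * k) * \<omega>"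
  have "real_of_int m = 11 * of_int k + of_int j - 5 * of_int n"
    using jk by (metis (no_types, opaque_lifting) add_diff_cancel_right' of_int_add of_int_diff of_int_mult of_int_numeral)
  then have "cx b = Re v - of_int j" "cy b = sqrt 11 * Im v"
    by (simp_all add: b_def cx_def cy_def mn field_simps)
  then have "z - b \<in> hexagon j" using v by (simp add: hexagon_def algebra_simps)
  moreover have "b \<in> O11" unfolding b_def by (rule O11I[OF refl])
  ultimately show ?thesis using j by (intro that[of b]) (auto simp: row_eq_hexagons)
qed

section \<open>The floor of the Ford domain\<close>

text \<open>The power cell of a sphere within the row. Its borders are straight because the
  quadratic parts cancel.\<close>

definition cell :: "affine_form \<Rightarrow> complex set" where
  "cell l = {z \<in> hex_row. \<forall>l'\<in>forms. val l' z \<le> val l z}"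

definition floor_height :: "complex \<Rightarrow> real" where
  "floor_height z = (Max ((\<lambda>l. val l z) ` forms) - sqn z) / 11"

lemma val_unit [simp]: "val (unit_form j) z = 2 * of_int j * cx z + 1 - (of_int j)\<^sup>2"
  and val_small [simp]: "val (small_form \<sigma> \<tau>) z = (\<sigma> * cx z + \<tau> * cy z) / 3"
  by (simp_all add: unit_form_def small_form_def add_divide_distrib)

lemma forms_nonempty: "forms \<noteq> {}"
  by (auto simp: forms_def)

lemma unit_in_forms: "j \<in> {-5..5} \<Longrightarrow> j \<noteq> 0 \<Longrightarrow> unit_form j \<in> forms"
  by (auto simp: forms_def)

lemma small_in_forms:
  assumes "\<sigma> = 1 \<or> \<sigma> = - 1" "\<tau> = 1 \<or> \<tau> = - 1"
  shows "small_form \<sigma> \<tau> \<in> forms"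
  using assms by (auto simp: forms_def)

text \<open>The spheres at 1 and -1 are kept apart from the other unit spheres because their cells
  reach beyond their hexagons into the one around 0.\<close>

lemma forms_cases:
  assumes "l \<in> forms"
  obtains (outer) j where "j \<in> {-5..5}" "\<bar>j\<bar> \<ge> 2" "l = unit_form j"
    | (inner) \<sigma> :: int where "\<sigma> = 1 \<or> \<sigma> = - 1" "l = unit_form \<sigma>"
    | (small) \<sigma> \<tau> :: real where "\<sigma> = 1 \<or> \<sigma> = - 1" "\<tau> = 1 \<or> \<tau> = - 1" "l = small_form \<sigma> \<tau>"
proof -
  from assms consider "l \<in> unit_form ` ({-5..5} - {0})"
    | "l \<in> (\<lambda>(\<sigma>, \<tau>). small_form \<sigma> \<tau>) ` ({1, -1} \<times> {1, -1})"
    unfolding forms_def Un_iff by argo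
  then show ?thesis
  proof cases
    case 1
    then obtain j where j: "l = unit_form j" "j \<in> {-5..5}" "j \<noteq> 0" by (elim imageE) simp
    then have "\<bar>j\<bar> \<ge> 2 \<or> j = 1 \<or> j = - 1" by auto
    then show ?thesis using j that(1,2) by blast
  next
    case 2
    then obtain p where "l = (\<lambda>(\<sigma>, \<tau>). small_form \<sigma> \<tau>) p" "p \<in> {1, -1} \<times> {1, -1}" by (rule imageE)
    then show ?thesis using that(3)[of "fst p" "snd p"] by (auto simp: split_def)
  qed
qed

lemma row_cover:
  assumes "z \<in> hex_row"
  obtains l where "l \<in> forms" "z \<in> cell l"
proof -
  have "Max ((\<lambda>l. val l z) ` forms) \<in> (\<lambda>l. val l z) ` forms"
    using finite_forms forms_nonempty by (intro Max_in) auto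
  then obtain l where l: "Max ((\<lambda>l. val l z) ` forms) = val l z" "l \<in> forms" by (rule imageE)
  have "val l' z \<le> val l z" if "l' \<in> forms" for l'
    unfolding l(1)[symmetric] using finite_forms that by (intro Max_ge) auto
  then have "z \<in> cell l" using assms by (simp add: cell_def)
  with l(2) show ?thesis using that by blast
qed

lemma floor_height_cell:
  assumes "l \<in> forms" "z \<in> cell l"
  shows "11 * floor_height z = val l z - sqn z"
proof -
  have "Max ((\<lambda>l. val l z) ` forms) = val l z"
    using assms finite_forms by (intro Max_eqI) (auto simp: cell_def)
  then show ?thesis by (simp add: floor_height_def)
qed

lemma floor_height_le_iff:
  "floor_height z \<le> h \<longleftrightarrow> (\<forall>l\<in>forms. val l z - sqn z \<le> 11 * h)"
proof -
  have "floor_height z \<le> h \<longleftrightarrow> Max ((\<lambda>l. val l z) ` forms) \<le> 11 * h + sqn z"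
    unfolding floor_height_def by (simp add: pos_divide_le_eq algebra_simps)
  then show ?thesis using finite_forms forms_nonempty by (auto simp: diff_le_eq)
qed

text \<open>Among unit forms the nearest center has the largest value, as completing the square
  shows; at the two ends of the row its border replaces the missing neighbour. The small spheres
  cannot interfere: for \<open>\<bar>cx z\<bar> \<ge> 3 / 2\<close> their value is at most
  \<open>\<bar>cx z\<bar> / 3 + 1\<close>, against at least
  \<open>(cx z)\<^sup>2 + 3 / 4\<close>.\<close>

lemma cell_outer:
  assumes j: "j \<in> {-5..5}" "\<bar>j\<bar> \<ge> 2"
  shows "z \<in> cell (unit_form j) \<longleftrightarrow> z \<in> hexagon j"
proof
  assume z: "z \<in> cell (unit_form j)"
  have X: "\<bar>cx z\<bar> \<le> 11 / 2" using z by (simp add: cell_def hex_row_def)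
  have left: "of_int j - 1 / 2 \<le> cx z"
  proof (cases "j = - 5 \<or> j = 2")
    case False
    then have "unit_form (j - 1) \<in> forms" using j by (intro unit_in_forms) auto
    then have "val (unit_form (j - 1)) z \<le> val (unit_form j) z" using z unfolding cell_def by blast
    then show ?thesis by (simp add: power2_eq_square algebra_simps)
  next
    case True
    then show ?thesis
    proof
      assume "j = 2"
      have "val (unit_form 1) z \<le> val (unit_form 2) z"
        using z unit_in_forms[of 1, simplified] unfolding cell_def \<open>j = 2\<close> by blast
      then show ?thesis by (simp add: \<open>j = 2\<close>)
    qed (use X in \<open>auto; linarith\<close>)
  qed
  have right: "cx z \<le> of_int j + 1 / 2"
  proof (cases "j = 5 \<or> j = - 2")
    case False
    then have "unit_form (j + 1) \<in> forms" using j by (intro unit_in_forms) auto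
    then have "val (unit_form (j + 1)) z \<le> val (unit_form j) z" using z unfolding cell_def by blast
    then show ?thesis by (simp add: power2_eq_square algebra_simps)
  next
    case True
    then show ?thesis
    proof
      assume "j = - 2"
      have "val (unit_form (- 1)) z \<le> val (unit_form (- 2)) z"
        using z unit_in_forms[of "- 1", simplified] unfolding cell_def \<open>j = - 2\<close> by blast
      then show ?thesis by (simp add: \<open>j = - 2\<close>)
    qed (use X in \<open>auto; linarith\<close>)
  qed
  have near: "\<bar>cx z - of_int j\<bar> \<le> 1 / 2" using left right by linarith
  obtain k :: int where "\<bar>cx z - of_int k\<bar> + \<bar>cy z\<bar> \<le> 3" using z by (auto simp: cell_def hex_row_def)
  then show "z \<in> hexagon j" using near abs_int_diff_ge_half[OF near, of k] by (simp add: hexagon_def)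
next
  assume z: "z \<in> hexagon j"
  then have near: "\<bar>cx z - of_int j\<bar> \<le> 1 / 2" and y: "\<bar>cx z - of_int j\<bar> + \<bar>cy z\<bar> \<le> 3"
    by (auto simp: hexagon_def)
  have eq: "val (unit_form k) z = 1 + (cx z)\<^sup>2 - (cx z - of_int k)\<^sup>2" for k
    by (simp add: power2_eq_square algebra_simps)
  have "val l' z \<le> val (unit_form j) z" if "l' \<in> forms" for l'
    using that
  proof (cases l' rule: forms_cases)
    case (outer k)
    have "(cx z - of_int j)\<^sup>2 \<le> (cx z - of_int k)\<^sup>2"
      using abs_int_diff_ge_half[OF near] by (simp add: abs_le_square_iff)
    then show ?thesis unfolding outer eq by simp
  next
    case (inner k)
    have "(cx z - of_int j)\<^sup>2 \<le> (cx z - of_int k)\<^sup>2"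
      using abs_int_diff_ge_half[OF near] by (simp add: abs_le_square_iff)
    then show ?thesis unfolding inner eq by simp
  next
    case (small \<sigma> \<tau>)
    have "\<bar>real_of_int j\<bar> \<ge> 2" using j by linarith
    then have x: "\<bar>cx z\<bar> \<ge> 3 / 2" using near by linarith
    have "\<sigma> * cx z + \<tau> * cy z \<le> \<bar>cx z\<bar> + \<bar>cy z\<bar>" using small by auto
    then have 1: "val l' z \<le> \<bar>cx z\<bar> / 3 + 1" using y by (simp add: small)
    have "\<bar>cx z - of_int j\<bar>\<^sup>2 \<le> (1 / 2)\<^sup>2" using near by (intro power_mono) auto
    then have 2: "val (unit_form j) z \<ge> (cx z)\<^sup>2 + 3 / 4" unfolding eq by (simp add: power2_eq_square)
    have "3 / 2 * \<bar>cx z\<bar> \<le> \<bar>cx z\<bar> * \<bar>cx z\<bar>" using x by (intro mult_right_mono) auto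
    then have "\<bar>cx z\<bar> / 3 + 1 \<le> (cx z)\<^sup>2 + 3 / 4" using x by (simp add: power2_eq_square)
    with 1 2 show ?thesis by linarith
  qed
  moreover have "z \<in> hex_row" using z j(1) by (auto simp: row_eq_hexagons)
  ultimately show "z \<in> cell (unit_form j)" by (simp add: cell_def)
qed

text \<open>The cell is the hexagon around \<open>\<sigma>\<close> together with the triangle from 0
  to its two nearest vertices. The lines with slope 5 are where \<open>2 * \<sigma> * cx z\<close>
  equals the value of a small form.\<close>

lemma cell_inner:
  fixes \<sigma> :: int
  assumes \<sigma>: "\<sigma> = 1 \<or> \<sigma> = - 1"
  shows "z \<in> cell (unit_form \<sigma>) \<longleftrightarrow> \<bar>cy z\<bar> \<le> 5 * of_int \<sigma> * cx z \<and> \<bar>cx z - of_int \<sigma>\<bar> + \<bar>cy z\<bar> \<le> 3 \<and>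
    of_int \<sigma> * cx z \<le> 3 / 2"
proof
  assume z: "z \<in> cell (unit_form \<sigma>)"
  have v: "val l z \<le> 2 * of_int \<sigma> * cx z" if "l \<in> forms" for l
    using z that \<sigma> unfolding cell_def by auto
  have "val (small_form (of_int \<sigma>) 1) z \<le> 2 * of_int \<sigma> * cx z"
    "val (small_form (of_int \<sigma>) (-1)) z \<le> 2 * of_int \<sigma> * cx z"
    using \<sigma> by (intro v small_in_forms; auto)+
  then have y: "\<bar>cy z\<bar> \<le> 5 * of_int \<sigma> * cx z" by (simp add: abs_le_iff mult.assoc)
  have "val (unit_form (2 * \<sigma>)) z \<le> 2 * of_int \<sigma> * cx z"
    using \<sigma> by (intro v unit_in_forms) auto
  then have x: "of_int \<sigma> * cx z \<le> 3 / 2" using \<sigma> by auto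
  have "\<bar>cx z - of_int \<sigma>\<bar> + \<bar>cy z\<bar> \<le> 3"
  proof (cases "of_int \<sigma> * cx z \<le> 1 / 2")
    case True
    then show ?thesis using \<sigma> y by auto
  next
    case False
    then have near: "\<bar>cx z - of_int \<sigma>\<bar> \<le> 1 / 2" using x \<sigma> unfolding abs_le_iff by auto
    obtain k :: int where "\<bar>cx z - of_int k\<bar> + \<bar>cy z\<bar> \<le> 3" using z by (auto simp: cell_def hex_row_def)
    then show ?thesis using near abs_int_diff_ge_half[OF near, of k] by simp
  qed
  with x y show "\<bar>cy z\<bar> \<le> 5 * of_int \<sigma> * cx z \<and> \<bar>cx z - of_int \<sigma>\<bar> + \<bar>cy z\<bar> \<le> 3 \<and>
    of_int \<sigma> * cx z \<le> 3 / 2" by simp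
next
  assume z: "\<bar>cy z\<bar> \<le> 5 * of_int \<sigma> * cx z \<and> \<bar>cx z - of_int \<sigma>\<bar> + \<bar>cy z\<bar> \<le> 3 \<and>
    of_int \<sigma> * cx z \<le> 3 / 2"
  define x where "x = of_int \<sigma> * cx z"
  have cx: "cx z = of_int \<sigma> * x" "\<bar>cx z\<bar> = x" and x: "0 \<le> x" "x \<le> 3 / 2" and y: "\<bar>cy z\<bar> \<le> 5 * x"
    using \<sigma> z by (auto simp: x_def)
  have val_\<sigma>: "val (unit_form \<sigma>) z = 2 * x" using \<sigma> by (auto simp: x_def)
  have unit: "val (unit_form k) z \<le> 2 * x" if "k \<noteq> 0" for k
  proof -
    define m where "m = \<sigma> * k"
    have "m \<noteq> 0" using that \<sigma> by (auto simp: m_def)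
    have m: "val (unit_form k) z = 2 * of_int m * x + 1 - (of_int m)\<^sup>2"
      using \<sigma> by (auto simp: m_def x_def)
    \<comment> \<open>This product is the difference of the two values. For \<open>m \<ge> 1\<close>
      it vanishes or has nonnegative factors since \<open>x \<le> 3 / 2\<close>; for
      \<open>m \<le> -1\<close> both factors are nonpositive.\<close>
    have "0 \<le> of_int (m - 1) * (of_int (m + 1) - 2 * x)"
    proof (cases "m \<ge> 1")
      case True
      then consider "m = 1" | "of_int m \<ge> (2 :: real)" by linarith
      then show ?thesis using x by cases auto
    next
      case False
      then have "of_int m \<le> (-1 :: real)" using \<open>m \<noteq> 0\<close> by linarith
      then show ?thesis using x by (intro mult_nonpos_nonpos) auto
    qed
    then show ?thesis unfolding m by (simp add: power2_eq_square algebra_simps)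
  qed
  have "val l' z \<le> val (unit_form \<sigma>) z" if "l' \<in> forms" for l'
    using that
  proof (cases l' rule: forms_cases)
    case (small \<sigma>' \<tau>)
    then have "\<sigma>' * cx z + \<tau> * cy z \<le> x + \<bar>cy z\<bar>" unfolding cx(2)[symmetric] by auto
    then show ?thesis using y unfolding val_\<sigma> by (simp add: small)
  next
    case (outer k)
    then have "k \<noteq> 0" by auto
    then show ?thesis unfolding outer val_\<sigma> by (rule unit)
  next
    case (inner k)
    then have "k \<noteq> 0" by auto
    then show ?thesis unfolding inner val_\<sigma> by (rule unit)
  qed
  moreover have "z \<in> hex_row" unfolding hex_row_def mem_Collect_eq
    using z x \<sigma> cx by (intro conjI bexI[of _ \<sigma>]) auto
  ultimately show "z \<in> cell (unit_form \<sigma>)" by (simp add: cell_def)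
qed

text \<open>A triangle with corners at 0, \<open>(0, 3 * \<tau>)\<close> and
  \<open>(\<sigma> / 2, 5 * \<tau> / 2)\<close>. Its sides come from the mirror image small sphere,
  the unit sphere at \<open>\<sigma>\<close>, and the border of the row.\<close>

lemma cell_small:
  fixes \<sigma> \<tau> :: real
  assumes \<sigma>: "\<sigma> = 1 \<or> \<sigma> = - 1" and \<tau>: "\<tau> = 1 \<or> \<tau> = - 1"
  shows "z \<in> cell (small_form \<sigma> \<tau>) \<longleftrightarrow>
    0 \<le> \<sigma> * cx z \<and> 5 * \<sigma> * cx z \<le> \<tau> * cy z \<and> \<sigma> * cx z + \<tau> * cy z \<le> 3"
proof
  assume z: "z \<in> cell (small_form \<sigma> \<tau>)"
  have v: "val l z \<le> (\<sigma> * cx z + \<tau> * cy z) / 3" if "l \<in> forms" for l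
    using z that unfolding cell_def by auto
  have "val (small_form (- \<sigma>) \<tau>) z \<le> (\<sigma> * cx z + \<tau> * cy z) / 3"
    using \<sigma> \<tau> by (intro v small_in_forms) auto
  then have x: "0 \<le> \<sigma> * cx z" by simp
  obtain s :: int where s: "\<sigma> = of_int s" "s = 1 \<or> s = - 1" using \<sigma> by (metis of_int_1 of_int_minus)
  have "val (unit_form s) z \<le> (\<sigma> * cx z + \<tau> * cy z) / 3"
    using s by (intro v unit_in_forms) auto
  then have y: "5 * \<sigma> * cx z \<le> \<tau> * cy z" using s by auto
  obtain k :: int where k: "\<bar>cx z - of_int k\<bar> + \<bar>cy z\<bar> \<le> 3" using z by (auto simp: cell_def hex_row_def)
  have "\<sigma> * cx z + \<tau> * cy z \<le> 3"
  proof (cases "\<sigma> * cx z \<le> 1 / 2")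
    case True
    then have "\<bar>cx z - of_int 0\<bar> \<le> 1 / 2" using x \<sigma> by auto
    from abs_int_diff_ge_half[OF this, of k] show ?thesis using k \<sigma> \<tau> by auto
  next
    case False
    \<comment> \<open>This case is contradictory: the point would lie so close to \<open>s\<close>
      that the bound of the hexagon around \<open>s\<close>, together with the slope 5, forces
      \<open>\<sigma> * cx z \<le> 1 / 2\<close>.\<close>
    have "\<bar>cy z\<bar> = \<tau> * cy z" using x y \<tau> \<sigma> by auto
    then have "\<sigma> * cx z \<le> 3 / 5" using k y by linarith
    then have "\<bar>cx z - of_int s\<bar> \<le> 1 / 2" using False s by auto
    from abs_int_diff_ge_half[OF this, of k] show ?thesis using k s y \<tau> False by auto
  qed
  with x y show "0 \<le> \<sigma> * cx z \<and> 5 * \<sigma> * cx z \<le> \<tau> * cy z \<and> \<sigma> * cx z + \<tau> * cy z \<le> 3" by simp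
next
  assume z: "0 \<le> \<sigma> * cx z \<and> 5 * \<sigma> * cx z \<le> \<tau> * cy z \<and> \<sigma> * cx z + \<tau> * cy z \<le> 3"
  define x where "x = \<bar>cx z\<bar>"
  define y where "y = \<bar>cy z\<bar>"
  have xy: "\<sigma> * cx z = x" "\<tau> * cy z = y" "5 * x \<le> y" "x + y \<le> 3" "0 \<le> x"
    using z \<sigma> \<tau> by (auto simp: x_def y_def)
  have unit: "val (unit_form k) z \<le> (x + y) / 3" if "k \<noteq> 0" for k
  proof -
    obtain m :: int where m: "real_of_int k * cx z = of_int m * x" "m = k \<or> m = - k"
      unfolding x_def by (cases "cx z \<ge> 0") (use that[of k] that[of "- k"] in \<open>auto simp: x_def\<close>)
    have "(of_int m - 1) * (2 * x) \<le> (of_int m - 1) * (of_int m + 1)"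
    proof (cases "m \<ge> 1")
      case True
      then have "real_of_int m \<ge> 1" by simp
      then show ?thesis using xy by (intro mult_left_mono) auto
    next
      case False
      then have "real_of_int m \<le> - 1" using m that by auto
      then show ?thesis using xy by (intro mult_left_mono_neg) auto
    qed
    moreover have "val (unit_form k) z = 2 * of_int m * x + 1 - (of_int m)\<^sup>2"
      using m by (auto simp: mult.assoc)
    ultimately have "val (unit_form k) z \<le> 2 * x" by (simp add: power2_eq_square algebra_simps)
    then show ?thesis using xy by simp
  qed
  have val_\<sigma>\<tau>: "val (small_form \<sigma> \<tau>) z = (x + y) / 3" by (simp add: xy)
  have "val l' z \<le> val (small_form \<sigma> \<tau>) z" if "l' \<in> forms" for l'
    using that
  proof (cases l' rule: forms_cases)
    case (small \<sigma>' \<tau>')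
    then have "\<sigma>' * cx z + \<tau>' * cy z \<le> x + y" by (auto simp: x_def y_def)
    then show ?thesis using xy by (simp add: small)
  next
    case (outer k)
    then have "k \<noteq> 0" by auto
    then show ?thesis unfolding outer val_\<sigma>\<tau> by (rule unit)
  next
    case (inner k)
    then have "k \<noteq> 0" by auto
    then show ?thesis unfolding inner val_\<sigma>\<tau> by (rule unit)
  qed
  moreover have "z \<in> hex_row" unfolding hex_row_def mem_Collect_eq
    using xy by (intro conjI bexI[of _ 0]) (auto simp: x_def y_def)
  ultimately show "z \<in> cell (small_form \<sigma> \<tau>)" by (simp add: cell_def)
qed

text \<open>The spheres meeting at the cusp 0 all have height 0 there, so positivity has to be
  checked separately on the triangles around it; on the other hexagons it is uniform. As a
  consequence 0 is the only finite ideal point of the domain.\<close>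

lemma floor_height_pos:
  assumes "z \<in> hex_row" "z \<noteq> 0"
  shows "0 < floor_height z"
proof -
  obtain l where l: "l \<in> forms" "z \<in> cell l" using row_cover[OF assms(1)] .
  have hex: "0 < val (unit_form j) z - sqn z" if "z \<in> hexagon j" for j
  proof -
    define u where "u = \<bar>cx z - of_int j\<bar>"
    have u: "0 \<le> u" "u \<le> 1 / 2" "\<bar>cy z\<bar> \<le> 3 - u" using that by (auto simp: hexagon_def u_def)
    have "(cy z)\<^sup>2 \<le> (3 - u)\<^sup>2" using u abs_le_square_iff[of "cy z" "3 - u"] by simp
    \<comment> \<open>With \<open>\<bar>cy z\<bar> \<le> 3 - u\<close>, eleven times the value is at
      least \<open>2 - 6 * u * (2 * u - 1)\<close>.\<close>
    moreover have "u * (2 * u - 1) \<le> 0" using u by (intro mult_nonneg_nonpos) auto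
    moreover have "val (unit_form j) z - sqn z = 1 - u\<^sup>2 - (cy z)\<^sup>2 / 11"
      unfolding u_def by (simp add: sqn_def power2_eq_square algebra_simps)
    ultimately show ?thesis by (simp add: power2_eq_square algebra_simps)
  qed
  have "0 < val l z - sqn z"
    using l(1)
  proof (cases l rule: forms_cases)
    case (outer j)
    then show ?thesis using hex l(2) cell_outer by blast
  next
    case (inner \<sigma>)
    define x where "x = of_int \<sigma> * cx z"
    have z: "\<bar>cy z\<bar> \<le> 5 * x" "\<bar>cx z - of_int \<sigma>\<bar> + \<bar>cy z\<bar> \<le> 3" "x \<le> 3 / 2"
      using l(2) cell_inner inner by (auto simp: x_def)
    show ?thesis
    proof (cases "x \<le> 1 / 2")
      case True
      have "x \<noteq> 0"
      proof
        assume "x = 0"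
        then have "z = 0" using z(1) inner by (intro cxy_eqI) (auto simp: x_def)
        with assms show False by simp
      qed
      then have "x > 0" using z by linarith
      have "(cy z)\<^sup>2 \<le> (5 * x)\<^sup>2" using z(1) abs_le_square_iff[of "cy z" "5 * x"] by simp
      \<comment> \<open>Inserting \<open>\<bar>cy z\<bar> \<le> 5 * x\<close> gives the coefficient
        \<open>1 + 25 / 11 = 36 / 11\<close>.\<close>
      moreover have "0 < x * (2 - 36 / 11 * x)" using True \<open>x > 0\<close> by (intro mult_pos_pos) auto
      moreover have "val l z - sqn z = 2 * x - x\<^sup>2 - (cy z)\<^sup>2 / 11"
        using inner by (auto simp: x_def sqn_def)
      ultimately show ?thesis by (simp add: power2_eq_square algebra_simps)
    next
      case False
      then have "\<bar>cx z - of_int \<sigma>\<bar> \<le> 1 / 2"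
        using inner(1) z(3) unfolding x_def abs_le_iff by auto
      then have "z \<in> hexagon \<sigma>" using z by (simp add: hexagon_def)
      then show ?thesis using hex inner by blast
    qed
  next
    case (small \<sigma> \<tau>)
    define x where "x = \<sigma> * cx z"
    define y where "y = \<tau> * cy z"
    have z: "0 \<le> x" "5 * x \<le> y" "x + y \<le> 3"
      using l(2) cell_small small by (auto simp: x_def y_def)
    have sq: "(cx z)\<^sup>2 = x\<^sup>2" "(cy z)\<^sup>2 = y\<^sup>2" using small by (auto simp: x_def y_def)
    have "x + y > 0"
    proof (rule ccontr)
      assume "\<not> x + y > 0"
      then have "x = 0" "y = 0" using z by linarith+
      then have "z = 0" using small by (intro cxy_eqI) (auto simp: x_def y_def)
      with assms show False by simp
    qed
    have "x * (5 * x) \<le> x * y" using z by (intro mult_left_mono) auto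
    then have "11 * (x\<^sup>2 + y\<^sup>2 / 11) \<le> (x + y) * (x + y)" by (simp add: power2_eq_square algebra_simps)
    also have "\<dots> \<le> 3 * (x + y)" using z \<open>x + y > 0\<close> by (intro mult_right_mono) auto
    also have "\<dots> < 11 * ((x + y) / 3)" using \<open>x + y > 0\<close> by simp
    finally show ?thesis using small by (simp add: sqn_def sq x_def y_def)
  qed
  then show ?thesis using floor_height_cell[OF l] by simp
qed

lemma continuous_floor_height: "continuous_on UNIV floor_height"
proof -
  have "continuous_on UNIV (\<lambda>z. Max ((\<lambda>l. val l z) ` S))" if "finite S" "S \<noteq> {}" for S
    using that
  proof (induction S rule: finite_ne_induct)
    case (singleton l)
    show ?case by (cases l) (simp, intro continuous_intros)
  next
    case (insert l S)
    have "continuous_on UNIV (val l)" by (cases l) (simp, intro continuous_intros)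
    then have "continuous_on UNIV (\<lambda>z. max (val l z) (Max ((\<lambda>l. val l z) ` S)))"
      using insert by (intro continuous_on_max) auto
    then show ?case using insert by simp
  qed
  then have "continuous_on UNIV (\<lambda>z. Max ((\<lambda>l. val l z) ` forms))"
    using finite_forms forms_nonempty by blast
  then show ?thesis
    unfolding floor_height_def sqn_def by (intro continuous_intros) auto
qed

subsection \<open>Every other isometric sphere lies below the floor\<close>

text \<open>The hypotheses are the six vertex values, so by symmetry all quantities may be replaced
  by their absolute values. The border point \<open>(\<bar>u\<bar>, 3 - \<bar>u\<bar>)\<close> is
  then the convex combination of \<open>(1 / 2, 5 / 2)\<close> and \<open>(0, 3)\<close> with
  weights \<open>2 * \<bar>u\<bar>\<close> and \<open>1 - 2 * \<bar>u\<bar>\<close>.\<close>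

lemma affine_nonpos_hexagon:
  fixes \<alpha> \<beta> \<gamma> u y :: real
  assumes "3 * \<beta> + \<gamma> \<le> 0" "- 3 * \<beta> + \<gamma> \<le> 0"
    and "\<alpha> / 2 + 5 * \<beta> / 2 + \<gamma> \<le> 0" "- \<alpha> / 2 + 5 * \<beta> / 2 + \<gamma> \<le> 0"
    and "\<alpha> / 2 - 5 * \<beta> / 2 + \<gamma> \<le> 0" "- \<alpha> / 2 - 5 * \<beta> / 2 + \<gamma> \<le> 0"
    and u: "\<bar>u\<bar> \<le> 1 / 2" "\<bar>u\<bar> + \<bar>y\<bar> \<le> 3"
  shows "\<alpha> * u + \<beta> * y + \<gamma> \<le> 0"
proof -
  have "\<alpha> * u \<le> \<bar>\<alpha>\<bar> * \<bar>u\<bar>" "\<beta> * y \<le> \<bar>\<beta>\<bar> * \<bar>y\<bar>" by (metis abs_ge_self abs_mult)+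
  moreover have "\<bar>\<beta>\<bar> * \<bar>y\<bar> \<le> \<bar>\<beta>\<bar> * (3 - \<bar>u\<bar>)" using u by (intro mult_left_mono) auto
  moreover have "2 * \<bar>u\<bar> * (\<bar>\<alpha>\<bar> / 2 + 5 * \<bar>\<beta>\<bar> / 2 + \<gamma>) \<le> 0"
    by (rule mult_nonneg_nonpos) (use assms in auto)
  moreover have "(1 - 2 * \<bar>u\<bar>) * (3 * \<bar>\<beta>\<bar> + \<gamma>) \<le> 0"
    by (rule mult_nonneg_nonpos) (use assms in auto)
  ultimately show ?thesis by (simp add: algebra_simps)
qed

text \<open>Each proof adds the three corner values multiplied by the barycentric coordinates of the
  point. The triangles have a corner at 0 and are those under a small sphere and under an inner unit
  sphere, reflected to positive signs.\<close>

lemma affine_nonpos_triangles: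
  fixes \<alpha> \<beta> \<gamma> x y :: real
  assumes "\<gamma> \<le> 0" "\<alpha> / 2 + 5 * \<beta> / 2 + \<gamma> \<le> 0"
  shows "3 * \<beta> + \<gamma> \<le> 0 \<Longrightarrow> 0 \<le> x \<Longrightarrow> 5 * x \<le> y \<Longrightarrow> x + y \<le> 3 \<Longrightarrow> \<alpha> * x + \<beta> * y + \<gamma> \<le> 0"
    and "\<alpha> / 2 - 5 * \<beta> / 2 + \<gamma> \<le> 0 \<Longrightarrow> \<bar>y\<bar> \<le> 5 * x \<Longrightarrow> x \<le> 1 / 2 \<Longrightarrow> \<alpha> * x + \<beta> * y + \<gamma> \<le> 0"
proof -
  assume *: "3 * \<beta> + \<gamma> \<le> 0" "0 \<le> x" "5 * x \<le> y" "x + y \<le> 3"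
  have "2 * x * (\<alpha> / 2 + 5 * \<beta> / 2 + \<gamma>) \<le> 0" by (rule mult_nonneg_nonpos) (use assms * in auto)
  moreover have "(y - 5 * x) / 3 * (3 * \<beta> + \<gamma>) \<le> 0" by (rule mult_nonneg_nonpos) (use assms * in auto)
  moreover have "(1 - (x + y) / 3) * \<gamma> \<le> 0" by (rule mult_nonneg_nonpos) (use assms * in auto)
  ultimately show "\<alpha> * x + \<beta> * y + \<gamma> \<le> 0" by (simp add: field_simps)
next
  assume *: "\<alpha> / 2 - 5 * \<beta> / 2 + \<gamma> \<le> 0" "\<bar>y\<bar> \<le> 5 * x" "x \<le> 1 / 2"
  have "(x + y / 5) * (\<alpha> / 2 + 5 * \<beta> / 2 + \<gamma>) \<le> 0" by (rule mult_nonneg_nonpos) (use assms * in auto)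
  moreover have "(x - y / 5) * (\<alpha> / 2 - 5 * \<beta> / 2 + \<gamma>) \<le> 0" by (rule mult_nonneg_nonpos) (use assms * in auto)
  moreover have "(1 - 2 * x) * \<gamma> \<le> 0" by (rule mult_nonneg_nonpos) (use assms * in auto)
  ultimately show "\<alpha> * x + \<beta> * y + \<gamma> \<le> 0" by (simp add: field_simps)
qed

text \<open>The sphere of \<open>A\<close> has squared radius \<open>1 / N\<close> after scaling, so
  its affine function is compared with \<open>N\<close> times the largest listed form. The
  comparison at the cusp is \<open>\<gamma> \<le> 0\<close>; at the hexagon vertices it is
  \<open>vertex_height\<close>.\<close>

lemma exterior_dominated:
  assumes A: "A \<in> Gamma0" "A$2$1 \<noteq> 0" and z: "z \<in> hex_row" and t: "floor_height z \<le> t\<^sup>2"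
  shows "1 \<le> (cmod (A$2$1 * z + A$2$2))\<^sup>2 + (cmod (A$2$1))\<^sup>2 * t\<^sup>2"
proof -
  define d where "d = A$2$2"
  obtain x where x: "x \<in> O11" "A$2$1 = \<theta> * x" using A by (auto simp: Gamma0_iff)
  have O: "A$1$2 \<in> O11" "d \<in> O11" and det: "A$1$1 * d - A$1$2 * A$2$1 = 1"
    using A by (auto simp: Gamma0_iff d_def)
  have "x \<noteq> 0" using A(2) x(2) by auto
  \<comment> \<open>Otherwise the determinant would be minus a product of \<theta> with two nonzero
    elements of \<open>O11\<close>, whose norm is at least 11.\<close>
  have "d \<noteq> 0"
  proof
    assume "d = 0"
    then have 1: "A$1$2 * \<theta> * x = - 1" using det x(2) by (simp add: algebra_simps minus_equation_iff)
    have "1 \<le> (cmod (A$1$2))\<^sup>2" "1 \<le> (cmod x)\<^sup>2"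
      using O(1) x(1) 1 by (auto intro!: O11_norm_ge_1)
    then have "1 * 11 * 1 \<le> (cmod (A$1$2))\<^sup>2 * 11 * (cmod x)\<^sup>2" by (intro mult_mono) auto
    also have "\<dots> = (cmod (A$1$2 * \<theta> * x))\<^sup>2" by (simp add: norm_mult power_mult_distrib cmod_theta)
    finally show False unfolding 1 by simp
  qed
  define N where "N = (cmod x)\<^sup>2"
  have "N \<ge> 0" by (simp add: N_def)
  define q where "q = x * cnj d"
  define \<alpha> where "\<alpha> = - 2 * Re q"
  define \<beta> where "\<beta> = 2 * Im q / sqrt 11"
  define \<gamma> where "\<gamma> = 1 - (cmod d)\<^sup>2"
  \<comment> \<open>The quadratic part of the squared modulus is exactly \<open>N * sqn w\<close>;
    what remains is affine in the coordinates.\<close>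
  have g: "1 - (cmod (A$2$1 * w + d))\<^sup>2 + N * sqn w = \<alpha> * cx w + \<beta> * cy w + \<gamma>" for w
  proof -
    have add: "(cmod (a + b))\<^sup>2 = (cmod a)\<^sup>2 + (cmod b)\<^sup>2 + 2 * Re (a * cnj b)" for a b
      unfolding cmod_power2 by (simp add: power2_eq_square algebra_simps)
    have "(cmod (A$2$1 * w))\<^sup>2 = N * sqn w"
      by (simp add: x N_def sqn_eq norm_mult power_mult_distrib cmod_theta)
    moreover have "A$2$1 * w * cnj d = q * (\<theta> * w)" by (simp add: x q_def)
    then have "Re (A$2$1 * w * cnj d) = Re q * cx w - Im q * (cy w / sqrt 11)"
      by (simp only: times_complex.sel(1)[of q] theta_times)
    then have "2 * Re (A$2$1 * w * cnj d) = - \<alpha> * cx w - \<beta> * cy w"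
      unfolding \<alpha>_def \<beta>_def by simp
    ultimately show ?thesis unfolding add \<gamma>_def by simp
  qed
  have zero: "\<gamma> \<le> 0" using O11_norm_ge_1[OF O(2) \<open>d \<noteq> 0\<close>] by (simp add: \<gamma>_def)
  have vertex: "\<alpha> * cx v + \<beta> * cy v + \<gamma> \<le> N * (2 / 11 + sqn v)"
    if "\<theta> * v = y + of_real s * z1" "y \<in> O11" "s = 1 \<or> s = - 1" for v y s
  proof -
    have "A$2$1 * v + d = x * (\<theta> * v) + d" by (simp add: x(2))
    then have eq: "A$2$1 * v + d = (x * y + d) + of_real s * x * z1"
      unfolding that(1) by (simp add: algebra_simps)
    have "1 \<le> (cmod (A$2$1 * v + d))\<^sup>2 + 2 / 11 * N"
      unfolding eq N_def by (rule vertex_height) (use x(1) O(2) \<open>x \<noteq> 0\<close> that in auto)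
    then show ?thesis unfolding g[symmetric] by (simp add: algebra_simps)
  qed
  have top: "\<alpha> * of_int j + \<beta> * (3 * \<tau>) + \<gamma> \<le> N * (1 + (of_int j)\<^sup>2)"
    if "\<tau> = 1 \<or> \<tau> = - 1" for j :: int and \<tau> :: real
  proof -
    have "\<theta> * point (of_int j) (3 * \<tau>) = of_int j + of_real \<tau> * z1"
      unfolding complex_eq_iff theta_times by simp
    from vertex[OF this] that show ?thesis by (auto simp: sqn_def)
  qed
  have corner: "\<alpha> * (of_int j + of_int \<sigma> / 2) + \<beta> * (5 * of_int \<tau> / 2) + \<gamma>
      \<le> N * (1 + of_int j * of_int \<sigma> + (of_int j)\<^sup>2)"
    if "\<sigma> = 1 \<or> \<sigma> = - 1" "\<tau> = 1 \<or> \<tau> = - 1" for j \<sigma> \<tau> :: int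
  proof -
    \<comment> \<open>The corner is \<open>- \<tau> * z1\<close> away from a lattice point on the
      adjacent lattice line, because \<open>11 / 2 - 3 = 5 / 2\<close>.\<close>
    have "\<theta> * point (of_int j + of_int \<sigma> / 2) (5 * of_int \<tau> / 2) =
        (of_int (j + (\<sigma> + \<tau>) div 2) + of_int \<tau> * \<omega>) + of_real (- of_int \<tau>) * z1"
      unfolding complex_eq_iff theta_times using that by (auto simp: divide_simps)
    then have "\<alpha> * cx (point (of_int j + of_int \<sigma> / 2) (5 * of_int \<tau> / 2)) +
        \<beta> * cy (point (of_int j + of_int \<sigma> / 2) (5 * of_int \<tau> / 2)) + \<gamma>
      \<le> N * (2 / 11 + sqn (point (of_int j + of_int \<sigma> / 2) (5 * of_int \<tau> / 2)))"
      by (rule vertex) (use that in \<open>auto intro: O11I\<close>)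
    also have "2 / 11 + sqn (point (of_int j + of_int \<sigma> / 2) (5 * of_int \<tau> / 2)) =
        1 + of_int j * of_int \<sigma> + (of_int j)\<^sup>2"
      using that by (auto simp: sqn_def power2_eq_square algebra_simps)
    finally show ?thesis by simp
  qed
  obtain l where l: "l \<in> forms" "z \<in> cell l" using row_cover[OF z] .
  have hex: "\<alpha> * cx z + \<beta> * cy z + \<gamma> \<le> N * val (unit_form j) z" if "z \<in> hexagon j" for j
  proof -
    \<comment> \<open>Coefficients of the difference with the unit form at \<open>j\<close>,
      recentered at \<open>j\<close>.\<close>
    define \<alpha>' where "\<alpha>' = \<alpha> - N * (2 * of_int j)"
    define \<gamma>' where "\<gamma>' = \<gamma> + \<alpha> * of_int j - N * (1 + (of_int j)\<^sup>2)"
    have "\<alpha>' * (cx z - of_int j) + \<beta> * cy z + \<gamma>' \<le> 0"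
    proof (rule affine_nonpos_hexagon)
      show "3 * \<beta> + \<gamma>' \<le> 0" "- 3 * \<beta> + \<gamma>' \<le> 0"
        using top[of 1 j] top[of "- 1" j] by (simp_all add: \<gamma>'_def)
      show "\<alpha>' / 2 + 5 * \<beta> / 2 + \<gamma>' \<le> 0" "- \<alpha>' / 2 + 5 * \<beta> / 2 + \<gamma>' \<le> 0"
        "\<alpha>' / 2 - 5 * \<beta> / 2 + \<gamma>' \<le> 0" "- \<alpha>' / 2 - 5 * \<beta> / 2 + \<gamma>' \<le> 0"
        using corner[of 1 1 j] corner[of "- 1" 1 j] corner[of 1 "- 1" j] corner[of "- 1" "- 1" j]
        by (simp_all add: \<alpha>'_def \<gamma>'_def field_simps)
    qed (use that in \<open>auto simp: hexagon_def\<close>)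
    then show ?thesis by (simp add: \<alpha>'_def \<gamma>'_def power2_eq_square algebra_simps)
  qed
  have "\<alpha> * cx z + \<beta> * cy z + \<gamma> \<le> N * val l z"
    using l(1)
  proof (cases l rule: forms_cases)
    case (outer j)
    then show ?thesis using hex l(2) cell_outer by blast
  next
    case (inner \<sigma>)
    define x where "x = of_int \<sigma> * cx z"
    have *: "\<bar>cy z\<bar> \<le> 5 * x" "\<bar>cx z - of_int \<sigma>\<bar> + \<bar>cy z\<bar> \<le> 3" "x \<le> 3 / 2"
      using l(2) cell_inner inner by (auto simp: x_def)
    show ?thesis
    proof (cases "x \<le> 1 / 2")
      case True
      have "(\<alpha> * of_int \<sigma> - N * 2) * x + \<beta> * cy z + \<gamma> \<le> 0"
      proof (rule affine_nonpos_triangles(2))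
        show "(\<alpha> * of_int \<sigma> - N * 2) / 2 + 5 * \<beta> / 2 + \<gamma> \<le> 0"
          "(\<alpha> * of_int \<sigma> - N * 2) / 2 - 5 * \<beta> / 2 + \<gamma> \<le> 0"
          using corner[of \<sigma> 1 0] corner[of \<sigma> "- 1" 0] inner(1) by (simp_all add: field_simps)
      qed (use * True zero in auto)
      then show ?thesis using inner by (auto simp: x_def algebra_simps)
    next
      case False
      then have "\<bar>cx z - of_int \<sigma>\<bar> \<le> 1 / 2"
        using inner(1) *(3) unfolding x_def abs_le_iff by auto
      then have "z \<in> hexagon \<sigma>" using * by (simp add: hexagon_def)
      then show ?thesis using hex inner by blast
    qed
  next
    case (small \<sigma> \<tau>)
    obtain s :: int where s: "\<sigma> = of_int s" "s = 1 \<or> s = - 1" using small by (metis of_int_1 of_int_minus)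
    obtain r :: int where r: "\<tau> = of_int r" "r = 1 \<or> r = - 1" using small by (metis of_int_1 of_int_minus)
    have "(\<alpha> * \<sigma> - N / 3) * (\<sigma> * cx z) + (\<beta> * \<tau> - N / 3) * (\<tau> * cy z) + \<gamma> \<le> 0"
    proof (rule affine_nonpos_triangles(1))
      show "(\<alpha> * \<sigma> - N / 3) / 2 + 5 * (\<beta> * \<tau> - N / 3) / 2 + \<gamma> \<le> 0"
        using corner[OF s(2) r(2), of 0] unfolding s(1) r(1) by (simp add: field_simps)
      show "3 * (\<beta> * \<tau> - N / 3) + \<gamma> \<le> 0"
        using top[OF small(2), of 0] by (simp add: field_simps)
    qed (use l(2) cell_small small zero in auto)
    then show ?thesis using small by (auto simp: algebra_simps add_divide_distrib)
  qed
  also have "val l z \<le> 11 * t\<^sup>2 + sqn z"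
    using floor_height_cell[OF l] t by simp
  then have "N * val l z \<le> N * (11 * t\<^sup>2 + sqn z)" using \<open>N \<ge> 0\<close> by (rule mult_left_mono)
  finally have "1 - (cmod (A$2$1 * z + d))\<^sup>2 \<le> N * 11 * t\<^sup>2"
    unfolding g[symmetric] by (simp add: algebra_simps)
  moreover have "(cmod (A$2$1))\<^sup>2 = N * 11"
    by (simp add: x N_def norm_mult power_mult_distrib cmod_theta)
  ultimately show ?thesis by (simp add: d_def)
qed

text \<open>Every listed sphere is isometric, so the exterior lies above the floor; every other
  isometric sphere is dominated, so nothing more is removed over the row.\<close>

lemma ford_domain_eq:
  "ford_exterior PGamma0 \<inter> above_graph hex_row (\<lambda>_. 0) = above_graph hex_row floor_height"
proof (rule Set.set_eqI)
  fix p :: "complex \<times> real"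
  obtain z t where p: "p = (z, t)" by (cases p)
  have "floor_height z \<le> t\<^sup>2"
    if ext: "\<forall>A\<in>Gamma0. A$2$1 \<noteq> 0 \<longrightarrow> 1 \<le> (cmod (A$2$1 * z + A$2$2))\<^sup>2 + (cmod (A$2$1))\<^sup>2 * t\<^sup>2"
    unfolding floor_height_le_iff
  proof
    fix l assume "l \<in> forms"
    from forms_isometric[OF this] show "val l z - sqn z \<le> 11 * t\<^sup>2" using ext by metis
  qed
  then show "p \<in> ford_exterior PGamma0 \<inter> above_graph hex_row (\<lambda>_. 0) \<longleftrightarrow>
      p \<in> above_graph hex_row floor_height"
    using exterior_dominated by (auto simp: p mem_ford_exterior above_graph_def)
qed

section \<open>Faces\<close>

definition normal :: "real \<Rightarrow> real \<Rightarrow> complex" where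
  "normal a b = Complex (11 * b) (- sqrt 11 * a)"

lemma inner_normal: "inner (normal a b) z = a * cx z + b * cy z"
  by (simp add: normal_def inner_complex_def cx_def cy_def)

lemma convex_halfplane: "convex {z. a * cx z + b * cy z \<le> c}"
  using convex_halfspace_le[of "normal a b" c] by (simp add: inner_normal)

lemma cell_regular:
  assumes "l \<in> forms"
  shows "closed (cell l)" "cell l \<subseteq> closure (interior (cell l))"
proof -
  have "continuous_on UNIV (val l')" for l' by (cases l') (simp, intro continuous_intros)
  then have "closed (\<Inter>l'\<in>forms. {z. val l' z \<le> val l z})"
    by (intro closed_INT ballI closed_Collect_le) auto
  moreover have "cell l = hex_row \<inter> (\<Inter>l'\<in>forms. {z. val l' z \<le> val l z})" by (auto simp: cell_def)
  ultimately show "closed (cell l)" using closed_row by auto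
  show "cell l \<subseteq> closure (interior (cell l))"
    using assms
  proof (cases l rule: forms_cases)
    case (outer j)
    then have "cell l = hexagon j" using cell_outer by blast
    then show ?thesis using hexagon_subset_closure_interior by simp
  next
    case (inner \<sigma>)
    have cell: "cell l = {z. (- 5 * of_int \<sigma>) * cx z + 1 * cy z \<le> 0} \<inter> {z. (- 5 * of_int \<sigma>) * cx z + (-1) * cy z \<le> 0}
      \<inter> {z. \<bar>cx z - of_int \<sigma>\<bar> + \<bar>cy z\<bar> \<le> 3} \<inter> {z. of_int \<sigma> * cx z + 0 * cy z \<le> 3 / 2}"
      using cell_inner inner by auto
    have "convex (cell l)" unfolding cell by (intro convex_Int convex_halfplane convex_abs_le)
    moreover have "open {z. (- 5 * of_int \<sigma>) * cx z + cy z < 0 \<and> (- 5 * of_int \<sigma>) * cx z - cy z < 0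
      \<and> \<bar>cx z - of_int \<sigma>\<bar> + \<bar>cy z\<bar> < 3 \<and> of_int \<sigma> * cx z < 3 / 2}" (is "open ?U")
      by (intro open_Collect_conj open_Collect_less continuous_intros)
    moreover have "?U \<subseteq> cell l" unfolding cell by auto
    moreover have "point (of_int \<sigma>) 0 \<in> ?U" using inner by auto
    ultimately show ?thesis by (rule subset_closure_interior_convex)
  next
    case (small \<sigma> \<tau>)
    have cell: "cell l = {z. (- \<sigma>) * cx z + 0 * cy z \<le> 0} \<inter> {z. (5 * \<sigma>) * cx z + (- \<tau>) * cy z \<le> 0}
      \<inter> {z. \<sigma> * cx z + \<tau> * cy z \<le> 3}"
      using cell_small small by auto
    have "convex (cell l)" unfolding cell by (intro convex_Int convex_halfplane)
    moreover have "open {z. (- \<sigma>) * cx z < 0 \<and> (5 * \<sigma>) * cx z - \<tau> * cy z < 0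
      \<and> \<sigma> * cx z + \<tau> * cy z < 3}" (is "open ?U")
      by (intro open_Collect_conj open_Collect_less continuous_intros)
    moreover have "?U \<subseteq> cell l" unfolding cell by auto
    moreover have "point (\<sigma> / 5) (2 * \<tau>) \<in> ?U" using small by auto
    ultimately show ?thesis by (rule subset_closure_interior_convex)
  qed
qed

lemma cell_nontrivial:
  assumes "l \<in> forms"
  obtains z where "z \<in> cell l" "z \<noteq> 0"
  using assms
proof (cases l rule: forms_cases)
  case (outer j)
  then have "point (of_int j) 0 \<in> cell l" by (simp add: cell_outer hexagon_def)
  moreover have "cx (point (of_int j) 0) \<noteq> cx 0" using outer by auto
  ultimately show ?thesis using that by metis
next
  case (inner \<sigma>)
  then have "point (of_int \<sigma>) 0 \<in> cell l" by (auto simp: cell_inner)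
  moreover have "cx (point (of_int \<sigma>) 0) \<noteq> cx 0" using inner by auto
  ultimately show ?thesis using that by metis
next
  case (small \<sigma> \<tau>)
  then have "point 0 \<tau> \<in> cell l" by (auto simp: cell_small)
  moreover have "cy (point 0 \<tau>) \<noteq> cy 0" using small by auto
  ultimately show ?thesis using that by metis
qed

definition floor_piece :: "affine_form \<Rightarrow> (complex \<times> real) set" where
  "floor_piece l = {(z, t) \<in> dome l. z \<in> cell l}"

lemma mem_floor_piece:
  assumes "l \<in> forms"
  shows "(z, t) \<in> floor_piece l \<longleftrightarrow> z \<in> cell l \<and> t > 0 \<and> t\<^sup>2 = floor_height z"
  using floor_height_cell[OF assms, of z] by (auto simp: floor_piece_def dome_def)

lemma floor_piece_face:
  assumes "l \<in> forms"
  shows "dome l \<in> hyperbolic_planes" "regular_in (dome l) (floor_piece l)" "floor_piece l \<noteq> {}"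
    "bounded (dome l)"
proof -
  obtain A where A: "A$2$1 \<noteq> 0" "isometric_sphere A = dome l" using forms_isometric[OF assms] by metis
  then have dome: "dome l = hemisphere (- A$2$2 / A$2$1) (1 / cmod (A$2$1))"
    by (simp add: isometric_sphere_def)
  then show "dome l \<in> hyperbolic_planes"
    using A(1) unfolding hyperbolic_planes_def by (intro UnI1 CollectI exI conjI) auto
  show "regular_in (dome l) (floor_piece l)"
    unfolding floor_piece_def dome by (intro regular_in_hemisphere cell_regular assms)
  show "bounded (dome l)" unfolding dome by (rule bounded_hemisphere)
  obtain z where z: "z \<in> cell l" "z \<noteq> 0" using cell_nontrivial[OF assms] .
  then have "floor_height z > 0" by (intro floor_height_pos) (auto simp: cell_def)
  with z have "(z, sqrt (floor_height z)) \<in> floor_piece l" by (simp add: mem_floor_piece[OF assms])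
  then show "floor_piece l \<noteq> {}" by blast
qed

text \<open>No edge of the row has constant \<open>cy\<close>, so the coefficient of
  \<open>cx\<close> can be normalized to 1. Then \<open>b\<close> is 0 on the two ends and 1 or -1
  on the zigzag.\<close>

definition wall_plane :: "real \<Rightarrow> real \<Rightarrow> (complex \<times> real) set" where
  "wall_plane b k = {p \<in> H3. cx (fst p) + b * cy (fst p) = k}"

definition side_edge :: "real \<Rightarrow> complex set" where
  "side_edge \<sigma> = {z. cx z = 11 / 2 * \<sigma> \<and> \<bar>cy z\<bar> \<le> 5 / 2}"

text \<open>Half of the upper or lower roof of hexagon \<open>j\<close>: \<open>s\<close> selects
  the right or left half, and the sign of \<open>cy\<close> is
  \<open>\<epsilon> * s\<close>.\<close>

definition zigzag_edge :: "real \<Rightarrow> real \<Rightarrow> int \<Rightarrow> complex set" where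
  "zigzag_edge \<epsilon> s j =
    {z. cx z + \<epsilon> * cy z = of_int j + 3 * s \<and> 0 \<le> s * (cx z - of_int j) \<and> s * (cx z - of_int j) \<le> 1 / 2}"

text \<open>\<open>(b, k, E)\<close> is the edge \<open>E\<close> of the row, contained in the line \<open>cx z + b * cy z = k\<close>.\<close>

definition walls :: "(real \<times> real \<times> complex set) set" where
  "walls = (\<lambda>\<sigma>. (0, 11 / 2 * \<sigma>, side_edge \<sigma>)) ` {1, -1} \<union>
     (\<lambda>(\<epsilon>, s, j). (\<epsilon>, of_int j + 3 * s, zigzag_edge \<epsilon> s j)) ` ({1, -1} \<times> {1, -1} \<times> {-5..5})"

lemma finite_walls: "finite walls" by (simp add: walls_def)

lemma walls_cases:
  assumes "(b, k, E) \<in> walls"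
  obtains (side) \<sigma> where "\<sigma> = 1 \<or> \<sigma> = - 1" "b = 0" "k = 11 / 2 * \<sigma>" "E = side_edge \<sigma>"
    | (zigzag) s j where "b = 1 \<or> b = - 1" "s = 1 \<or> s = - 1" "j \<in> {-5..5}" "k = of_int j + 3 * s"
        "E = zigzag_edge b s j"
proof -
  from assms consider "(b, k, E) \<in> (\<lambda>\<sigma>. (0, 11 / 2 * \<sigma>, side_edge \<sigma>)) ` {1, -1}"
    | "(b, k, E) \<in> (\<lambda>(\<epsilon>, s, j). (\<epsilon>, of_int j + 3 * s, zigzag_edge \<epsilon> s j)) ` ({1, -1} \<times> {1, -1} \<times> {-5..5})"
    unfolding walls_def Un_iff by argo
  then show ?thesis
  proof cases
    case 1
    then obtain \<sigma> where "(b, k, E) = (0, 11 / 2 * \<sigma>, side_edge \<sigma>)" "\<sigma> \<in> {1, -1}" by (rule imageE)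
    then show ?thesis using side[of \<sigma>] by simp
  next
    case 2
    then obtain p where "(b, k, E) = (\<lambda>(\<epsilon>, s, j). (\<epsilon>, of_int j + 3 * s, zigzag_edge \<epsilon> s j)) p"
      "p \<in> {1, -1} \<times> {1, -1} \<times> {-5..5}" by (rule imageE)
    then show ?thesis using zigzag[of "fst (snd p)" "snd (snd p)"] by (auto simp: split_def)
  qed
qed

lemma side_in_walls: "\<sigma> = 1 \<or> \<sigma> = - 1 \<Longrightarrow> (0, 11 / 2 * \<sigma>, side_edge \<sigma>) \<in> walls"
  by (auto simp: walls_def)

lemma zigzag_in_walls:
  assumes "\<epsilon> = 1 \<or> \<epsilon> = - 1" "s = 1 \<or> s = - 1" "j \<in> {-5..5}"
  shows "(\<epsilon>, of_int j + 3 * s, zigzag_edge \<epsilon> s j) \<in> walls"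
proof -
  have "(\<epsilon>, s, j) \<in> {1, -1} \<times> {1, -1} \<times> {-5..5}" using assms by auto
  then show ?thesis unfolding walls_def by (intro UnI2) (auto intro: image_eqI[of _ _ "(\<epsilon>, s, j)"])
qed

lemma zigzag_edge_height:
  assumes "\<epsilon> = 1 \<or> \<epsilon> = - 1" "s = 1 \<or> s = - 1" "z \<in> zigzag_edge \<epsilon> s j"
  shows "\<bar>cx z - of_int j\<bar> = s * (cx z - of_int j)" "\<bar>cy z\<bar> = 3 - s * (cx z - of_int j)"
  using assms by (auto simp: zigzag_edge_def)

lemma frontier_row: "frontier hex_row = (\<Union>(b, k, E)\<in>walls. E)"
proof -
  have "frontier hex_row = hex_row - open_hex_row"
    using closed_row by (simp add: frontier_def interior_row)
  also have "\<dots> = (\<Union>(b, k, E)\<in>walls. E)"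
  proof (intro equalityI subsetI)
    fix z assume "z \<in> (\<Union>(b, k, E)\<in>walls. E)"
    then obtain b k E where w: "(b, k, E) \<in> walls" "z \<in> E" by auto
    from w(1) show "z \<in> hex_row - open_hex_row"
    proof (cases rule: walls_cases)
      case (side \<sigma>)
      have "\<exists>j\<in>{-5..5 :: int}. \<bar>cx z - of_int j\<bar> + \<bar>cy z\<bar> \<le> 3"
        using side w(2) by (auto simp: side_edge_def intro: bexI[of _ 5] bexI[of _ "- 5"])
      then show ?thesis using side w(2) by (auto simp: side_edge_def hex_row_def open_hex_row_def)
    next
      case (zigzag s j)
      have z: "z \<in> zigzag_edge b s j" using w zigzag by simp
      note h = zigzag_edge_height[OF zigzag(1,2) z]
      have near: "\<bar>cx z - of_int j\<bar> \<le> 1 / 2" using h z by (simp add: zigzag_edge_def)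
      have "z \<in> hexagon j" using near h by (simp add: hexagon_def)
      then have "z \<in> hex_row" using zigzag(3) by (auto simp: row_eq_hexagons)
      moreover have "3 \<le> \<bar>cx z - of_int i\<bar> + \<bar>cy z\<bar>" for i
        using abs_int_diff_ge_half[OF near, of i] h by linarith
      then have "z \<notin> open_hex_row" unfolding open_hex_row_def mem_Collect_eq by (meson not_less)
      ultimately show ?thesis by blast
    qed
  next
    fix z assume z: "z \<in> hex_row - open_hex_row"
    then obtain j where j: "j \<in> {-5..5}" "z \<in> hexagon j" by (auto simp: row_eq_hexagons)
    show "z \<in> (\<Union>(b, k, E)\<in>walls. E)"
    proof (cases "\<bar>cx z\<bar> = 11 / 2")
      case True
      have "\<bar>real_of_int j\<bar> \<le> 5" using j by auto
      then have "\<bar>cx z - of_int j\<bar> \<ge> 1 / 2" using True by linarith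
      then have "\<bar>cy z\<bar> \<le> 5 / 2" using j(2) unfolding hexagon_def by simp
      with True have "z \<in> side_edge (sgn (cx z))" by (auto simp: side_edge_def sgn_if)
      moreover have "sgn (cx z) = 1 \<or> sgn (cx z) = - 1" using True by (auto simp: sgn_if)
      ultimately show ?thesis using side_in_walls[of "sgn (cx z)"] by blast
    next
      case False
      then have "\<bar>cx z\<bar> < 11 / 2" using z by (auto simp: hex_row_def)
      then have "3 \<le> \<bar>cx z - of_int j\<bar> + \<bar>cy z\<bar>" using z j(1) unfolding open_hex_row_def by (auto simp: not_less)
      then have eq: "\<bar>cx z - of_int j\<bar> + \<bar>cy z\<bar> = 3" and near: "\<bar>cx z - of_int j\<bar> \<le> 1 / 2"
        using j(2) by (auto simp: hexagon_def)
      define s :: real where "s = (if cx z \<ge> of_int j then 1 else -1)"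
      define \<epsilon> :: real where "\<epsilon> = s * (if cy z \<ge> 0 then 1 else -1)"
      have "\<epsilon> = 1 \<or> \<epsilon> = - 1" "s = 1 \<or> s = - 1" by (simp_all add: \<epsilon>_def s_def)
      moreover have "z \<in> zigzag_edge \<epsilon> s j"
        using eq near by (auto simp: zigzag_edge_def \<epsilon>_def s_def)
      ultimately show ?thesis using zigzag_in_walls j(1) by blast
    qed
  qed
  finally show ?thesis .
qed

lemma closure_from_center:
  fixes z m :: complex
  assumes "\<And>r. 0 < r \<Longrightarrow> r < 1 \<Longrightarrow> z + r *\<^sub>R (m - z) \<in> C"
  shows "z \<in> closure C"
proof (rule Lim_in_closed_set[OF closed_closure])
  show "((\<lambda>r. z + r *\<^sub>R (m - z)) \<longlongrightarrow> z) (at_right (0 :: real))"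
    by (rule tendsto_eq_intros refl | simp)+
  have "\<forall>\<^sub>F r in at_right (0 :: real). r \<in> {0<..<1}" by (rule eventually_at_right_real) simp
  then show "\<forall>\<^sub>F r in at_right (0 :: real). z + r *\<^sub>R (m - z) \<in> closure C"
    by eventually_elim (use assms closure_subset in auto)
qed simp

text \<open>\<open>V\<close> cuts the open edge out of its line and \<open>m\<close> is its
  midpoint. Shrinking towards \<open>m\<close> carries the whole edge into the open part, which
  provides the density needed for regularity of the wall.\<close>

lemma wall_edge_nonempty:
  assumes "(b, k, E) \<in> walls"
  obtains V m where "open V" "{z. cx z + b * cy z = k} \<inter> V \<subseteq> E" "m \<in> E"
    "\<forall>z\<in>E. \<forall>r\<in>{0<..<1}. z + r *\<^sub>R (m - z) \<in> {z. cx z + b * cy z = k} \<inter> V"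
    "E \<subseteq> {z. cx z + b * cy z = k}" "closed E"
  using assms
proof (cases rule: walls_cases)
  case (side \<sigma>)
  have strict: "\<bar>y + r * (0 - y)\<bar> < 5 / 2" if "\<bar>y\<bar> \<le> 5 / 2" "0 < r" "r < 1" for y r :: real
  proof -
    have "y + r * (0 - y) = (1 - r) * y" by (simp add: algebra_simps)
    then have "\<bar>y + r * (0 - y)\<bar> = (1 - r) * \<bar>y\<bar>" using that by (simp add: abs_mult)
    also have "\<dots> \<le> (1 - r) * (5 / 2)" using that by (intro mult_left_mono) auto
    also have "\<dots> < 5 / 2" using that by simp
    finally show ?thesis .
  qed
  show ?thesis
  proof (rule that[of "{z. \<bar>cy z\<bar> < 5 / 2}" "point (11 / 2 * \<sigma>) 0"])
    show "open {z. \<bar>cy z\<bar> < 5 / 2}" by (intro open_Collect_less continuous_intros)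
    show "closed E" unfolding side side_edge_def
      by (intro closed_Collect_conj closed_Collect_le closed_Collect_eq continuous_intros)
    show "\<forall>z\<in>E. \<forall>r\<in>{0<..<1}. z + r *\<^sub>R (point (11 / 2 * \<sigma>) 0 - z) \<in>
        {z. cx z + b * cy z = k} \<inter> {z. \<bar>cy z\<bar> < 5 / 2}"
    proof (intro ballI)
      fix z and r :: real assume "z \<in> E" and r: "r \<in> {0<..<1}"
      then have z: "cx z = 11 / 2 * \<sigma>" "\<bar>cy z\<bar> \<le> 5 / 2" by (auto simp: side side_edge_def)
      show "z + r *\<^sub>R (point (11 / 2 * \<sigma>) 0 - z) \<in> {z. cx z + b * cy z = k} \<inter> {z. \<bar>cy z\<bar> < 5 / 2}"
        using strict[OF z(2), of r] r by (simp add: z(1) side)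
    qed
  qed (use side in \<open>auto simp: side_edge_def\<close>)
next
  case (zigzag s j)
  \<comment> \<open>The mean of the top vertex at height 3 and the corner at height 5/2.\<close>
  define m where "m = point (of_int j + s / 4) (b * (11 / 4 * s))"
  have m: "cx m + b * cy m = k" "s * (cx m - of_int j) = 1 / 4"
    using zigzag by (auto simp: m_def)
  show ?thesis
  proof (rule that[of "{z. 0 < s * (cx z - of_int j) \<and> s * (cx z - of_int j) < 1 / 2}" m])
    show "open {z. 0 < s * (cx z - of_int j) \<and> s * (cx z - of_int j) < 1 / 2}"
      by (intro open_Collect_conj open_Collect_less continuous_intros)
    show "closed E" unfolding zigzag zigzag_edge_def
      by (intro closed_Collect_conj closed_Collect_le closed_Collect_eq continuous_intros)
    show "m \<in> E" using m zigzag by (simp add: zigzag_edge_def)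
    show "\<forall>z\<in>E. \<forall>r\<in>{0<..<1}. z + r *\<^sub>R (m - z) \<in> {z. cx z + b * cy z = k} \<inter>
        {z. 0 < s * (cx z - of_int j) \<and> s * (cx z - of_int j) < 1 / 2}"
    proof (intro ballI)
      fix z and r :: real assume z: "z \<in> E" and "r \<in> {0<..<1}"
      then have r: "0 < r" "r < 1" by auto
      have eq: "cx z + b * cy z = k" and ineq: "0 \<le> s * (cx z - of_int j)" "s * (cx z - of_int j) \<le> 1 / 2"
        using z zigzag by (auto simp: zigzag_edge_def)
      have "cx (z + r *\<^sub>R (m - z)) + b * cy (z + r *\<^sub>R (m - z)) =
          (1 - r) * (cx z + b * cy z) + r * (cx m + b * cy m)" by (simp add: algebra_simps)
      also have "\<dots> = k" unfolding eq m by (simp add: algebra_simps)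
      finally have 1: "cx (z + r *\<^sub>R (m - z)) + b * cy (z + r *\<^sub>R (m - z)) = k" .
      have 2: "s * (cx (z + r *\<^sub>R (m - z)) - of_int j) =
          (1 - r) * (s * (cx z - of_int j)) + r * (s * (cx m - of_int j))" by (simp add: algebra_simps)
      have "0 \<le> (1 - r) * (s * (cx z - of_int j))" "(1 - r) * (s * (cx z - of_int j)) \<le> (1 - r) * (1 / 2)"
        using r ineq by (simp, intro mult_left_mono) auto
      then show "z + r *\<^sub>R (m - z) \<in> {z. cx z + b * cy z = k} \<inter>
          {z. 0 < s * (cx z - of_int j) \<and> s * (cx z - of_int j) < 1 / 2}"
        using 1 r unfolding Int_iff mem_Collect_eq 2 m(2) by (simp add: algebra_simps)
    qed
  qed (use zigzag in \<open>auto simp: zigzag_edge_def\<close>)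
qed

lemma wall_plane_vertical: "wall_plane b k \<in> vertical_planes"
proof -
  have "normal 1 b \<noteq> 0" by (simp add: normal_def complex_eq_iff)
  moreover have "wall_plane b k = {p \<in> H3. inner (normal 1 b) (fst p) = k}"
    by (simp add: wall_plane_def inner_normal)
  ultimately show ?thesis unfolding vertical_planes_def by blast
qed

lemma wall_piece_face:
  assumes "(b, k, E) \<in> walls" "continuous_on UNIV f"
  shows "regular_in (wall_plane b k) (above_graph E f)" "above_graph E f \<noteq> {}"
    "\<not> bounded (above_graph E f)"
proof -
  obtain V m where mV: "open V" "{z. cx z + b * cy z = k} \<inter> V \<subseteq> E" "m \<in> E"
    "\<forall>z\<in>E. \<forall>r\<in>{0<..<1}. z + r *\<^sub>R (m - z) \<in> {z. cx z + b * cy z = k} \<inter> V"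
    "E \<subseteq> {z. cx z + b * cy z = k}" "closed E"
    using wall_edge_nonempty[OF assms(1)] .
  have "E \<subseteq> closure ({z. cx z + b * cy z = k} \<inter> V)"
  proof
    fix z assume "z \<in> E"
    then show "z \<in> closure ({z. cx z + b * cy z = k} \<inter> V)"
      using bspec[OF bspec[OF mV(4)]] by (intro closure_from_center[of z m]) auto
  qed
  then show "regular_in (wall_plane b k) (above_graph E f)"
    using regular_in_vertical[of f E "normal 1 b" k V] mV assms(2)
    by (simp add: wall_plane_def inner_normal)
  show "\<not> bounded (above_graph E f)" using mV(3) by (intro unbounded_above) auto
  then show "above_graph E f \<noteq> {}" by auto
qed

text \<open>The lower bound \<open>f\<close> is a parameter so that the same edges serve the strip,
  with \<open>f = 0\<close>, and the Ford domain, with \<open>f = floor_height\<close>.\<close>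

definition wall_pieces :: "(complex \<Rightarrow> real) \<Rightarrow> ((complex \<times> real) set \<times> (complex \<times> real) set) set" where
  "wall_pieces f = (\<lambda>(b, k, E). (wall_plane b k, above_graph E f)) ` walls"

definition floor_pieces :: "((complex \<times> real) set \<times> (complex \<times> real) set) set" where
  "floor_pieces = (\<lambda>l. (dome l, floor_piece l)) ` forms"

lemma wall_pieces_cases:
  assumes "(H, P) \<in> wall_pieces f"
  obtains b k E where "(b, k, E) \<in> walls" "H = wall_plane b k" "P = above_graph E f"
proof -
  from assms obtain w where "(H, P) = (\<lambda>(b, k, E). (wall_plane b k, above_graph E f)) w" "w \<in> walls"
    unfolding wall_pieces_def by (rule imageE)
  then show ?thesis using that[of "fst w" "fst (snd w)" "snd (snd w)"] by (simp add: split_def)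
qed

lemma wall_piecesI: "(b, k, E) \<in> walls \<Longrightarrow> (wall_plane b k, above_graph E f) \<in> wall_pieces f"
  unfolding wall_pieces_def by (rule image_eqI) auto

lemma floor_pieces_cases:
  assumes "(H, P) \<in> floor_pieces"
  obtains l where "l \<in> forms" "H = dome l" "P = floor_piece l"
  using assms unfolding floor_pieces_def by auto

lemma wall_pieces_face:
  assumes "(H, P) \<in> wall_pieces f" "continuous_on UNIV f"
  shows "H \<in> hyperbolic_planes" "regular_in H P" "P \<noteq> {}"
proof -
  obtain b k E where w: "(b, k, E) \<in> walls" "H = wall_plane b k" "P = above_graph E f"
    using wall_pieces_cases[OF assms(1)] .
  show "H \<in> hyperbolic_planes"
    unfolding w(2) hyperbolic_planes_def using wall_plane_vertical by (rule UnI2)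
  show "regular_in H P" "P \<noteq> {}" using wall_piece_face[OF w(1) assms(2)] w by simp_all
qed

lemma Union_wall_pieces:
  "\<Union> (snd ` wall_pieces f) = above_graph (frontier hex_row) f"
  unfolding frontier_row wall_pieces_def by (auto simp: above_graph_def split_def)

lemma Union_floor_pieces:
  "\<Union> (snd ` floor_pieces) = {(z, t). z \<in> hex_row \<and> t > 0 \<and> t\<^sup>2 = floor_height z}"
proof (rule Set.set_eqI)
  fix p :: "complex \<times> real"
  obtain z t where p: "p = (z, t)" by (cases p)
  have "p \<in> \<Union> (snd ` floor_pieces) \<longleftrightarrow> (\<exists>l\<in>forms. (z, t) \<in> floor_piece l)"
    by (simp add: floor_pieces_def p)
  also have "\<dots> \<longleftrightarrow> (\<exists>l\<in>forms. z \<in> cell l) \<and> t > 0 \<and> t\<^sup>2 = floor_height z"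
    using mem_floor_piece by auto
  also have "(\<exists>l\<in>forms. z \<in> cell l) \<longleftrightarrow> z \<in> hex_row"
    using row_cover[of z] by (auto simp: cell_def)
  finally show "p \<in> \<Union> (snd ` floor_pieces) \<longleftrightarrow>
      p \<in> {(z, t). z \<in> hex_row \<and> t > 0 \<and> t\<^sup>2 = floor_height z}"
    by (simp add: p)
qed

section \<open>Boundary decompositions of the strip and of the Ford domain\<close>

interpretation strip: decomposed_boundary "above_graph hex_row (\<lambda>_. 0)" "wall_pieces (\<lambda>_. 0)"
proof
  show "finite (wall_pieces (\<lambda>_. 0))" using finite_walls by (simp add: wall_pieces_def)
  have "frontier hex_row \<subseteq> hex_row" using closed_row by (simp add: frontier_subset_eq)
  then show "H3 \<inter> frontier (above_graph hex_row (\<lambda>_. 0)) = \<Union> (snd ` wall_pieces (\<lambda>_. 0))"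
    unfolding Union_wall_pieces frontier_above[OF closed_row continuous_on_const]
    by (auto simp: above_graph_def)
qed (simp_all add: wall_pieces_face)

interpretation ford: decomposed_boundary "above_graph hex_row floor_height"
  "wall_pieces floor_height \<union> floor_pieces"
proof
  show "finite (wall_pieces floor_height \<union> floor_pieces)"
    using finite_walls finite_forms by (simp add: wall_pieces_def floor_pieces_def)
  have "frontier hex_row \<subseteq> hex_row" using closed_row by (simp add: frontier_subset_eq)
  then show "H3 \<inter> frontier (above_graph hex_row floor_height) =
      \<Union> (snd ` (wall_pieces floor_height \<union> floor_pieces))"
    unfolding image_Un Union_Un_distrib Union_wall_pieces Union_floor_pieces
      frontier_above[OF closed_row continuous_floor_height]
    by (auto simp: above_graph_def)
  fix H P assume "(H, P) \<in> wall_pieces floor_height \<union> floor_pieces"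
  then have "H \<in> hyperbolic_planes \<and> regular_in H P \<and> P \<noteq> {}"
  proof
    assume "(H, P) \<in> wall_pieces floor_height"
    from wall_pieces_face[OF this continuous_floor_height] show ?thesis by blast
  next
    assume "(H, P) \<in> floor_pieces"
    then obtain l where "l \<in> forms" "H = dome l" "P = floor_piece l" by (rule floor_pieces_cases)
    with floor_piece_face show ?thesis by simp
  qed
  then show "H \<in> hyperbolic_planes" "regular_in H P" "P \<noteq> {}" by auto
qed

text \<open>Cutting off the part below the floor leaves every wall nonempty, so the vertical sides
  of the strip and of the Ford domain lie in the same planes.\<close>

lemma fst_wall_pieces: "fst ` wall_pieces f = fst ` wall_pieces g"
  unfolding wall_pieces_def by (auto simp: image_image split_def)

lemma fst_floor_pieces: "fst ` floor_pieces = bounding_spheres"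
  unfolding bounding_spheres_eq floor_pieces_def by (simp add: image_image)

lemma strip_fundamental_domain:
  "fundamental_domain (stab_infinity PGamma0) (above_graph hex_row (\<lambda>_. 0))"
proof -
  define D where "D = above_graph hex_row (\<lambda>_. 0)"
  have D: "D = hex_row \<times> {0<..}" by (auto simp: D_def above_graph_def)
  have int: "interior D = open_hex_row \<times> {0<..}" by (simp add: D interior_Times interior_row interior_open)
  have "closure open_hex_row = hex_row"
    using row_subset_closure_interior closure_minimal[OF interior_subset closed_row]
    unfolding interior_row by (intro subset_antisym)
  then have cl: "closure (interior D) = hex_row \<times> {0..}"
    unfolding int closure_Times by simp
  have 1: "D = H3 \<inter> closure (interior D)"
    unfolding cl by (auto simp: D H3_def)
  have 2: "connected (interior D)"
    unfolding int by (intro connected_Times connected_open_row) simp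
  have 3: "(\<Union>b\<in>O11. (\<lambda>(z, t). (z + b, t)) ` D) = H3"
  proof (intro equalityI subsetI)
    fix p assume "p \<in> H3"
    then obtain z t where p: "p = (z, t)" "t > 0" by (cases p) (auto simp: H3_def)
    obtain b where "b \<in> O11" "z - b \<in> hex_row" using row_translates_cover .
    then show "p \<in> (\<Union>b\<in>O11. (\<lambda>(z, t). (z + b, t)) ` D)"
      using p by (intro UN_I image_eqI[of _ _ "(z - b, t)"]) (auto simp: D)
  qed (auto simp: D H3_def)
  have 4: "(\<lambda>(z, t). (z + b, t)) ` interior D \<inter> interior D = {}" if "b \<in> O11" "b \<noteq> 0" for b
    using open_row_translates_disjoint[OF that] by (auto simp: int)
  show ?thesis
    unfolding fundamental_domain_stab_infinity D_def[symmetric]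
    by (intro conjI ballI impI 1 2 3 4)
qed

section \<open>Vertices\<close>

definition hex_vertices :: "complex set" where
  "hex_vertices = {point (of_int j) (3 * \<tau>) | j \<tau>. j \<in> {-5..5} \<and> (\<tau> = 1 \<or> \<tau> = - 1)} \<union>
     {point (of_int j + \<sigma> / 2) (5 * \<tau> / 2) | j \<sigma> \<tau>.
        j \<in> {-5..5} \<and> (\<sigma> = 1 \<or> \<sigma> = - 1) \<and> (\<tau> = 1 \<or> \<tau> = - 1)}"

text \<open>\<open>z1\<close> gives the tops of the hexagons; \<open>z2\<close> gives the corners
  with opposite signs \<open>\<sigma>\<close> and \<open>\<tau>\<close>, \<open>z3\<close> those
  with equal signs.\<close>

lemma translated_z_eq_hex_vertices:
  "{(of_int j + s * z) / \<theta> | j s z. j \<in> {-5..5 :: int} \<and> s \<in> {1, -1} \<and> z \<in> {z1, z2, z3}} = hex_vertices"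
proof -
  have coords: "(of_int j + of_real s * z1) / \<theta> = point (of_int j) (3 * s)"
    "(of_int j + of_real s * z2) / \<theta> = point (of_int j + (- s) / 2) (5 * s / 2)"
    "(of_int j + of_real s * z3) / \<theta> = point (of_int j + s / 2) (5 * s / 2)" for j :: int and s :: real
  proof -
    have z: "Re z2 = - 1 / 2" "Im z2 = 5 / 22 * sqrt 11" "Re z3 = 1 / 2" "Im z3 = 5 / 22 * sqrt 11"
      by (simp_all add: z2_def z3_def)
    then show "(of_int j + of_real s * z1) / \<theta> = point (of_int j) (3 * s)"
      "(of_int j + of_real s * z2) / \<theta> = point (of_int j + (- s) / 2) (5 * s / 2)"
      "(of_int j + of_real s * z3) / \<theta> = point (of_int j + s / 2) (5 * s / 2)"
      by (auto intro!: cxy_eqI simp: cx_divide_theta cy_divide_theta z)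
  qed
  show ?thesis
  proof (intro equalityI subsetI)
    fix v assume "v \<in> {(of_int j + s * z) / \<theta> | j s z. j \<in> {-5..5 :: int} \<and> s \<in> {1, -1} \<and> z \<in> {z1, z2, z3}}"
    then obtain j s z where v: "v = (of_int j + s * z) / \<theta>" "j \<in> {-5..5}" "s \<in> {1, -1}" "z \<in> {z1, z2, z3}"
      by blast
    obtain r :: real where r: "s = of_real r" "r = 1 \<or> r = - 1"
      using v(3) by (metis insertE of_real_1 of_real_minus singletonD)
    from r(2) have r': "- r = 1 \<or> - r = - 1" by auto
    from v(4) consider "z = z1" | "z = z2" | "z = z3" by blast
    then show "v \<in> hex_vertices"
    proof cases
      case 1
      then have "v = point (of_int j) (3 * r)" unfolding v(1) r(1) by (simp only: coords)
      then show ?thesis using v(2) r(2) unfolding hex_vertices_def by blast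
    next
      case 2
      then have "v = point (of_int j + (- r) / 2) (5 * r / 2)" unfolding v(1) r(1) by (simp only: coords)
      then show ?thesis using v(2) r(2) r' unfolding hex_vertices_def by blast
    next
      case 3
      then have "v = point (of_int j + r / 2) (5 * r / 2)" unfolding v(1) r(1) by (simp only: coords)
      then show ?thesis using v(2) r(2) unfolding hex_vertices_def by blast
    qed
  next
    fix v assume "v \<in> hex_vertices"
    then obtain j \<tau> where "v = point (of_int j) (3 * \<tau>) \<or> v = point (of_int j + \<tau> / 2) (5 * \<tau> / 2) \<or>
        v = point (of_int j + (- \<tau>) / 2) (5 * \<tau> / 2)"
      and j: "j \<in> {-5..5}" and \<tau>: "\<tau> = 1 \<or> \<tau> = - 1"
      unfolding hex_vertices_def by force
    then have "v = (of_int j + of_real \<tau> * z1) / \<theta> \<or> v = (of_int j + of_real \<tau> * z2) / \<theta> \<or>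
        v = (of_int j + of_real \<tau> * z3) / \<theta>"
      unfolding coords by blast
    then have "\<exists>z\<in>{z1, z2, z3}. v = (of_int j + of_real \<tau> * z) / \<theta>" by blast
    moreover have "complex_of_real \<tau> \<in> {1, -1}" using \<tau> by auto
    ultimately show "v \<in> {(of_int j + s * z) / \<theta> | j s z. j \<in> {-5..5 :: int} \<and> s \<in> {1, -1} \<and> z \<in> {z1, z2, z3}}"
      using j by blast
  qed
qed

lemma wall_through_point_distinct:
  assumes "cx z + b * cy z = cx v + b * cy v" "cx z + b' * cy z = cx v + b' * cy v" "b \<noteq> b'"
  shows "z = v"
proof -
  have "(b - b') * (cy z - cy v) = 0" using assms(1,2) by (simp add: algebra_simps)
  then have "cy z = cy v" using assms(3) by simp
  then show ?thesis using assms(1) by (intro cxy_eqI) auto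
qed

text \<open>Two walls of different slope meet over each vertex, which fixes the base point; the
  known floor height then fixes the third coordinate.\<close>

lemma hex_vertex_data:
  assumes "v \<in> hex_vertices"
  obtains b k E b' k' E' where "(b, k, E) \<in> walls" "v \<in> E" "(b', k', E') \<in> walls" "v \<in> E'" "b \<noteq> b'"
    and "v \<in> hex_row" "floor_height v = 2 / 121"
proof -
  have height: "floor_height v = 2 / 121" if "l \<in> forms" "v \<in> cell l" "val l v - sqn v = 2 / 11" for l
    using floor_height_cell[OF that(1,2)] that(3) by simp
  from assms consider
    (top) j \<tau> where "v = point (of_int j) (3 * \<tau>)" "j \<in> {-5..5}" "\<tau> = 1 \<or> \<tau> = - 1"
  | (corner) j \<sigma> \<tau> where "v = point (of_int j + \<sigma> / 2) (5 * \<tau> / 2)" "j \<in> {-5..5}"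
      "\<sigma> = 1 \<or> \<sigma> = - 1" "\<tau> = 1 \<or> \<tau> = - 1"
    unfolding hex_vertices_def by blast
  then show ?thesis
  proof cases
    case (top j \<tau>)
    have v: "cx v = of_int j" "cy v = 3 * \<tau>" using top by auto
    have w1: "(\<tau>, of_int j + 3 * 1, zigzag_edge \<tau> 1 j) \<in> walls"
      using top by (intro zigzag_in_walls) auto
    have w2: "(- \<tau>, of_int j + 3 * (- 1), zigzag_edge (- \<tau>) (- 1) j) \<in> walls"
      using top by (intro zigzag_in_walls) auto
    have e: "v \<in> zigzag_edge \<tau> 1 j" "v \<in> zigzag_edge (- \<tau>) (- 1) j"
      using top(2,3) v by (auto simp: zigzag_edge_def)
    have "v \<in> hexagon j" using v top(3) by (auto simp: hexagon_def)
    then have row: "v \<in> hex_row" using top(2) by (auto simp: row_eq_hexagons)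
    have "floor_height v = 2 / 121"
    proof (cases "j = 0")
      case True
      have "v \<in> cell (small_form 1 \<tau>)" using v top(3) True by (auto simp: cell_small)
      moreover have "val (small_form 1 \<tau>) v - sqn v = 2 / 11" using v top(3) True by (auto simp: sqn_def)
      ultimately show ?thesis using height small_in_forms[of 1 \<tau>] top(3) by blast
    next
      case False
      have "v \<in> cell (unit_form j)"
      proof (cases "\<bar>j\<bar> \<ge> 2")
        case False
        then have "j = 1 \<or> j = - 1" using \<open>j \<noteq> 0\<close> by auto
        then show ?thesis using v top(3) by (auto simp: cell_inner)
      qed (use \<open>v \<in> hexagon j\<close> top(2) cell_outer in blast)
      moreover have "val (unit_form j) v - sqn v = 2 / 11"
        using v top(3) by (auto simp: sqn_def power2_eq_square)
      ultimately show ?thesis using height unit_in_forms[OF top(2) False] by blast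
    qed
    then show ?thesis using that[OF w1 e(1) w2 e(2) _ row] top(3) by auto
  next
    case (corner j \<sigma> \<tau>)
    have v: "cx v = of_int j + \<sigma> / 2" "cy v = 5 * \<tau> / 2" using corner by auto
    have w: "(\<sigma> * \<tau>, of_int j + 3 * \<sigma>, zigzag_edge (\<sigma> * \<tau>) \<sigma> j) \<in> walls"
      using corner(2,3,4) by (intro zigzag_in_walls) auto
    have e: "v \<in> zigzag_edge (\<sigma> * \<tau>) \<sigma> j"
      using corner(2,3,4) v by (auto simp: zigzag_edge_def)
    have "v \<in> hexagon j" using v corner(3,4) by (auto simp: hexagon_def)
    then have row: "v \<in> hex_row" using corner(2) by (auto simp: row_eq_hexagons)
    have height: "floor_height v = 2 / 121"
    proof (cases "j = 0")
      case True
      have "v \<in> cell (small_form \<sigma> \<tau>)" using v corner(3,4) True by (auto simp: cell_small)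
      moreover have "val (small_form \<sigma> \<tau>) v - sqn v = 2 / 11"
        using corner(3,4) True by (auto simp: v sqn_def power2_eq_square)
      ultimately show ?thesis using height small_in_forms[of \<sigma> \<tau>] corner(3,4) by blast
    next
      case False
      have "v \<in> cell (unit_form j)"
      proof (cases "\<bar>j\<bar> \<ge> 2")
        case False
        then have "j = 1 \<or> j = - 1" using \<open>j \<noteq> 0\<close> by auto
        then show ?thesis using v corner(3,4) by (auto simp: cell_inner)
      qed (use \<open>v \<in> hexagon j\<close> corner(2) cell_outer in blast)
      moreover have "val (unit_form j) v - sqn v = 2 / 11"
        using corner(3,4) by (auto simp: v sqn_def power2_eq_square algebra_simps)
      ultimately show ?thesis using height unit_in_forms[OF corner(2) False] by blast
    qed
    obtain s :: int where s: "\<sigma> = of_int s" "s = 1 \<or> s = - 1" using corner(3) by (metis of_int_1 of_int_minus)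
    \<comment> \<open>The second wall belongs to the neighbouring hexagon, except at an outermost
      corner, where the row ends and the vertical side takes its place.\<close>
    show ?thesis
    proof (cases "j + s \<in> {-5..5}")
      case True
      have "(- \<sigma> * \<tau>, of_int (j + s) + 3 * (- \<sigma>), zigzag_edge (- \<sigma> * \<tau>) (- \<sigma>) (j + s)) \<in> walls"
        using corner(3,4) True by (intro zigzag_in_walls) auto
      moreover have "v \<in> zigzag_edge (- \<sigma> * \<tau>) (- \<sigma>) (j + s)"
        using v s corner(3,4) by (auto simp: zigzag_edge_def)
      moreover have "\<sigma> * \<tau> \<noteq> - \<sigma> * \<tau>" using corner(3,4) by auto
      ultimately show ?thesis using that[OF w e] row height by blast
    next
      case False
      then have "j = 5 * s" using corner(2) s(2) by auto
      then have "v \<in> side_edge \<sigma>" using v s corner(4) by (auto simp: side_edge_def)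
      moreover have "\<sigma> * \<tau> \<noteq> 0" using corner(3,4) by auto
      ultimately show ?thesis using that[OF w e side_in_walls[OF corner(3)]] row height by blast
    qed
  qed
qed


section \<open>Directions along which all active sides agree\<close>

fun slope :: "affine_form \<Rightarrow> complex \<Rightarrow> real" where
  "slope (a, b, e) v = a * cx v + b * cy v"

lemma val_line: "val l (z + r *\<^sub>R v) = val l z + r * slope l v"
  by (cases l) (simp add: algebra_simps)

lemma slope_unit [simp]: "slope (unit_form j) v = 2 * of_int j * cx v"
  and slope_small [simp]: "slope (small_form \<sigma> \<tau>) v = (\<sigma> * cx v + \<tau> * cy v) / 3"
  by (simp_all add: unit_form_def small_form_def add_divide_distrib)

text \<open>Moving \<open>z\<close> along \<open>v\<close> keeps the equations of all walls through
  \<open>z\<close> and keeps all active forms equal, so the lifted curve stays in every active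
  plane. On a zigzag edge \<open>v\<close> runs along the edge, elsewhere it is the
  \<open>cy\<close> direction, except in the triangles of the small spheres with
  \<open>cx z \<noteq> 0\<close>, where it points away from 0.\<close>

lemma nonvertex_direction:
  assumes "z \<in> hex_row" "z \<noteq> 0" "z \<notin> hex_vertices"
  obtains v where "v \<noteq> 0" "\<forall>b k E. (b, k, E) \<in> walls \<longrightarrow> z \<in> E \<longrightarrow> cx v + b * cy v = 0"
    "\<forall>l\<in>forms. \<forall>l'\<in>forms. z \<in> cell l \<longrightarrow> z \<in> cell l' \<longrightarrow> slope l v = slope l' v"
proof (cases "\<exists>\<epsilon>\<in>{1, -1}. \<exists>s\<in>{1, -1}. \<exists>j\<in>{-5..5}. z \<in> zigzag_edge \<epsilon> s j")
  case True
  then obtain \<epsilon> s j where \<epsilon>: "\<epsilon> = 1 \<or> \<epsilon> = - 1" and s: "s = 1 \<or> s = - 1" and j: "j \<in> {-5..5}"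
    and z: "z \<in> zigzag_edge \<epsilon> s j" by blast
  define u where "u = s * (cx z - of_int j)"
  have u: "\<bar>cx z - of_int j\<bar> = u" "\<bar>cy z\<bar> = 3 - u"
    using zigzag_edge_height[OF \<epsilon> s z] by (simp_all add: u_def)
  have x: "cx z = of_int j + s * u" using s by (auto simp: u_def)
  obtain \<tau> where \<tau>: "\<tau> = 1 \<or> \<tau> = - 1" "cy z = \<tau> * \<bar>cy z\<bar>"
    by (cases "cy z \<ge> 0") (use that[of 1] that[of "- 1"] in auto)
  have "u \<noteq> 0"
  proof
    assume "u = 0"
    then have "z = point (of_int j) (3 * \<tau>)" using x u \<tau> by (intro cxy_eqI) auto
    with \<tau> j assms(3) show False unfolding hex_vertices_def by blast
  qed
  moreover have "u \<noteq> 1 / 2"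
  proof
    assume "u = 1 / 2"
    then have "z = point (of_int j + s / 2) (5 * \<tau> / 2)" using x u \<tau> by (intro cxy_eqI) auto
    with \<tau> s j assms(3) show False unfolding hex_vertices_def by blast
  qed
  moreover have "0 \<le> u" "u \<le> 1 / 2" using z by (simp_all add: zigzag_edge_def u_def)
  ultimately have u01: "0 < u" "u < 1 / 2" by simp_all
  have unique: "i = j" if "\<bar>cx z - of_int i\<bar> \<le> 1 / 2" for i
  proof -
    have "\<bar>real_of_int i - of_int j\<bar> < 1" using that u01 u by linarith
    then show ?thesis by linarith
  qed
  have wall: "b = \<epsilon>" if "(b, k, E) \<in> walls" "z \<in> E" for b k E
    using that(1)
  proof (cases rule: walls_cases)
    case (side \<sigma>)
    obtain i :: int where i: "\<sigma> = of_int i" "i = 1 \<or> i = - 1" using side(1) by (metis of_int_1 of_int_minus)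
    have "\<bar>cx z - of_int (5 * i)\<bar> = 1 / 2" using side that(2) i by (auto simp: side_edge_def)
    moreover from this have "5 * i = j" by (intro unique) simp
    ultimately show ?thesis using u u01 by simp
  next
    case (zigzag s' j')
    have z': "z \<in> zigzag_edge b s' j'" using that(2) zigzag by simp
    have "j' = j" using zigzag_edge_height[OF zigzag(1,2) z'] z'
      by (intro unique) (simp add: zigzag_edge_def)
    have "s' * (s * u) \<ge> 0" using z' x by (simp add: zigzag_edge_def \<open>j' = j\<close>)
    then have "s' = s" using s zigzag(2) u01 by auto
    have "cx z + b * cy z = cx z + \<epsilon> * cy z"
      using z z' by (simp add: zigzag_edge_def \<open>j' = j\<close> \<open>s' = s\<close>)
    moreover have "cy z \<noteq> 0" using u u01 by auto
    ultimately show ?thesis by simp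
  qed
  have cell: "l = (if j = 0 then small_form s \<tau> else unit_form j)" if "l \<in> forms" "z \<in> cell l" for l
    using that(1)
  proof (cases l rule: forms_cases)
    case (outer k)
    then have "z \<in> hexagon k" using that(2) cell_outer by blast
    then have "k = j" by (intro unique) (simp add: hexagon_def)
    then show ?thesis using outer by auto
  next
    case (inner \<sigma>)
    have *: "\<bar>cy z\<bar> \<le> 5 * (of_int \<sigma> * cx z)" "of_int \<sigma> * cx z \<le> 3 / 2"
      using that(2) cell_inner inner by (auto simp: mult.assoc)
    have "1 / 2 \<le> of_int \<sigma> * cx z" using *(1) u u01 by linarith
    then have "\<bar>cx z - of_int \<sigma>\<bar> \<le> 1 / 2" using *(2) inner(1) unfolding abs_le_iff by auto
    then have "\<sigma> = j" by (rule unique)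
    then show ?thesis using inner by auto
  next
    case (small \<sigma> \<tau>')
    have *: "0 \<le> \<sigma> * cx z" "5 * (\<sigma> * cx z) \<le> \<tau>' * cy z" "\<sigma> * cx z + \<tau>' * cy z \<le> 3"
      using that(2) cell_small small by (auto simp: mult.assoc)
    have "\<bar>cx z - of_int 0\<bar> \<le> 1 / 2" using * small(1) unfolding abs_le_iff by auto
    then have "j = 0" using unique by blast
    have "\<sigma> * (s * u) \<ge> 0" using * x \<open>j = 0\<close> by simp
    then have "\<sigma> = s" using s small(1) u01 by auto
    have "\<tau>' * (\<tau> * (3 - u)) \<ge> 0" using * \<tau>(2) u(2) by auto
    then have "\<tau>' = \<tau>" using \<tau>(1) small(2) u01 by auto
    then show ?thesis using small \<open>\<sigma> = s\<close> \<open>j = 0\<close> by simp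
  qed
  show ?thesis
  \<comment> \<open>The direction of the line \<open>cx + \<epsilon> * cy = const\<close>, since
    \<open>\<epsilon> - \<epsilon> = 0\<close>; only one form is active here.\<close>
  proof (rule that[of "point \<epsilon> (- 1)"])
    have "cx (point \<epsilon> (- 1)) \<noteq> cx 0" using \<epsilon> by auto
    then show "point \<epsilon> (- 1) \<noteq> 0" by metis
    show "\<forall>b k E. (b, k, E) \<in> walls \<longrightarrow> z \<in> E \<longrightarrow> cx (point \<epsilon> (- 1)) + b * cy (point \<epsilon> (- 1)) = 0"
      using wall by simp
    show "\<forall>l\<in>forms. \<forall>l'\<in>forms. z \<in> cell l \<longrightarrow> z \<in> cell l' \<longrightarrow>
        slope l (point \<epsilon> (- 1)) = slope l' (point \<epsilon> (- 1))"
      using cell by metis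
  qed
next
  case no_zigzag: False
  have side: "b = 0 \<and> \<bar>cx z\<bar> = 11 / 2" if "(b, k, E) \<in> walls" "z \<in> E" for b k E
    using that(1)
  proof (cases rule: walls_cases)
    case (zigzag s j)
    then show ?thesis using no_zigzag that(2) by blast
  qed (use that(2) in \<open>auto simp: side_edge_def\<close>)
  have up: "point 0 1 \<noteq> 0" by (simp add: point_def complex_eq_iff)
  show ?thesis
  \<comment> \<open>Without an active small sphere only unit forms matter, and these do not depend
    on \<open>cy\<close>.\<close>
  proof (cases "\<exists>\<sigma>\<in>{1, -1}. \<exists>\<tau>\<in>{1, -1}. z \<in> cell (small_form \<sigma> \<tau>)")
    case False
    have "slope l (point 0 1) = 0" if "l \<in> forms" "z \<in> cell l" for l
      using that(1)
    proof (cases l rule: forms_cases)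
      case (small \<sigma> \<tau>)
      then show ?thesis using False that(2) by blast
    qed simp_all
    then show ?thesis using side by (intro that[of "point 0 1"] up) auto
  next
    case True
    then obtain \<sigma> \<tau> :: real where \<sigma>: "\<sigma> = 1 \<or> \<sigma> = - 1" and \<tau>: "\<tau> = 1 \<or> \<tau> = - 1"
      and z: "z \<in> cell (small_form \<sigma> \<tau>)" by blast
    have *: "0 \<le> \<sigma> * cx z" "5 * (\<sigma> * cx z) \<le> \<tau> * cy z" "\<sigma> * cx z + \<tau> * cy z \<le> 3"
      using z cell_small[OF \<sigma> \<tau>] by (auto simp: mult.assoc)
    have abs: "5 * \<bar>cx z\<bar> \<le> \<bar>cy z\<bar>" "\<bar>cx z\<bar> \<le> 1 / 2" using * \<sigma> \<tau> by auto
    have no_wall: False if "(b, k, E) \<in> walls" "z \<in> E" for b k E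
      using side[OF that] abs(2) by simp
    have signs: "\<sigma>' * cx z = \<bar>cx z\<bar> \<and> \<tau>' * cy z = \<bar>cy z\<bar>"
      if "\<sigma>' = 1 \<or> \<sigma>' = - 1" "\<tau>' = 1 \<or> \<tau>' = - 1" "z \<in> cell (small_form \<sigma>' \<tau>')" for \<sigma>' \<tau>'
      using that(3) unfolding cell_small[OF that(1,2)] using that(1,2) by auto
    have no_outer: False if "z \<in> cell (unit_form j)" "j \<in> {-5..5}" "\<bar>j\<bar> \<ge> 2" for j
    proof -
      have "\<bar>cx z - of_int j\<bar> \<le> 1 / 2" using that cell_outer by (auto simp: hexagon_def)
      then have "\<bar>real_of_int j\<bar> \<le> 1" using abs(2) by linarith
      then show False using that(3) by linarith
    qed
    show ?thesis
    proof (cases "cx z = 0")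
      case True
      then have "cy z \<noteq> 0" using assms(2) by (metis cxy_0 cxy_eqI)
      have "slope l (point 0 1) = \<tau> / 3" if "l \<in> forms" "z \<in> cell l" for l
        using that(1)
      proof (cases l rule: forms_cases)
        case (outer j)
        then show ?thesis using no_outer that(2) by blast
      next
        case (inner s)
        then have "\<bar>cy z\<bar> \<le> 0" using that(2) cell_inner True by auto
        then show ?thesis using \<open>cy z \<noteq> 0\<close> by simp
      next
        case (small \<sigma>' \<tau>')
        have "\<tau>' * cy z = \<tau> * cy z"
          using signs small that(2) \<sigma> \<tau> z by metis
        then show ?thesis using small \<open>cy z \<noteq> 0\<close> by simp
      qed
      then have "\<forall>l\<in>forms. \<forall>l'\<in>forms. z \<in> cell l \<longrightarrow> z \<in> cell l' \<longrightarrow>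
          slope l (point 0 1) = slope l' (point 0 1)" by metis
      then show ?thesis using no_wall by (intro that[of "point 0 1"] up) blast+
    next
      case False
      \<comment> \<open>The active forms have constant term 0, so their slope in the direction
        \<open>z\<close> equals their common value at \<open>z\<close>.\<close>
      have "slope l z = (\<bar>cx z\<bar> + \<bar>cy z\<bar>) / 3" if "l \<in> forms" "z \<in> cell l" for l
        using that(1)
      proof (cases l rule: forms_cases)
        case (outer j)
        then show ?thesis using no_outer that(2) by blast
      next
        case (inner s)
        then have "\<bar>cy z\<bar> \<le> 5 * of_int s * cx z" using that(2) cell_inner by blast
        then show ?thesis using inner abs(1) by auto
      next
        case (small \<sigma>' \<tau>')
        have "\<sigma>' * cx z = \<bar>cx z\<bar> \<and> \<tau>' * cy z = \<bar>cy z\<bar>"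
          using signs small that(2) by metis
        then show ?thesis using small by simp
      qed
      then have "\<forall>l\<in>forms. \<forall>l'\<in>forms. z \<in> cell l \<longrightarrow> z \<in> cell l' \<longrightarrow>
          slope l z = slope l' z" by metis
      then show ?thesis using no_wall by (intro that[of z] assms(2)) blast+
    qed
  qed
qed

section \<open>Ideal and finite vertices of the Ford domain\<close>

lemma closure_wall_plane: "(z, t) \<in> closure (wall_plane b k) \<Longrightarrow> cx z + b * cy z = k"
proof -
  have "closed {p :: complex \<times> real. cx (fst p) + b * cy (fst p) = k}"
    by (intro closed_Collect_eq continuous_intros)
  then have "closure (wall_plane b k) \<subseteq> {p. cx (fst p) + b * cy (fst p) = k}"
    by (intro closure_minimal) (auto simp: wall_plane_def)
  then show "(z, t) \<in> closure (wall_plane b k) \<Longrightarrow> cx z + b * cy z = k" by auto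
qed

lemma continuous_val [continuous_intros]: "continuous_on S f \<Longrightarrow> continuous_on S (\<lambda>x. val l (f x))"
  by (cases l) (simp, intro continuous_intros)

lemma continuous_sqn [continuous_intros]: "continuous_on S f \<Longrightarrow> continuous_on S (\<lambda>x. sqn (f x))"
  unfolding sqn_def by (intro continuous_intros) auto

lemma closure_dome: "(z, t) \<in> closure (dome l) \<Longrightarrow> 0 \<le> t \<and> 11 * t\<^sup>2 = val l z - sqn z"
proof -
  have "closed {p :: complex \<times> real. 0 \<le> snd p \<and> 11 * (snd p)\<^sup>2 = val l (fst p) - sqn (fst p)}"
    by (intro closed_Collect_conj closed_Collect_le closed_Collect_eq continuous_intros)
  then have "closure (dome l) \<subseteq> {p. 0 \<le> snd p \<and> 11 * (snd p)\<^sup>2 = val l (fst p) - sqn (fst p)}"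
    by (intro closure_minimal) (auto simp: dome_def)
  then show "(z, t) \<in> closure (dome l) \<Longrightarrow> 0 \<le> t \<and> 11 * t\<^sup>2 = val l z - sqn z" by auto
qed

abbreviation ford_pieces :: "((complex \<times> real) set \<times> (complex \<times> real) set) set" where
  "ford_pieces \<equiv> wall_pieces floor_height \<union> floor_pieces"

lemma ford_pieces_cases:
  assumes "(H, P) \<in> ford_pieces"
  obtains (wall) b k E where "(b, k, E) \<in> walls" "H = wall_plane b k" "P = above_graph E floor_height"
    | (floor) l where "l \<in> forms" "H = dome l" "P = floor_piece l"
  using assms wall_pieces_cases floor_pieces_cases by (metis UnE)

lemma ford_closure_piece:
  assumes "(H, P) \<in> ford_pieces" "(z, t) \<in> closure P"
  shows "z \<in> hex_row" "floor_height z \<le> t\<^sup>2" "0 \<le> t"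
proof -
  have "P \<subseteq> \<Union> (snd ` ford_pieces)" using assms(1) by (auto intro: image_eqI[rotated])
  also have "\<dots> \<subseteq> above_graph hex_row floor_height"
    unfolding ford.boundary[symmetric] frontier_above[OF closed_row continuous_floor_height]
    by (auto simp: above_graph_def)
  finally have "closure P \<subseteq> {(z, t). z \<in> hex_row \<and> floor_height z \<le> t\<^sup>2 \<and> 0 \<le> t}"
    using closure_above_subset[OF closed_row continuous_floor_height] closure_mono by blast
  then show "z \<in> hex_row" "floor_height z \<le> t\<^sup>2" "0 \<le> t" using assms(2) by auto
qed

lemma floor_height_0: "floor_height 0 = 0"
proof -
  have "0 \<in> cell (small_form 1 1)" by (simp add: cell_small)
  then have "11 * floor_height 0 = val (small_form 1 1) 0 - sqn 0"
    by (intro floor_height_cell small_in_forms) auto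
  then show ?thesis by (simp add: sqn_def)
qed

text \<open>The planes over the two ends of the row are parallel in the base and carry unbounded
  walls; even their closures have no finite common point.\<close>

lemma infinity_vertex: "None \<in> vertices (above_graph hex_row floor_height)"
  unfolding ford.mem_vertices
proof (intro allI impI)
  fix q assume q: "\<forall>H P. (H, P) \<in> ford_pieces \<longrightarrow> None \<in> ideal_closure P \<longrightarrow> q \<in> ideal_closure H"
  have side: "q \<in> ideal_closure (wall_plane 0 (11 / 2 * \<sigma>))" if "\<sigma> = 1 \<or> \<sigma> = - 1" for \<sigma>
    using q wall_piecesI[OF side_in_walls[OF that], of floor_height]
      wall_piece_face(3)[OF side_in_walls[OF that] continuous_floor_height] by auto
  show "q = None"
  proof (cases q)
    case (Some p)
    obtain z t where p: "p = (z, t)" by (cases p)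
    have "(z, t) \<in> closure (wall_plane 0 (11 / 2 * 1))" "(z, t) \<in> closure (wall_plane 0 (11 / 2 * - 1))"
      using side[of 1] side[of "- 1"] unfolding Some p by simp_all
    from this[THEN closure_wall_plane] show ?thesis by simp
  qed
qed

text \<open>The spheres at 1 and -1 are tangent at the cusp 0. Both floor pieces reach it along the
  axis \<open>cy = 0\<close>, where the scaled squared height at distance \<open>r\<close> is
  \<open>2 * r - r\<^sup>2\<close>.\<close>

lemma origin_vertex: "Some (0, 0) \<in> vertices (above_graph hex_row floor_height)"
  unfolding ford.mem_vertices
proof (intro allI impI)
  fix q assume q: "\<forall>H P. (H, P) \<in> ford_pieces \<longrightarrow> Some (0, 0) \<in> ideal_closure P \<longrightarrow> q \<in> ideal_closure H"
  have dome: "q \<in> ideal_closure (dome (unit_form \<sigma>))" if \<sigma>: "\<sigma> = 1 \<or> \<sigma> = - 1" for \<sigma> :: int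
  proof -
    have form: "unit_form \<sigma> \<in> forms" using \<sigma> by (intro unit_in_forms) auto
    define w where "w r = point (of_int \<sigma> * r) 0" for r
    have "(w r, sqrt ((2 * r - r\<^sup>2) / 11)) \<in> floor_piece (unit_form \<sigma>)" if "0 < r" "r < 1" for r
    proof -
      have "w r \<in> cell (unit_form \<sigma>)" using that \<sigma> by (auto simp: cell_inner w_def)
      moreover have "0 < r * (2 - r)" using that by simp
      then have "0 < 2 * r - r\<^sup>2" by (simp add: power2_eq_square algebra_simps)
      moreover have "val (unit_form \<sigma>) (w r) - sqn (w r) = 2 * r - r\<^sup>2" using \<sigma> by (auto simp: w_def sqn_def)
      ultimately show ?thesis by (simp add: floor_piece_def dome_def)
    qed
    moreover have "\<forall>\<^sub>F r in at_right (0 :: real). r \<in> {0<..<1}" by (rule eventually_at_right_real) simp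
    ultimately have "\<forall>\<^sub>F r in at_right (0 :: real).
        (w r, sqrt ((2 * r - r\<^sup>2) / 11)) \<in> closure (floor_piece (unit_form \<sigma>))"
      using closure_subset by (auto elim!: eventually_mono)
    moreover have "((\<lambda>r. (w r, sqrt ((2 * r - r\<^sup>2) / 11))) \<longlongrightarrow> (w 0, sqrt ((2 * 0 - 0\<^sup>2) / 11))) (at_right 0)"
      unfolding w_def point_def by (intro tendsto_intros) auto
    ultimately have "(w 0, sqrt ((2 * 0 - 0\<^sup>2) / 11)) \<in> closure (floor_piece (unit_form \<sigma>))"
      by (intro Lim_in_closed_set[OF closed_closure]) auto
    moreover have "w 0 = 0" by (intro cxy_eqI) (simp_all add: w_def)
    ultimately have "Some (0, 0) \<in> ideal_closure (floor_piece (unit_form \<sigma>))" by simp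
    moreover have "(dome (unit_form \<sigma>), floor_piece (unit_form \<sigma>)) \<in> ford_pieces"
      using form by (simp add: floor_pieces_def)
    ultimately show ?thesis using q by blast
  qed
  show "q = Some (0, 0)"
  proof (cases q)
    case None
    have "bounded (dome (unit_form 1))" by (intro floor_piece_face(4) unit_in_forms) auto
    then show ?thesis using dome[of 1] None by simp
  next
    case (Some p)
    obtain z t where p: "p = (z, t)" by (cases p)
    have "(z, t) \<in> closure (dome (unit_form 1))" "(z, t) \<in> closure (dome (unit_form (- 1)))"
      using dome[of 1] dome[of "- 1"] by (simp_all add: Some p)
    from this[THEN closure_dome]
    have *: "0 \<le> t" "11 * t\<^sup>2 = 2 * cx z - sqn z" "11 * t\<^sup>2 = - 2 * cx z - sqn z"
      by simp_all
    then have "cx z = 0" by simp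
    moreover have "121 * t\<^sup>2 + (cy z)\<^sup>2 = 0" using * \<open>cx z = 0\<close> by (simp add: sqn_def)
    then have "t = 0 \<and> cy z = 0" by (simp add: add_nonneg_eq_0_iff)
    ultimately show ?thesis by (auto simp: Some p intro: cxy_eqI)
  qed
qed

text \<open>Two walls of different slope determine the base point and an active sphere determines
  the height; boundedness of the sphere excludes infinity.\<close>

lemma hex_vertex_vertex:
  assumes "v \<in> hex_vertices"
  shows "Some (v, sqrt 2 / 11) \<in> vertices (above_graph hex_row floor_height)"
  unfolding ford.mem_vertices
proof (intro allI impI)
  fix q
  assume q: "\<forall>H P. (H, P) \<in> ford_pieces \<longrightarrow> Some (v, sqrt 2 / 11) \<in> ideal_closure P \<longrightarrow> q \<in> ideal_closure H"
  obtain b k E b' k' E' where w: "(b, k, E) \<in> walls" "v \<in> E" "(b', k', E') \<in> walls" "v \<in> E'" "b \<noteq> b'"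
    and v: "v \<in> hex_row" "floor_height v = 2 / 121"
    using hex_vertex_data[OF assms] .
  obtain l where l: "l \<in> forms" "v \<in> cell l" using row_cover[OF v(1)] .
  have t: "(sqrt 2 / 11)\<^sup>2 = floor_height v" using v(2) by (simp add: power_divide)
  have wall: "q \<in> ideal_closure (wall_plane c m) \<and> cx v + c * cy v = m"
    if "(c, m, G) \<in> walls" "v \<in> G" for c m G
  proof -
    have "(v, sqrt 2 / 11) \<in> above_graph G floor_height" using that(2) t by (simp add: above_graph_def)
    then have 1: "Some (v, sqrt 2 / 11) \<in> ideal_closure (above_graph G floor_height)"
      using closure_subset by auto
    have 2: "(wall_plane c m, above_graph G floor_height) \<in> ford_pieces" using wall_piecesI[OF that(1)] by simp
    have "(v, sqrt 2 / 11) \<in> closure (wall_plane c m)"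
      using subsetD[OF ideal_closure_mono[OF ford.piece_subset[OF 2]] 1] by simp
    then show ?thesis using q 1 2 closure_wall_plane by blast
  qed
  have "(v, sqrt 2 / 11) \<in> floor_piece l" using mem_floor_piece[OF l(1)] l(2) t by simp
  then have "Some (v, sqrt 2 / 11) \<in> ideal_closure (floor_piece l)" using closure_subset by auto
  moreover have "(dome l, floor_piece l) \<in> ford_pieces" using l(1) by (simp add: floor_pieces_def)
  ultimately have dome: "q \<in> ideal_closure (dome l)" using q by blast
  show "q = Some (v, sqrt 2 / 11)"
  proof (cases q)
    case None
    then show ?thesis using dome floor_piece_face(4)[OF l(1)] by simp
  next
    case (Some p)
    obtain z s where p: "p = (z, s)" by (cases p)
    have "cx z + b * cy z = cx v + b * cy v" "cx z + b' * cy z = cx v + b' * cy v"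
      using wall[OF w(1,2)] wall[OF w(3,4)] closure_wall_plane[of z s] by (auto simp: Some p)
    then have "z = v" using wall_through_point_distinct w(5) by blast
    have "0 \<le> s" "11 * s\<^sup>2 = val l v - sqn v" using dome closure_dome[of z s l] \<open>z = v\<close> by (auto simp: Some p)
    then have "s\<^sup>2 = (sqrt 2 / 11)\<^sup>2" using floor_height_cell[OF l] t by simp
    then have "s = sqrt 2 / 11" by (rule power2_eq_imp_eq) (use \<open>0 \<le> s\<close> in simp_all)
    then show ?thesis using \<open>z = v\<close> by (simp add: Some p)
  qed
qed

text \<open>Strictly above the floor only walls are active, and moving upwards stays in them. On the
  floor the base point is moved in the direction from \<open>nonvertex_direction\<close> and lifted
  to the active sphere. Height 0 occurs only over the cusp.\<close>

lemma not_vertex: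
  assumes "p \<noteq> Some (0, 0)" "p \<noteq> None" "p \<notin> (\<lambda>v. Some (v, sqrt 2 / 11)) ` hex_vertices"
  shows "p \<notin> vertices (above_graph hex_row floor_height)"
proof
  assume vertex: "p \<in> vertices (above_graph hex_row floor_height)"
  obtain z t where p: "p = Some (z, t)" using assms(2) by auto
  have *: "\<exists>H P. (H, P) \<in> ford_pieces \<and> (z, t) \<in> closure P \<and> Some q \<notin> ideal_closure H" if "q \<noteq> (z, t)" for q
    using vertex that unfolding ford.mem_vertices p by (metis Some_in_ideal_closure option.inject)
  \<comment> \<open>Any other point would serve: a point reached by no piece has an empty family of
    planes and hence every point in the intersection.\<close>
  have "(z, t + 1) \<noteq> (z, t)" by simp
  from *[OF this] obtain H P where HP: "(H, P) \<in> ford_pieces" "(z, t) \<in> closure P" by blast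
  note row = ford_closure_piece[OF HP]
  have "t > 0"
  proof (rule ccontr)
    assume "\<not> t > 0"
    then have "t = 0" using row(3) by simp
    then have "z = 0" using row floor_height_pos[of z] by fastforce
    then show False using assms(1) \<open>t = 0\<close> p by simp
  qed
  have active: "(z, t) \<in> P" if "(H, P) \<in> ford_pieces" "(z, t) \<in> closure P" for H P
    using closure_closedin_H3[OF ford.piece_closedin_H3[OF that(1)], of "(z, t)"] that(2) \<open>t > 0\<close>
    by (simp add: H3_def)
  show False
  proof (cases "t\<^sup>2 = floor_height z")
    case False
    obtain H P where HP: "(H, P) \<in> ford_pieces" "(z, t) \<in> closure P" "Some (z, t + 1) \<notin> ideal_closure H"
      using *[of "(z, t + 1)"] by auto
    from HP(1) show False
    proof (cases rule: ford_pieces_cases)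
      case (wall b k E)
      then have "z \<in> E" using active[OF HP(1,2)] by (simp add: above_graph_def)
      obtain V m where "E \<subseteq> {z. cx z + b * cy z = k}" using wall_edge_nonempty[OF wall(1)] .
      then have "(z, t + 1) \<in> wall_plane b k" using \<open>z \<in> E\<close> \<open>t > 0\<close> by (auto simp: wall_plane_def H3_def)
      then show False using HP(3) wall closure_subset by auto
    next
      case (floor l)
      then show False using active[OF HP(1,2)] mem_floor_piece False by simp
    qed
  next
    case True
    have "z \<noteq> 0" using True floor_height_0 \<open>t > 0\<close> by auto
    have "z \<notin> hex_vertices"
    proof
      assume "z \<in> hex_vertices"
      then have "floor_height z = 2 / 121" by (rule hex_vertex_data)
      then have "t\<^sup>2 = (sqrt 2 / 11)\<^sup>2" using True by (simp add: power_divide)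
      then have "t = sqrt 2 / 11" by (rule power2_eq_imp_eq) (use \<open>t > 0\<close> in simp_all)
      then show False using assms(3) \<open>z \<in> hex_vertices\<close> p by blast
    qed
    then obtain v where v: "v \<noteq> 0" "\<forall>b k E. (b, k, E) \<in> walls \<longrightarrow> z \<in> E \<longrightarrow> cx v + b * cy v = 0"
      "\<forall>l\<in>forms. \<forall>l'\<in>forms. z \<in> cell l \<longrightarrow> z \<in> cell l' \<longrightarrow> slope l v = slope l' v"
      using nonvertex_direction[OF row(1) \<open>z \<noteq> 0\<close>] by metis
    obtain l where l: "l \<in> forms" "z \<in> cell l" using row_cover[OF row(1)] .
    \<comment> \<open>Eleven times the squared height of the active sphere over the moved point; it
      stays positive for small \<open>r\<close> by continuity.\<close>
    define h where "h r = val l (z + r *\<^sub>R v) - sqn (z + r *\<^sub>R v)" for r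
    have "floor_height z > 0" unfolding True[symmetric] using \<open>t > 0\<close> by simp
    then have "h 0 > 0" unfolding h_def scaleR_zero_left add_0_right floor_height_cell[OF l, symmetric] by simp
    moreover have "continuous_on UNIV h" unfolding h_def by (intro continuous_intros)
    then have "(h \<longlongrightarrow> h 0) (at_right 0)"
      by (meson UNIV_I continuous_on_def tendsto_within_subset top_greatest)
    ultimately have "\<forall>\<^sub>F r in at_right 0. 0 < h r" by (intro order_tendstoD(1)) auto
    then obtain r where r: "0 < h r" "r > 0"
      using eventually_happens[OF eventually_conj[OF _ eventually_at_right_less]] by force
    define q where "q = (z + r *\<^sub>R v, sqrt (h r / 11))"
    have "q \<noteq> (z, t)" using r v(1) by (simp add: q_def)
    then obtain H P where HP: "(H, P) \<in> ford_pieces" "(z, t) \<in> closure P" "Some q \<notin> ideal_closure H"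
      using * by blast
    have "q \<in> H"
      using HP(1)
    proof (cases rule: ford_pieces_cases)
      case (wall b k E)
      then have "z \<in> E" using active[OF HP(1,2)] by (simp add: above_graph_def)
      obtain V m where "E \<subseteq> {z. cx z + b * cy z = k}" using wall_edge_nonempty[OF wall(1)] .
      then have "cx z + b * cy z = k" using \<open>z \<in> E\<close> by auto
      moreover have "cx v + b * cy v = 0" using v(2) wall(1) \<open>z \<in> E\<close> by blast
      then have "r * (cx v + b * cy v) = 0" by simp
      ultimately show ?thesis using r by (simp add: wall q_def wall_plane_def H3_def algebra_simps)
    next
      case (floor l')
      then have l': "z \<in> cell l'" using active[OF HP(1,2)] mem_floor_piece by simp
      have "val l' z = val l z" using floor_height_cell[OF l] floor_height_cell[OF floor(1) l'] by simp
      moreover have "slope l' v = slope l v" using v(3) l l' floor(1) by blast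
      ultimately have "val l' (z + r *\<^sub>R v) - sqn (z + r *\<^sub>R v) = h r" by (simp add: val_line h_def)
      then show ?thesis using r by (simp add: floor q_def dome_def)
    qed
    then show False using HP(3) closure_subset by auto
  qed
qed

lemma vertices_ford:
  "vertices (above_graph hex_row floor_height) =
    {Some (0, 0), None} \<union> (\<lambda>v. Some (v, sqrt 2 / 11)) ` hex_vertices"
  using not_vertex infinity_vertex origin_vertex hex_vertex_vertex by blast

text \<open>The witnesses are the strip over \<open>hex_row\<close>, its part above
  \<open>floor_height\<close>, and the planes of the walls.\<close>

theorem mainTheorem20:
  shows "bounding_spheres \<subseteq> isometric_spheres PGamma0 \<and>
    (\<exists>D F \<V>.
       fundamental_domain (stab_infinity PGamma0) D \<and>
       \<V> \<subseteq> vertical_planes \<and> bounded_by D \<V> \<and>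
       F = ford_exterior PGamma0 \<inter> D \<and>
       bounded_by F (\<V> \<union> bounding_spheres) \<and>
       vertices F = {Some (0, 0), None} \<union>
         {Some ((of_int j + s * z) / \<theta>, sqrt 2 / 11) | j s z.
            j \<in> {-5..5 :: int} \<and> s \<in> {1, -1} \<and> z \<in> {z1, z2, z3}})"
proof (intro conjI exI)
  show "bounding_spheres \<subseteq> isometric_spheres PGamma0"
  proof
    fix S assume "S \<in> bounding_spheres"
    then obtain l where "l \<in> forms" "S = dome l" by (auto simp: bounding_spheres_eq)
    moreover obtain A where "A \<in> Gamma0" "A$2$1 \<noteq> 0" "isometric_sphere A = dome l"
      using forms_isometric[OF \<open>l \<in> forms\<close>] by metis
    ultimately show "S \<in> isometric_spheres PGamma0"
      unfolding isometric_spheres_def Union_PGamma0 by blast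
  qed
  show "fundamental_domain (stab_infinity PGamma0) (above_graph hex_row (\<lambda>_. 0))"
    by (rule strip_fundamental_domain)
  show "fst ` wall_pieces (\<lambda>_. 0) \<subseteq> vertical_planes"
    using wall_plane_vertical by (auto elim!: wall_pieces_cases)
  show "bounded_by (above_graph hex_row (\<lambda>_. 0)) (fst ` wall_pieces (\<lambda>_. 0))"
    by (rule strip.bounded_by)
  show "above_graph hex_row floor_height = ford_exterior PGamma0 \<inter> above_graph hex_row (\<lambda>_. 0)"
    by (rule ford_domain_eq[symmetric])
  show "bounded_by (above_graph hex_row floor_height) (fst ` wall_pieces (\<lambda>_. 0) \<union> bounding_spheres)"
    using ford.bounded_by
    unfolding image_Un fst_floor_pieces fst_wall_pieces[of floor_height "\<lambda>_. 0"] .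
  have "(\<lambda>v. Some (v, sqrt 2 / 11)) ` hex_vertices =
      {Some ((of_int j + s * z) / \<theta>, sqrt 2 / 11) | j s z.
         j \<in> {-5..5 :: int} \<and> s \<in> {1, -1} \<and> z \<in> {z1, z2, z3}}"
    unfolding translated_z_eq_hex_vertices[symmetric] by blast
  then show "vertices (above_graph hex_row floor_height) = {Some (0, 0), None} \<union>
      {Some ((of_int j + s * z) / \<theta>, sqrt 2 / 11) | j s z.
         j \<in> {-5..5 :: int} \<and> s \<in> {1, -1} \<and> z \<in> {z1, z2, z3}}"
    unfolding vertices_ford by simp
qed

end
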